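(* Let $p\in(0,p_c(d))$, let $\ell\in\mathbb{R}^d$ be a unit vector, and let $\beta\ge\xi$. 1. For any $d\ge1$ and $\lambda>0$, $$\frac{\ln|Y_t|}{\ln t}\xrightarrow[t\to+\infty]{}\frac{\xi}{\beta}\qquad P\text{-a.s.}$$ 2. If $\lambda=0$, then for any $d\ge2$, $$\limsup_{t\to+\infty}\frac{\ln|Y_t|}{\ln t}=\frac{\xi}{2\beta}\qquad P\text{-a.s.}$$ 3. If $d=1$ and $\lambda=0$, then $$\limsup_{t\to+\infty}\frac{\ln|Y_t|}{\ln t}=\frac12\Big(\frac{\beta}{2\xi}+\frac12\Big)^{-1}\qquad P\text{-a.s.}$$
   Context: Environment. For $x,y\in\mathbb{Z}^d$ write $x\sim y$ if $\|x-y\|_1=1$; $|\cdot|$ is the Euclidean norm. Let $\Omega=\{0,1\}^{\mathbb{Z}^d}$ with the product $\sigma$-field and $\mathbb{P}=\mathcal{B}(p)^{\otimes\mathbb{Z}^d}$, where $\mathcal{B}(p)$ is the Bernoulli law with parameter $p$. For $\omega\in\Omega$, a site $x$ is open if $\omega_x=1$ and closed otherwise. The cluster of an open site $x$ is the set consisting of $x$ and all $y$ connected to $x$ by a nearest-neighbour path all of whose vertices are open; the cluster of a closed site is empty. $C_x=C_x(\omega)$ is the cardinality of the cluster of $x$. $p_c=p_c(d)$ is the critical parameter of this site percolation ($p_c(1)=1$). It is known that for each $p<p_c$ there is $\xi=\xi(p)>0$ with $\lim_{n\to\infty}\frac1n\ln\mathbb{P}(C_x\ge n)=-\xi$ for all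 $x$; this defines $\xi$. Walk. For every $\omega$, $P_\omega$ (the quenched law) is the law of the continuous-time Markov chain $Y=(Y_t)_{t\ge0}$ on $\mathbb{Z}^d$, with right-continuous paths, started at $0$, with generator $$Lf(x)=K\sum_{e\sim 0}e^{\lambda\ell\cdot e-\beta C_x}\,[f(x+e)-f(x)],\qquad K=\Big(\sum_{e\sim0}e^{\lambda\ell\cdot e}\Big)^{-1}.$$ The annealed law is $P=\mathbb{P}\times P_\omega$, i.e. the joint law of $(\omega,Y)$ where $\omega$ has law $\mathbb{P}$ and, given $\omega$, $Y$ has law $P_\omega$. Convention: $\ln 0=-\infty$. *)

theory Defs
  imports "HOL-Probability.Probability"
begin

text \<open>The lattice is \<open>int ^ 'd\<close>, so the dimension is \<open>CARD('d)\<close>, at least 1.\<close>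

definition adj :: "int ^ 'd::finite \<Rightarrow> int ^ 'd \<Rightarrow> bool" where
  "adj x y \<longleftrightarrow> (\<Sum>i\<in>UNIV. \<bar>x $ i - y $ i\<bar>) = 1"

definition to_real :: "int ^ 'd::finite \<Rightarrow> real ^ 'd" where
  "to_real x = (\<chi> i. real_of_int (x $ i))"

type_synonym 'd env = "int ^ 'd \<Rightarrow> bool"

definition perc :: "real \<Rightarrow> 'd::finite env measure" where
  "perc p = (\<Pi>\<^sub>M x\<in>UNIV. measure_pmf (bernoulli_pmf p))"

definition cluster :: "'d::finite env \<Rightarrow> int ^ 'd \<Rightarrow> (int ^ 'd) set" where
  "cluster \<omega> x = {y. \<omega> x \<and> (\<lambda>u v. \<omega> u \<and> \<omega> v \<and> adj u v)\<^sup>*\<^sup>* x y}"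

definition cluster_size :: "'d::finite env \<Rightarrow> int ^ 'd \<Rightarrow> enat" where
  "cluster_size \<omega> x =
     (if finite (cluster \<omega> x) then enat (card (cluster \<omega> x)) else \<infinity>)"

definition percolation_prob :: "'d::finite itself \<Rightarrow> real \<Rightarrow> real" where
  "percolation_prob _ p =
     measure (perc p) {\<omega> \<in> space (perc p :: 'd env measure). cluster_size \<omega> 0 = \<infinity>}"

definition p_crit :: "'d::finite itself \<Rightarrow> real" where
  "p_crit d = Sup {p \<in> {0..1}. percolation_prob d p = 0}"

text \<open>The exponential decay rate \<open>\<xi>(p)\<close> of the cluster size, determined by the limit it
  satisfies. For \<open>p > 0\<close> the probabilities below are positive, so the logarithms are genuine.\<close>

definition cluster_decay_rate :: "'d::finite itself \<Rightarrow> real \<Rightarrow> real \<Rightarrow> bool" where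
  "cluster_decay_rate _ p \<xi> \<longleftrightarrow> 0 < \<xi> \<and>
     (\<forall>x :: int ^ 'd.
        (\<lambda>n. 1 / real n *
               ln (measure (perc p) {\<omega> \<in> space (perc p). enat n \<le> cluster_size \<omega> x}))
        \<longlonglongrightarrow> - \<xi>)"

text \<open>The rate \<open>exp (\<lambda> \<ell>\<cdot>e - \<beta> C\<^sub>x)\<close> up to normalization; it vanishes on an infinite cluster,
  as it should for \<open>\<beta> > 0\<close>.\<close>

definition jump_weight ::
  "real \<Rightarrow> real ^ 'd \<Rightarrow> real \<Rightarrow> 'd::finite env \<Rightarrow> int ^ 'd \<Rightarrow> int ^ 'd \<Rightarrow> real" where
  "jump_weight lam l \<beta> \<omega> x e =
     (case cluster_size \<omega> x of
        enat n \<Rightarrow> exp (lam * (l \<bullet> to_real e) - \<beta> * real n)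
      | \<infinity> \<Rightarrow> 0)"

definition K_norm :: "real \<Rightarrow> real ^ 'd::finite \<Rightarrow> real" where
  "K_norm lam l = inverse (\<Sum>e | adj e 0. exp (lam * (l \<bullet> to_real e)))"

definition generator ::
  "real \<Rightarrow> real ^ 'd \<Rightarrow> real \<Rightarrow> 'd::finite env \<Rightarrow> (int ^ 'd \<Rightarrow> real) \<Rightarrow> int ^ 'd \<Rightarrow> real" where
  "generator lam l \<beta> \<omega> f x =
     K_norm lam l * (\<Sum>e | adj e 0. jump_weight lam l \<beta> \<omega> x e * (f (x + e) - f x))"

text \<open>For \<open>\<beta> \<ge> 0\<close> the total jump rate at every site is at most 1, so the generator \<open>L\<close> is a bounded
  operator on bounded functions, and the semigroup it generates is \<open>exp (t L)\<close>, given by its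
  power series; the transition probability \<open>p\<^sub>t(x, y)\<close> is \<open>exp (t L)\<close> applied to the
  indicator function of \<open>y\<close>, at \<open>x\<close>.\<close>

definition transition_prob ::
  "real \<Rightarrow> real ^ 'd \<Rightarrow> real \<Rightarrow> 'd::finite env \<Rightarrow> real \<Rightarrow> int ^ 'd \<Rightarrow> int ^ 'd \<Rightarrow> real" where
  "transition_prob lam l \<beta> \<omega> t x y =
     (\<Sum>n. t ^ n / fact n * (generator lam l \<beta> \<omega> ^^ n) (indicator {y}) x)"

text \<open>Right-continuous paths with times in \<open>[0, \<infinity>)\<close>, with the \<open>\<sigma>\<close>-algebra generated by the
  coordinates. The topology of \<open>int ^ 'd\<close> is discrete.\<close>

definition path_space :: "(real \<Rightarrow> int ^ 'd::finite) measure" where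
  "path_space =
     restrict_space (\<Pi>\<^sub>M t\<in>{0..}. count_space UNIV) {Y. \<forall>t\<ge>0. continuous (at_right t) Y}"

text \<open>\<open>Q\<close> is the law of the Markov chain started at 0: its finite-dimensional distributions are
  prescribed by the transition probabilities.\<close>

definition quenched_law ::
  "real \<Rightarrow> real ^ 'd \<Rightarrow> real \<Rightarrow> 'd::finite env \<Rightarrow> (real \<Rightarrow> int ^ 'd) measure \<Rightarrow> bool" where
  "quenched_law lam l \<beta> \<omega> Q \<longleftrightarrow>
     prob_space Q \<and> sets Q = sets path_space \<and>
     (\<forall>n (t :: nat \<Rightarrow> real) x.
        t 0 = 0 \<longrightarrow> (\<forall>i<n. t i \<le> t (Suc i)) \<longrightarrow>
        measure Q {Y \<in> space Q. \<forall>i\<le>n. Y (t i) = x i} =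
          (if x 0 = 0
           then \<Prod>i<n. transition_prob lam l \<beta> \<omega> (t (Suc i) - t i) (x i) (x (Suc i))
           else 0))"

text \<open>The joint law of \<open>(\<omega>, Y)\<close> when \<open>\<omega>\<close> has law \<open>perc p\<close> and, given \<open>\<omega>\<close>, \<open>Y\<close> has law \<open>Q \<omega>\<close>.\<close>

definition annealed_law ::
  "real \<Rightarrow> ('d env \<Rightarrow> (real \<Rightarrow> int ^ 'd) measure) \<Rightarrow>
     ('d::finite env \<times> (real \<Rightarrow> int ^ 'd)) measure" where
  "annealed_law p Q =
     perc p \<bind> (\<lambda>\<omega>. distr (Q \<omega>) (perc p \<Otimes>\<^sub>M path_space) (\<lambda>Y. (\<omega>, Y)))"

text \<open>The logarithm with \<open>ln 0 = -\<infinity>\<close>; it is only applied to nonnegative reals.\<close>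

definition eln :: "real \<Rightarrow> ereal" where
  "eln r = (if r = 0 then -\<infinity> else ereal (ln r))"

definition log_ratio :: "(real \<Rightarrow> int ^ 'd::finite) \<Rightarrow> real \<Rightarrow> ereal" where
  "log_ratio Y t = eln (norm (to_real (Y t))) / ereal (ln t)"

end

theory Submission
  imports Defs "HOL-Real_Asymp.Real_Asymp"
begin

text \<open>
  The trap factor \<open>exp (- \<beta> C\<^sub>x)\<close> depends only on the current site, so \<open>Y\<close> is a time change of a
  random walk \<open>X\<close> with independent steps that is independent of the environment: \<open>Y\<close> sits at \<open>X\<^sub>n\<close>
  during \<open>[S\<^sub>n, S\<^sub>n\<^sub>+\<^sub>1)\<close>, where \<open>S\<^sub>n = (\<Sum>k<n. H\<^sub>k exp (\<beta> C(X\<^sub>k)))\<close> with standard exponential \<open>H\<^sub>k\<close>.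
  A renewal equation with a unique bounded solution shows that this process has the transition
  probabilities \<open>exp (t L)\<close>, so it has the quenched law.

  Let \<open>\<alpha> = 1\<close>, except \<open>\<alpha> = 1/2\<close> for the symmetric walk on the line; \<open>X\<close> visits \<open>n\<close> to the power
  \<open>\<alpha> + o(1)\<close> sites in \<open>n\<close> steps. Then \<open>S\<^sub>n\<close> is \<open>n\<close> to the power \<open>\<sigma> + o(1)\<close>,
  \<open>\<sigma> = 1 - \<alpha> + \<alpha> \<beta> / \<xi>\<close>. The upper bound comes from moments of order \<open>a < \<xi> / \<beta> \<le> 1\<close>, the lower bound
  from Chebyshev's inequality for the number of steps spent in clusters of size about
  \<open>\<alpha> ln n / \<xi>\<close>. Since \<open>|X\<^sub>n|\<close> has exponent \<open>\<gamma> = 1\<close> (drift) or \<open>\<gamma> = 1/2\<close> (no drift), \<open>|Y\<^sub>t|\<close>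
  has exponent \<open>\<gamma> / \<sigma>\<close>.
\<close>

text \<open>The obstacle in the lower bound for the clock is dependence: clusters seen from nearby
  sites are correlated. Given the walk, the events that the clusters at \<open>X_j\<close> and
  \<open>X_k\<close> have at least \<open>m\<close> sites are independent unless the two sites are
  within distance \<open>2 m\<close>, and the expected number of such close pairs is at most
  \<open>2 n G\<close>, where \<open>G\<close> is a Green sum. If \<open>q\<close> is the
  probability of a large cluster, Chebyshev's inequality gives a bound of order
  \<open>G / (q n)\<close>. As \<open>G\<close> is about \<open>n^(1 - \<alpha>)\<close>, this is
  small once \<open>q\<close> exceeds \<open>n^(- \<alpha>)\<close> by a small power of
  \<open>n\<close>, which fixes the admissible \<open>m\<close>. Most of these bounds are small
  negative powers of \<open>n\<close>, summable only along \<open>n = 2^k\<close>. The clock is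
  monotone, so its gaps can be filled; the distance of the walk from the origin is not, and without
  drift its dyadic lower bound gives a limsup only. The assumption
  \<open>\<xi> \<le> \<beta>\<close> makes moment orders below \<open>\<xi> / \<beta>\<close> at
  most 1, where powers are subadditive, and gives \<open>\<sigma> \<ge> 1\<close>. The family
  \<open>Q\<close> is arbitrary; uniqueness of the law on path space permits replacing it by the
  explicit construction.\<close>

section \<open>Exploration of clusters in rounds\<close>

primrec reach :: "'d::finite env \<Rightarrow> int ^ 'd \<Rightarrow> nat \<Rightarrow> (int ^ 'd) set" where
  "reach \<omega> x 0 = (if \<omega> x then {x} else {})"
| "reach \<omega> x (Suc k) = reach \<omega> x k \<union> {v. \<omega> v \<and> (\<exists>u\<in>reach \<omega> x k. adj u v)}"

text \<open>The sup norm lets differences and disjointness be checked coordinatewise; the sites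
  found in \<open>r\<close> rounds lie in the box of radius \<open>r\<close>.\<close>

definition sbox :: "int ^ 'd::finite \<Rightarrow> nat \<Rightarrow> (int ^ 'd) set" where
  "sbox x r = {y. \<forall>i. \<bar>y $ i - x $ i\<bar> \<le> int r}"

lemma finite_sbox: "finite (sbox x r)"
proof (rule finite_subset)
  show "sbox x r \<subseteq> vec_lambda ` (PiE UNIV (\<lambda>i. {x $ i - int r..x $ i + int r}))"
  proof
    fix y assume "y \<in> sbox x r"
    then have *: "\<bar>y $ i - x $ i\<bar> \<le> int r" for i by (simp add: sbox_def)
    have "vec_nth y \<in> PiE UNIV (\<lambda>i. {x $ i - int r..x $ i + int r})"
      unfolding PiE_UNIV_domain
    proof (rule Pi_I)
      fix i show "y $ i \<in> {x $ i - int r..x $ i + int r}" using *[of i] by auto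
    qed
    then show "y \<in> vec_lambda ` (PiE UNIV (\<lambda>i. {x $ i - int r..x $ i + int r}))"
      by (intro image_eqI[where x="vec_nth y"]) (simp_all add: vec_nth_inverse)
  qed
  show "finite (vec_lambda ` (PiE UNIV (\<lambda>i. {x $ i - int r..x $ i + int r})))"
    by (intro finite_imageI finite_PiE) auto
qed

lemma sbox_self: "x \<in> sbox x r"
  by (simp add: sbox_def)

lemma adj_sbox: "adj u v \<Longrightarrow> v \<in> sbox u 1"
proof -
  assume "adj u v"
  then have s: "(\<Sum>i\<in>UNIV. \<bar>u $ i - v $ i\<bar>) = 1" by (simp add: adj_def)
  have "\<bar>u $ i - v $ i\<bar> \<le> (\<Sum>i\<in>UNIV. \<bar>u $ i - v $ i\<bar>)" for i
    by (rule member_le_sum) auto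
  then have "\<bar>v $ i - u $ i\<bar> \<le> 1" for i using s by (metis abs_minus_commute)
  then show ?thesis by (simp add: sbox_def)
qed

lemma reach_open: "v \<in> reach \<omega> x k \<Longrightarrow> \<omega> v"
  by (induction k) (auto split: if_splits)

lemma reach_sbox: "reach \<omega> x k \<subseteq> sbox x k"
proof (induction k)
  case 0 then show ?case by (auto simp: sbox_self)
next
  case (Suc k)
  show ?case
  proof
    fix v assume "v \<in> reach \<omega> x (Suc k)"
    then obtain u where u: "u \<in> sbox x k" "v = u \<or> adj u v" using Suc by auto
    have "\<bar>v $ i - u $ i\<bar> \<le> 1" for i using u(2) adj_sbox[of u v] by (auto simp: sbox_def)
    moreover have "\<bar>u $ i - x $ i\<bar> \<le> int k" for i using u(1) by (auto simp: sbox_def)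
    ultimately have vx: "\<bar>v $ i - u $ i\<bar> \<le> 1 \<and> \<bar>u $ i - x $ i\<bar> \<le> int k" for i by blast
    have "\<bar>v $ i - x $ i\<bar> \<le> int (Suc k)" for i using vx[of i] by linarith
    then show "v \<in> sbox x (Suc k)" by (auto simp: sbox_def)
  qed
qed

lemma finite_reach: "finite (reach \<omega> x k)"
  using finite_subset[OF reach_sbox finite_sbox] .

lemma reach_cong:
  assumes "\<And>y. y \<in> sbox x k \<Longrightarrow> \<omega> y = \<omega>' y"
  shows "reach \<omega> x k = reach \<omega>' x k"
  using assms
proof (induction k)
  case 0 then show ?case using sbox_self[of x 0] by auto
next
  case (Suc k)
  have "sbox x k \<subseteq> sbox x (Suc k)" by (fastforce simp: sbox_def intro: order_trans)
  then have IH: "reach \<omega> x k = reach \<omega>' x k" using Suc by blast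
  have "v \<in> sbox x (Suc k)" if "u \<in> reach \<omega> x k" "adj u v" for u v
  proof -
    have "\<bar>v $ i - u $ i\<bar> \<le> 1" for i using that(2) adj_sbox[of u v] by (auto simp: sbox_def)
    moreover have "\<bar>u $ i - x $ i\<bar> \<le> int k" for i
      using that(1) reach_sbox[of \<omega> x k] by (auto simp: sbox_def)
    ultimately have vx: "\<bar>v $ i - u $ i\<bar> \<le> 1 \<and> \<bar>u $ i - x $ i\<bar> \<le> int k" for i by blast
    have "\<bar>v $ i - x $ i\<bar> \<le> int (Suc k)" for i using vx[of i] by linarith
    then show ?thesis by (auto simp: sbox_def)
  qed
  then show ?case using IH Suc.prems by auto
qed

text \<open>The next round depends only on the set reached so far, so a round without gain repeats
  forever.\<close>

lemma reach_stationary: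
  assumes "reach \<omega> x (Suc k) = reach \<omega> x k" shows "k \<le> j \<Longrightarrow> reach \<omega> x j = reach \<omega> x k"
proof (induction j rule: dec_induct)
  case (step j)
  have "reach \<omega> x (Suc j) = reach \<omega> x j \<union> {v. \<omega> v \<and> (\<exists>u\<in>reach \<omega> x j. adj u v)}" by simp
  also have "\<dots> = reach \<omega> x (Suc k)" using step by simp
  finally show ?case using assms by simp
qed simp

lemma reach_mono: "k \<le> j \<Longrightarrow> reach \<omega> x k \<subseteq> reach \<omega> x j"
  by (rule lift_Suc_mono_le[of "reach \<omega> x"]) auto

text \<open>Each round before stabilization gains at least one site, so the number of rounds bounds
  the size from below until the exploration stops.\<close>

lemma reach_growth: "Suc k \<le> card (reach \<omega> x k) \<or> reach \<omega> x (Suc k) = reach \<omega> x k"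
proof (induction k)
  case 0 then show ?case by auto
next
  case (Suc k)
  show ?case
  proof (cases "reach \<omega> x (Suc k) = reach \<omega> x k")
    case True
    then have "reach \<omega> x (Suc (Suc k)) = reach \<omega> x (Suc k)"
      using reach_stationary[OF True, of "Suc (Suc k)"] by simp
    then show ?thesis by blast
  next
    case False
    then have "reach \<omega> x k \<subset> reach \<omega> x (Suc k)" by auto
    then have "card (reach \<omega> x k) < card (reach \<omega> x (Suc k))"
      by (intro psubset_card_mono finite_reach)
    then show ?thesis using Suc False by linarith
  qed
qed

lemma cluster_eq_reach: "cluster \<omega> x = (\<Union>k. reach \<omega> x k)"
proof (intro equalityI subsetI)
  fix y assume "y \<in> cluster \<omega> x"
  then have x: "\<omega> x" and "(\<lambda>u v. \<omega> u \<and> \<omega> v \<and> adj u v)\<^sup>*\<^sup>* x y" by (auto simp: cluster_def)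
  from this(2) show "y \<in> (\<Union>k. reach \<omega> x k)"
  proof induction
    case base then show ?case using x by (auto intro!: exI[of _ 0])
  next
    case (step y z)
    then obtain k where "y \<in> reach \<omega> x k" by auto
    then have "z \<in> reach \<omega> x (Suc k)" using step by auto
    then show ?case by blast
  qed
next
  have "y \<in> reach \<omega> x k \<Longrightarrow> y \<in> cluster \<omega> x" for k y
  proof (induction k arbitrary: y)
    case 0 then show ?case by (auto simp: cluster_def split: if_splits)
  next
    case (Suc k)
    show ?case
    proof (cases "y \<in> reach \<omega> x k")
      case False
      then obtain u where u: "\<omega> y" "u \<in> reach \<omega> x k" "adj u y" using Suc by auto
      then have "u \<in> cluster \<omega> x" "\<omega> u" using Suc reach_open by blast+
      then show ?thesis using u
        by (auto simp: cluster_def intro: rtranclp.rtrancl_into_rtrancl)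
    qed (use Suc in auto)
  qed
  then show "\<And>y. y \<in> (\<Union>k. reach \<omega> x k) \<Longrightarrow> y \<in> cluster \<omega> x" by blast
qed

text \<open>The exploration gains a site in every round until it stops, so \<open>m\<close> rounds decide whether the
  cluster has \<open>m\<close> sites; this makes the event local.\<close>

lemma cluster_size_ge_iff: "enat m \<le> cluster_size \<omega> x \<longleftrightarrow> m \<le> card (reach \<omega> x m)"
proof
  assume "m \<le> card (reach \<omega> x m)"
  moreover have "card (reach \<omega> x m) \<le> card (cluster \<omega> x)" if "finite (cluster \<omega> x)"
    using that by (intro card_mono) (auto simp: cluster_eq_reach)
  ultimately show "enat m \<le> cluster_size \<omega> x" by (auto simp: cluster_size_def)
next
  assume a: "enat m \<le> cluster_size \<omega> x"
  from reach_growth[of m \<omega> x] show "m \<le> card (reach \<omega> x m)"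
  proof
    assume st: "reach \<omega> x (Suc m) = reach \<omega> x m"
    have "reach \<omega> x k \<subseteq> reach \<omega> x m" for k
      using reach_stationary[OF st] reach_mono by (metis le_cases order_refl)
    then have "cluster \<omega> x = reach \<omega> x m" unfolding cluster_eq_reach by blast
    then show ?thesis using a finite_reach[of \<omega> x m] by (auto simp: cluster_size_def)
  qed simp
qed

text \<open>Stationarity of the environment enters through this pathwise identity; it makes the law
  of the cluster size the same at all sites.\<close>

lemma reach_translate: "reach (\<lambda>z. \<omega> (z + a)) x k = (\<lambda>z. z - a) ` reach \<omega> (x + a) k"
proof (induction k)
  case (Suc k)
  have adj: "adj (u - a) v \<longleftrightarrow> adj u (v + a)" for u v by (simp add: adj_def algebra_simps)
  have "v \<in> reach (\<lambda>z. \<omega> (z + a)) x (Suc k) \<longleftrightarrow> v + a \<in> reach \<omega> (x + a) (Suc k)" for v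
  proof -
    have "v \<in> (\<lambda>z. z - a) ` reach \<omega> (x + a) k \<longleftrightarrow> v + a \<in> reach \<omega> (x + a) k"
      by (force simp: image_iff)
    then show ?thesis using Suc by (auto simp: adj)
  qed
  then show ?case
    by (metis (no_types, lifting) add_diff_cancel_right' diff_add_cancel image_iff set_eqI)
qed auto

lemma cluster_size_translate:
  "enat m \<le> cluster_size (\<lambda>z. \<omega> (z + a)) x \<longleftrightarrow> enat m \<le> cluster_size \<omega> (x + a)"
  unfolding cluster_size_ge_iff reach_translate
  by (subst card_image) (auto simp: inj_on_def)

section \<open>Product measures\<close>

text \<open>The joint law of the coordinates is the product measure itself and each marginal is
  \<open>N\<close>; this is the characterization of independence by laws.\<close>

lemma indep_vars_coordinates:
  assumes "prob_space N"
  shows "prob_space.indep_vars (PiM (UNIV :: 'i set) (\<lambda>_. N)) (\<lambda>_. N) (\<lambda>i \<omega>. \<omega> i) UNIV"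
proof -
  interpret N: prob_space N by fact
  interpret P: product_prob_space "\<lambda>_. N" "UNIV :: 'i set" ..
  have "distr (PiM UNIV (\<lambda>_. N)) (PiM UNIV (\<lambda>_. N)) (\<lambda>\<omega>. \<lambda>i\<in>UNIV. \<omega> i) = PiM (UNIV :: 'i set) (\<lambda>_. N)"
    by (simp add: distr_id2 restrict_UNIV)
  moreover have "distr (PiM UNIV (\<lambda>_. N)) N (\<lambda>\<omega>. \<omega> i) = N" for i :: 'i
    using P.PiM_component[of i] by simp
  ultimately show ?thesis
    by (subst prob_space.indep_vars_iff_distr_eq_PiM') (auto intro!: prob_space_PiM assms)
qed

abbreviation site :: "real \<Rightarrow> bool measure" where "site p \<equiv> measure_pmf (bernoulli_pmf p)"

lemma prob_space_perc: "prob_space (perc p)"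
  unfolding perc_def by (intro prob_space_PiM measure_pmf.prob_space_axioms)

lemma space_perc [simp]: "space (perc p) = UNIV"
  by (auto simp: perc_def space_PiM)

text \<open>A local event is a finite union of cylinders, one for each pattern \<open>A\<close> of
  open sites in \<open>F\<close>. A general index set \<open>J\<close> serves both the full
  environment and its restrictions.\<close>

lemma sets_PiM_local:
  fixes P :: "('i \<Rightarrow> bool) \<Rightarrow> bool"
  assumes F: "finite F" "F \<subseteq> J" and P: "\<And>\<omega> \<omega>'. (\<forall>y\<in>F. \<omega> y = \<omega>' y) \<Longrightarrow> P \<omega> = P \<omega>'"
  shows "{\<omega> \<in> space (PiM J (\<lambda>_. site p)). P \<omega>} \<in> sets (PiM J (\<lambda>_. site p))"
proof -
  have "{\<omega> \<in> space (PiM J (\<lambda>_. site p)). P \<omega>} =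
    (\<Union>A\<in>{A\<in>Pow F. P (\<lambda>y. y \<in> A)}. {\<omega> \<in> space (PiM J (\<lambda>_. site p)). \<forall>y\<in>F. \<omega> y = (y \<in> A)})"
    (is "?L = ?R")
  proof (intro equalityI subsetI)
    fix \<omega> assume w: "\<omega> \<in> ?L"
    let ?A = "{y\<in>F. \<omega> y}"
    have "P (\<lambda>y. y \<in> ?A)" using w P[of "\<lambda>y. y \<in> ?A" \<omega>] by auto
    then show "\<omega> \<in> ?R" using w by (intro UN_I[of ?A]) auto
  next
    fix \<omega> assume w: "\<omega> \<in> ?R"
    then obtain A where "P (\<lambda>y. y \<in> A)" "\<forall>y\<in>F. \<omega> y = (y \<in> A)" "\<omega> \<in> space (PiM J (\<lambda>_. site p))" by auto
    then show "\<omega> \<in> ?L" using P[of \<omega> "\<lambda>y. y \<in> A"] by auto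
  qed
  moreover have "{\<omega> \<in> space (PiM J (\<lambda>_. site p)). \<forall>y\<in>F. \<omega> y = (y \<in> A)} \<in> sets (PiM J (\<lambda>_. site p))" for A
  proof (rule sets.sets_Collect_finite_All[OF _ F(1)])
    fix y assume "y \<in> F"
    then have y: "y \<in> J" using F by auto
    have "(\<lambda>\<omega>. \<omega> y) -` {y \<in> A} \<inter> space (PiM J (\<lambda>_. site p)) \<in> sets (PiM J (\<lambda>_. site p))"
      by (rule measurable_sets[OF measurable_component_singleton[OF y]]) simp
    also have "(\<lambda>\<omega>. \<omega> y) -` {y \<in> A} \<inter> space (PiM J (\<lambda>_. site p)) = {\<omega> \<in> space (PiM J (\<lambda>_. site p)). \<omega> y = (y \<in> A)}"
      by auto
    finally show "{\<omega> \<in> space (PiM J (\<lambda>_. site p)). \<omega> y = (y \<in> A)} \<in> sets (PiM J (\<lambda>_. site p))" .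
  qed
  ultimately show ?thesis using F by auto
qed

lemma perc_local_measurable:
  assumes F: "finite F" and P: "\<And>\<omega> \<omega>'. (\<forall>y\<in>F. \<omega> y = \<omega>' y) \<Longrightarrow> P \<omega> = P \<omega>'"
  shows "{\<omega>. P \<omega>} \<in> sets (perc p)"
  using sets_PiM_local[of F UNIV P p, OF F _ P] by (auto simp: perc_def space_PiM)

text \<open>Restrictions of the environment to disjoint sets are independent, and a local event can
  be read off the restriction whatever default value \<open>restrict\<close> takes
  elsewhere.\<close>

lemma perc_local_indep:
  assumes F: "finite F" and P: "\<And>\<omega> \<omega>'. (\<forall>y\<in>F. \<omega> y = \<omega>' y) \<Longrightarrow> P \<omega> = P \<omega>'"
    and G: "finite G" and R: "\<And>\<omega> \<omega>'. (\<forall>y\<in>G. \<omega> y = \<omega>' y) \<Longrightarrow> R \<omega> = R \<omega>'"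
    and disj: "F \<inter> G = {}"
  shows "measure (perc p) {\<omega>. P \<omega> \<and> R \<omega>} = measure (perc p) {\<omega>. P \<omega>} * measure (perc p) {\<omega>. R \<omega>}"
proof -
  interpret M: prob_space "perc p" by (rule prob_space_perc)
  have "M.indep_vars (\<lambda>_. site p) (\<lambda>i \<omega>. \<omega> i) UNIV"
    unfolding perc_def by (rule indep_vars_coordinates) (rule measure_pmf.prob_space_axioms)
  from M.indep_var_restrict[OF this disj]
  have "M.indep_var (PiM F (\<lambda>_. site p)) (\<lambda>\<omega>. restrict \<omega> F) (PiM G (\<lambda>_. site p)) (\<lambda>\<omega>. restrict \<omega> G)"
    by simp
  note indep = this
  define A where "A = {\<omega> \<in> space (PiM F (\<lambda>_. site p)). P \<omega>}"
  define B where "B = {\<omega> \<in> space (PiM G (\<lambda>_. site p)). R \<omega>}"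
  have A: "A \<in> sets (PiM F (\<lambda>_. site p))"
    unfolding A_def by (rule sets_PiM_local[OF F order_refl]) (rule P)
  have B: "B \<in> sets (PiM G (\<lambda>_. site p))"
    unfolding B_def by (rule sets_PiM_local[OF G order_refl]) (rule R)
  have PR: "P (restrict \<omega> F) = P \<omega>" "R (restrict \<omega> G) = R \<omega>" for \<omega>
    by (rule P, simp) (rule R, simp)
  have "(\<lambda>\<omega>. (restrict \<omega> F, restrict \<omega> G)) -` (A \<times> B) \<inter> space (perc p) = {\<omega>. P \<omega> \<and> R \<omega>}"
    "(\<lambda>\<omega>. restrict \<omega> F) -` A \<inter> space (perc p) = {\<omega>. P \<omega>}"
    "(\<lambda>\<omega>. restrict \<omega> G) -` B \<inter> space (perc p) = {\<omega>. R \<omega>}"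
    unfolding A_def B_def space_PiM by (auto simp: PR)
  then show ?thesis using M.indep_varD[OF indep A B] by simp
qed

abbreviation "big \<omega> x m \<equiv> enat m \<le> cluster_size \<omega> x"

lemma big_local: "(\<forall>y\<in>sbox x m. \<omega> y = \<omega>' y) \<Longrightarrow> big \<omega> x m = big \<omega>' x m"
  unfolding cluster_size_ge_iff using reach_cong[of x m \<omega> \<omega>'] by auto

lemma big_measurable: "{\<omega>. big \<omega> x m} \<in> sets (perc p)"
  by (rule perc_local_measurable[OF finite_sbox[of x m]]) (rule big_local)

lemma big_indep:
  assumes "sbox x m \<inter> sbox y m = {}"
  shows "measure (perc p) {\<omega>. big \<omega> x m \<and> big \<omega> y m} =
    measure (perc p) {\<omega>. big \<omega> x m} * measure (perc p) {\<omega>. big \<omega> y m}"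
  by (rule perc_local_indep[OF finite_sbox[of x m] _ finite_sbox[of y m] _ assms])
    (erule big_local)+

lemma big_translate:
  fixes x :: "int ^ 'd::finite"
  shows "measure (perc p) {\<omega>. big \<omega> x m} = measure (perc p) {\<omega>. big \<omega> (0 :: int ^ 'd) m}"
proof -
  have "distr (perc p) (perc p) (\<lambda>\<omega>. \<lambda>z\<in>UNIV. \<omega> (z + x)) = (perc p :: 'd env measure)"
    unfolding perc_def
    by (rule distr_PiM_reindex[where f="\<lambda>z. z + x" and K=UNIV and I=UNIV and M="\<lambda>_. site p"])
      (auto simp: measure_pmf.prob_space_axioms)
  then have d: "distr (perc p) (perc p) (\<lambda>\<omega> z. \<omega> (z + x)) = (perc p :: 'd env measure)" by (simp add: restrict_UNIV)
  have m: "(\<lambda>\<omega> z. \<omega> (z + x)) \<in> perc p \<rightarrow>\<^sub>M perc p"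
    unfolding perc_def by (rule measurable_PiM_single') (auto simp: space_PiM)
  have "measure (perc p) {\<omega>. big \<omega> (0 :: int ^ 'd) m} = measure (distr (perc p) (perc p) (\<lambda>\<omega> z. \<omega> (z + x))) {\<omega>. big \<omega> (0 :: int ^ 'd) m}"
    by (simp add: d)
  also have "\<dots> = measure (perc p) {\<omega>. big (\<lambda>z. \<omega> (z + x)) 0 m}"
    by (subst measure_distr[OF m big_measurable]) (simp add: vimage_def)
  finally show ?thesis by (simp add: cluster_size_translate)
qed

text \<open>A finite size is a difference of two nested local events; the value
  \<open>\<infinity>\<close> is what countably many of these leave over.\<close>

lemma cluster_size_measurable [measurable]:
  "(\<lambda>\<omega>. cluster_size \<omega> x) \<in> perc p \<rightarrow>\<^sub>M count_space UNIV"
proof (subst measurable_count_space_eq_countable)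
  show "countable (UNIV :: enat set)" by simp
  have fin: "(\<lambda>\<omega>. cluster_size \<omega> x) -` {enat n} \<inter> space (perc p) = {\<omega>. big \<omega> x n} - {\<omega>. big \<omega> x (Suc n)}" for n
    by (auto simp: not_le) (metis Suc_ile_eq antisym not_le)
  have f: "(\<lambda>\<omega>. cluster_size \<omega> x) -` {enat n} \<inter> space (perc p) \<in> sets (perc p)" for n
    unfolding fin by (intro sets.Diff big_measurable)
  have inf: "(\<lambda>\<omega>. cluster_size \<omega> x) -` {\<infinity>} \<inter> space (perc p) = space (perc p) - (\<Union>n. (\<lambda>\<omega>. cluster_size \<omega> x) -` {enat n} \<inter> space (perc p))"
  proof (intro set_eqI)
    fix \<omega> show "\<omega> \<in> (\<lambda>\<omega>. cluster_size \<omega> x) -` {\<infinity>} \<inter> space (perc p) \<longleftrightarrow>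
      \<omega> \<in> space (perc p) - (\<Union>n. (\<lambda>\<omega>. cluster_size \<omega> x) -` {enat n} \<inter> space (perc p))"
      by (cases "cluster_size \<omega> x") auto
  qed
  have i: "(\<lambda>\<omega>. cluster_size \<omega> x) -` {\<infinity>} \<inter> space (perc p) \<in> sets (perc p)"
    unfolding inf using f by (intro sets.Diff sets.top sets.countable_UN) auto
  show "(\<lambda>\<omega>. cluster_size \<omega> x) \<in> space (perc p) \<rightarrow> UNIV \<and>
    (\<forall>a\<in>UNIV. (\<lambda>\<omega>. cluster_size \<omega> x) -` {a} \<inter> space (perc p) \<in> sets (perc p))"
  proof (intro conjI ballI)
    fix a :: enat show "(\<lambda>\<omega>. cluster_size \<omega> x) -` {a} \<inter> space (perc p) \<in> sets (perc p)"
      using f i by (cases a) simp_all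
  qed simp
qed

section \<open>Tails of the cluster size and moments of the traps\<close>

definition big_prob :: "'d::finite itself \<Rightarrow> real \<Rightarrow> nat \<Rightarrow> real" where
  "big_prob _ p m = measure (perc p) {\<omega>. big \<omega> (0 :: int ^ 'd) m}"

lemma prob_big: "measure (perc p) {\<omega>. big \<omega> (x :: int ^ 'd::finite) m} = big_prob TYPE('d) p m"
  unfolding big_prob_def by (rule big_translate)

lemma big_prob_01: "0 \<le> big_prob TYPE('d::finite) p m" "big_prob TYPE('d) p m \<le> 1"
proof -
  interpret prob_space "perc p :: 'd env measure" by (rule prob_space_perc)
  show "0 \<le> big_prob TYPE('d::finite) p m" "big_prob TYPE('d) p m \<le> 1"
    by (simp_all add: big_prob_def)
qed

text \<open>The limit controls large \<open>m\<close> only; the constant pays for the finitely many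
  others.\<close>

lemma decay_upper:
  assumes "cluster_decay_rate TYPE('d::finite) p \<xi>" "0 < \<theta>" "\<theta> < \<xi>"
  shows "\<exists>C>0. \<forall>m. big_prob TYPE('d) p m \<le> C * exp (- \<theta> * real m)"
proof -
  have "(\<lambda>n. 1 / real n * ln (big_prob TYPE('d) p n)) \<longlonglongrightarrow> - \<xi>"
    using assms(1) by (auto simp: cluster_decay_rate_def big_prob_def)
  then have "\<forall>\<^sub>F n in sequentially. 1 / real n * ln (big_prob TYPE('d) p n) < - \<theta>"
    by (rule order_tendstoD) (use assms in auto)
  then have "\<forall>\<^sub>F n in sequentially. big_prob TYPE('d) p n \<le> exp (- \<theta> * real n)"
    using eventually_gt_at_top[of 0]
  proof eventually_elim
    case (elim n)
    show ?case
    proof (cases "big_prob TYPE('d) p n = 0")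
      case False
      then have pos: "0 < big_prob TYPE('d) p n" using big_prob_01[of p n, where 'd='d] by linarith
      have "ln (big_prob TYPE('d) p n) \<le> - \<theta> * real n" using elim by (simp add: field_simps)
      then show ?thesis using pos by (metis exp_le_cancel_iff exp_ln)
    qed simp
  qed
  then obtain N where N: "\<And>n. n \<ge> N \<Longrightarrow> big_prob TYPE('d) p n \<le> exp (- \<theta> * real n)"
    unfolding eventually_sequentially by blast
  have "big_prob TYPE('d) p m \<le> exp (\<theta> * real N) * exp (- \<theta> * real m)" for m
  proof (cases "m \<ge> N")
    case True
    have "1 * exp (- \<theta> * real m) \<le> exp (\<theta> * real N) * exp (- \<theta> * real m)"
      using assms(2) by (intro mult_right_mono) auto
    then show ?thesis using N[OF True] by linarith
  next
    case False
    then have "1 \<le> exp (\<theta> * real N + - \<theta> * real m)" using assms(2) by simp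
    also have "\<dots> = exp (\<theta> * real N) * exp (- \<theta> * real m)" by (rule exp_add)
    finally show ?thesis using big_prob_01(2)[of p m, where 'd='d] by linarith
  qed
  then show ?thesis by (intro exI[of _ "exp (\<theta> * real N)"]) auto
qed

lemma decay_lower:
  assumes "cluster_decay_rate TYPE('d::finite) p \<xi>" "\<xi> < \<theta>"
  shows "\<forall>\<^sub>F m in sequentially. exp (- \<theta> * real m) \<le> big_prob TYPE('d) p m"
proof -
  have "(\<lambda>n. 1 / real n * ln (big_prob TYPE('d) p n)) \<longlonglongrightarrow> - \<xi>" and xi: "0 < \<xi>"
    using assms(1) by (auto simp: cluster_decay_rate_def big_prob_def)
  note lim = this(1)
  have "\<forall>\<^sub>F n in sequentially. 1 / real n * ln (big_prob TYPE('d) p n) > - \<theta>"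
    by (rule order_tendstoD[OF lim]) (use assms in auto)
  \<comment> \<open>In HOL \<open>ln 0 = 0\<close>, so a strictly negative logarithm rules out
    probability zero, and \<open>exp\<close> may be applied to the bound.\<close>
  moreover have "\<forall>\<^sub>F n in sequentially. 1 / real n * ln (big_prob TYPE('d) p n) < 0"
    by (rule order_tendstoD[OF lim]) (use xi in auto)
  ultimately show ?thesis using eventually_gt_at_top[of 0]
  proof eventually_elim
    case (elim n)
    then have "big_prob TYPE('d) p n \<noteq> 0" by auto
    then have pos: "0 < big_prob TYPE('d) p n" using big_prob_01[of p n, where 'd='d] by linarith
    have "ln (big_prob TYPE('d) p n) \<ge> - \<theta> * real n" using elim by (simp add: field_simps)
    then show ?case using pos by (metis exp_le_cancel_iff exp_ln)
  qed
qed

lemma countable_lattice: "countable (UNIV :: (int ^ 'd::finite) set)"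
proof -
  have "countable (PiE (UNIV :: 'd set) (\<lambda>_. UNIV :: int set))" by (intro countable_PiE) auto
  then have "countable (vec_lambda ` (PiE (UNIV :: 'd set) (\<lambda>_. UNIV :: int set)))" by simp
  moreover
  have "x \<in> vec_lambda ` (PiE (UNIV :: 'd set) (\<lambda>_. UNIV :: int set))" for x :: "int ^ 'd"
    by (intro image_eqI[where x="vec_nth x"]) (simp_all add: vec_nth_inverse)
  then have "UNIV \<subseteq> vec_lambda ` (PiE (UNIV :: 'd set) (\<lambda>_. UNIV :: int set))" by blast
  ultimately show ?thesis by (rule countable_subset[rotated])
qed

text \<open>An infinite cluster has at least \<open>m\<close> sites for every \<open>m\<close>, and
  these probabilities tend to 0; countability of the lattice covers all sites at once.\<close>

lemma AE_cluster_finite: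
  assumes "cluster_decay_rate TYPE('d::finite) p \<xi>"
  shows "AE \<omega> in perc p. \<forall>x :: int ^ 'd. cluster_size \<omega> x \<noteq> \<infinity>"
proof -
  interpret prob_space "perc p :: 'd env measure" by (rule prob_space_perc)
  have xi: "0 < \<xi>" using assms by (simp add: cluster_decay_rate_def)
  obtain C where C: "\<And>m. big_prob TYPE('d) p m \<le> C * exp (- (\<xi>/2) * real m)"
    using decay_upper[OF assms, of "\<xi>/2"] xi by auto
  have "AE \<omega> in perc p. cluster_size \<omega> x \<noteq> \<infinity>" for x :: "int ^ 'd"
  proof -
    let ?A = "{\<omega>. cluster_size \<omega> x = \<infinity>}"
    have A: "?A \<in> sets (perc p)"
      using measurable_sets[OF cluster_size_measurable[of x p], of "{\<infinity>}"] by (simp add: vimage_def)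
    have "prob ?A \<le> C * exp (- (\<xi>/2) * real m)" for m
    proof -
      have "prob ?A \<le> prob {\<omega>. big \<omega> x m}" using big_measurable by (intro finite_measure_mono) auto
      then show ?thesis using C[of m] by (simp add: prob_big)
    qed
    moreover have "(\<lambda>m. C * exp (- (\<xi>/2) * real m)) \<longlonglongrightarrow> 0"
      using xi by real_asymp
    ultimately have "prob ?A \<le> 0"
      by (intro LIMSEQ_le_const[where X="\<lambda>m. C * exp (- (\<xi>/2) * real m)"]) auto
    then have "prob ?A = 0" using measure_nonneg[of "perc p" ?A] by linarith
    then have "?A \<in> null_sets (perc p)" using A by (simp add: null_sets_def emeasure_eq_measure)
    from AE_not_in[OF this] show ?thesis by eventually_elim simp
  qed
  then have "AE \<omega> in perc p. \<forall>x\<in>UNIV :: (int ^ 'd) set. cluster_size \<omega> x \<noteq> \<infinity>"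
    by (subst AE_ball_countable[OF countable_lattice]) auto
  then show ?thesis by simp
qed

text \<open>The mean holding time, inverse of the total jump rate. The value \<open>0\<close> at an
  infinite cluster is a placeholder on a null set of environments.\<close>

definition trap :: "real \<Rightarrow> 'd::finite env \<Rightarrow> int ^ 'd \<Rightarrow> real" where
  "trap \<beta> \<omega> x = (case cluster_size \<omega> x of enat n \<Rightarrow> exp (\<beta> * real n) | \<infinity> \<Rightarrow> 0)"

lemma trap_measurable [measurable]: "(\<lambda>\<omega>. trap \<beta> \<omega> x) \<in> borel_measurable (perc p)"
  unfolding trap_def by measurable

text \<open>Dominate \<open>exp (a * \<beta> * C)\<close> by the sum of
  \<open>exp (a * \<beta> * n)\<close> over all \<open>n \<le> C\<close>. The expectation is then at
  most a geometric series with ratio \<open>exp (a * \<beta> - \<theta>)\<close>, where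
  \<open>\<theta>\<close> is a decay rate between \<open>a * \<beta>\<close> and
  \<open>\<xi>\<close>.\<close>

lemma trap_moment:
  assumes "cluster_decay_rate TYPE('d::finite) p \<xi>" "0 < a" "0 < \<beta>" "a * \<beta> < \<xi>"
  shows "\<exists>C>0. \<forall>x :: int ^ 'd. (\<integral>\<^sup>+\<omega>. ennreal (trap \<beta> \<omega> x powr a) \<partial>perc p) \<le> ennreal C"
proof -
  interpret prob_space "perc p :: 'd env measure" by (rule prob_space_perc)
  obtain \<theta> where \<theta>: "a * \<beta> < \<theta>" "\<theta> < \<xi>" using dense[OF assms(4)] by blast
  moreover have "0 < a * \<beta>" using assms by simp
  ultimately have "0 < \<theta>" by linarith
  note \<theta> = this \<theta>(2,1)
  obtain C where C: "C > 0" "\<And>m. big_prob TYPE('d) p m \<le> C * exp (- \<theta> * real m)"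
    using decay_upper[OF assms(1) \<theta>(1,2)] by auto
  define D where "D = (\<Sum>n. C * exp (a * \<beta> - \<theta>) ^ n)"
  have sm: "summable (\<lambda>n. C * exp (a * \<beta> - \<theta>) ^ n)"
    using \<theta> by (intro summable_mult summable_geometric) simp
  have Dn: "0 \<le> D" unfolding D_def using C(1) by (intro suminf_nonneg sm) simp
  have "(\<integral>\<^sup>+\<omega>. ennreal (trap \<beta> \<omega> x powr a) \<partial>perc p) \<le> ennreal (D + 1)" for x :: "int ^ 'd"
  proof -
    have [measurable]: "{\<omega>. big \<omega> x n} \<in> sets (perc p)" for n by (rule big_measurable)
    have "(\<integral>\<^sup>+\<omega>. ennreal (trap \<beta> \<omega> x powr a) \<partial>perc p)
      \<le> (\<integral>\<^sup>+\<omega>. (\<Sum>n. ennreal (exp (a * \<beta> * real n)) * indicator {\<omega>. big \<omega> x n} \<omega>) \<partial>perc p)"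
    proof (rule nn_integral_mono)
      fix \<omega> :: "'d env"
      define f where "f n = ennreal (exp (a * \<beta> * real n)) * indicator {\<omega>. big \<omega> x n} \<omega>" for n
      have "ennreal (trap \<beta> \<omega> x powr a) \<le> suminf f"
      proof (cases "cluster_size \<omega> x")
        case (enat n)
        have "f n \<le> suminf f" using sum_le_suminf[of f "{n}"] by simp
        moreover have "f n = ennreal (trap \<beta> \<omega> x powr a)"
          using enat by (simp add: f_def trap_def powr_def algebra_simps)
        ultimately show ?thesis by simp
      qed (simp add: trap_def)
      then show "ennreal (trap \<beta> \<omega> x powr a) \<le> (\<Sum>n. ennreal (exp (a * \<beta> * real n)) * indicator {\<omega>. big \<omega> x n} \<omega>)"
        unfolding f_def[abs_def] .
    qed
    also have "\<dots> = (\<Sum>n. ennreal (exp (a * \<beta> * real n)) * emeasure (perc p) {\<omega>. big \<omega> x n})"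
      by (subst nn_integral_suminf) (auto simp: nn_integral_cmult)
    also have "\<dots> \<le> (\<Sum>n. ennreal (C * exp (a * \<beta> - \<theta>) ^ n))"
    proof (intro suminf_le allI)
      fix n
      have "exp (a * \<beta> * real n) * big_prob TYPE('d) p n \<le> exp (a * \<beta> * real n) * (C * exp (- \<theta> * real n))"
        using C(2)[of n] by (intro mult_left_mono) auto
      also have "\<dots> = C * (exp (a * \<beta> * real n) * exp (- \<theta> * real n))" by simp
      also have "\<dots> = C * exp (a * \<beta> - \<theta>) ^ n"
        by (simp only: exp_add[symmetric] exp_of_nat_mult[symmetric]) (simp add: algebra_simps)
      finally show "ennreal (exp (a * \<beta> * real n)) * emeasure (perc p) {\<omega>. big \<omega> x n} \<le> ennreal (C * exp (a * \<beta> - \<theta>) ^ n)"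
        by (auto simp add: emeasure_eq_measure prob_big ennreal_mult[symmetric] big_prob_01 intro!: ennreal_leI)
    qed auto
    also have "\<dots> = ennreal D"
      unfolding D_def using C(1) by (intro suminf_ennreal_eq sm[THEN summable_sums] ) simp
    also have "\<dots> \<le> ennreal (D + 1)" by (intro ennreal_leI) simp
    finally show ?thesis .
  qed
  then show ?thesis using Dn by (intro exI[of _ "D + 1"]) auto
qed

section \<open>The walk and its clock as functions of the marks\<close>

definition pos :: "(nat \<Rightarrow> (int ^ 'd::finite) \<times> real) \<Rightarrow> nat \<Rightarrow> int ^ 'd" where
  "pos s n = (\<Sum>k<n. fst (s k))"

text \<open>The start \<open>x\<close> stays a parameter because the same construction restarts at
  \<open>x + e\<close> after the first jump.\<close>

definition clk :: "(int ^ 'd::finite \<Rightarrow> real) \<Rightarrow> int ^ 'd \<Rightarrow> (nat \<Rightarrow> (int ^ 'd) \<times> real) \<Rightarrow> nat \<Rightarrow> real" where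
  "clk V x s n = (\<Sum>k<n. snd (s k) * V (x + pos s k))"

text \<open>The default value \<open>0\<close> when the clock never exceeds \<open>t\<close> makes the decomposition at the first jump
  (\<open>walk_path_case_nat\<close>) and right continuity hold for every sequence of marks, not only almost surely.\<close>

definition walk_path :: "(int ^ 'd::finite \<Rightarrow> real) \<Rightarrow> int ^ 'd \<Rightarrow> (nat \<Rightarrow> (int ^ 'd) \<times> real) \<Rightarrow> real \<Rightarrow> int ^ 'd" where
  "walk_path V x s t =
     (if \<exists>n. t < clk V x s (Suc n) then x + pos s (LEAST n. t < clk V x s (Suc n)) else 0)"

lemma pos_0 [simp]: "pos s 0 = 0" by (simp add: pos_def)
lemma clk_0 [simp]: "clk V x s 0 = 0" by (simp add: clk_def)

lemma pos_case_nat: "pos (case_nat z s) (Suc n) = fst z + pos s n"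
  unfolding pos_def by (subst sum.lessThan_Suc_shift) simp

lemma clk_case_nat: "clk V x (case_nat z s) (Suc n) = snd z * V x + clk V (x + fst z) s n"
  unfolding clk_def by (subst sum.lessThan_Suc_shift) (simp add: pos_case_nat add.assoc)

text \<open>Dropping the first mark shifts the clock by one holding time and moves the start. This
  pathwise Markov property at the first jump is the source of the renewal equation.\<close>

lemma walk_path_case_nat:
  "walk_path V x (case_nat z s) t =
     (if t < snd z * V x then x else walk_path V (x + fst z) s (t - snd z * V x))"
proof (cases "t < snd z * V x")
  case True
  then have *: "t < clk V x (case_nat z s) (Suc 0)" by (simp add: clk_case_nat)
  then have "(LEAST n. t < clk V x (case_nat z s) (Suc n)) = 0" by (intro Least_equality) auto
  then show ?thesis using * True unfolding walk_path_def by auto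
next
  case False
  let ?P = "\<lambda>n. t < clk V x (case_nat z s) (Suc n)"
  let ?R = "\<lambda>n. t - snd z * V x < clk V (x + fst z) s (Suc n)"
  have P0: "\<not> ?P 0" using False by (simp add: clk_case_nat)
  have PS: "?P (Suc n) = ?R n" for n by (subst clk_case_nat) auto
  have ex: "(\<exists>n. ?P n) \<longleftrightarrow> (\<exists>n. ?R n)"
  proof
    assume "\<exists>n. ?P n"
    then obtain n where n: "?P n" ..
    then obtain k where "n = Suc k" using P0 by (cases n) auto
    then show "\<exists>n. ?R n" using n PS by blast
  qed (use PS in blast)
  show ?thesis
  proof (cases "\<exists>n. ?P n")
    case True
    then obtain n where "?P n" ..
    then have "(LEAST n. ?P n) = Suc (LEAST n. ?P (Suc n))" by (rule Least_Suc) (rule P0)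
    then have "(LEAST n. ?P n) = Suc (LEAST n. ?R n)" by (simp only: PS)
    moreover have "x + pos (case_nat z s) (Suc m) = x + fst z + pos s m" for m
      by (simp add: pos_case_nat add.assoc)
    moreover have "\<exists>n. ?R n" using True ex by blast
    ultimately show ?thesis using True False unfolding walk_path_def by (simp only: if_True if_False)
  next
    case nP: False
    then have "\<not> (\<exists>n. ?R n)" using ex by blast
    with nP False show ?thesis unfolding walk_path_def by (simp only: if_False)
  qed
qed

lemma walk_path_right_continuous: "\<exists>b>t. \<forall>u\<in>{t..<b}. walk_path V x s u = walk_path V x s t"
proof (cases "\<exists>n. t < clk V x s (Suc n)")
  case True
  define m where "m = (LEAST n. t < clk V x s (Suc n))"
  have m: "t < clk V x s (Suc m)" using True unfolding m_def by (rule LeastI_ex)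
  have less: "clk V x s (Suc k) \<le> t" if "k < m" for k
    using not_less_Least[of k "\<lambda>n. t < clk V x s (Suc n)"] that by (auto simp: m_def)
  show ?thesis
  proof (intro exI[of _ "clk V x s (Suc m)"] conjI m ballI)
    fix u assume u: "u \<in> {t..<clk V x s (Suc m)}"
    have "(LEAST n. u < clk V x s (Suc n)) = m"
    proof (rule Least_equality)
      fix k assume "u < clk V x s (Suc k)"
      then show "m \<le> k" using less[of k] u by (cases "k < m") auto
    qed (use u in auto)
    moreover have "\<exists>n. u < clk V x s (Suc n)" using u by auto
    ultimately show "walk_path V x s u = walk_path V x s t"
      using True unfolding walk_path_def m_def by (simp only: if_True)
  qed
next
  case False
  then have "walk_path V x s u = walk_path V x s t" if "t \<le> u" for u
  proof -
    have "\<not> (\<exists>n. u < clk V x s (Suc n))" using False that by (meson order.strict_trans1)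
    with False show ?thesis unfolding walk_path_def by (simp only: if_False)
  qed
  then show ?thesis by (intro exI[of _ "t + 1"] conjI ballI) (simp, metis atLeastLessThan_iff)
qed

text \<open>Times are stored as increments, so that a time shift of the path acts on the starting
  time alone.\<close>

fun visits :: "(real \<Rightarrow> 'a) \<Rightarrow> real \<Rightarrow> (real \<times> 'a) list \<Rightarrow> bool" where
  "visits Y t [] = True"
| "visits Y t ((d, y) # L) = (Y (t + d) = y \<and> visits Y (t + d) L)"

lemma visits_shift:
  assumes "\<And>u. u \<ge> 0 \<Longrightarrow> Y (t + u) = Y' (t' + u)" "\<forall>z\<in>set L. fst z \<ge> 0"
  shows "visits Y t L = visits Y' t' L"
  using assms
proof (induction L arbitrary: t t')
  case (Cons z L)
  obtain d y where z: "z = (d, y)" by (cases z)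
  have "visits Y (t + d) L = visits Y' (t' + d) L"
  proof (rule Cons.IH)
    fix u :: real assume "0 \<le> u"
    then show "Y (t + d + u) = Y' (t' + d + u)" using Cons.prems(1)[of "d + u"] Cons.prems(2) z by (simp add: add.assoc)
  qed (use Cons.prems in auto)
  then show ?case using Cons.prems(1)[of d] Cons.prems(2) z by auto
qed simp

section \<open>The probability space of independent marks\<close>

abbreviation expo :: "real measure" where "expo \<equiv> density lborel (exponential_density 1)"

lemma prob_space_expo: "prob_space expo"
  by (rule prob_space_exponential_density) simp

lemma add_measurable_lattice:
  fixes f g :: "'a \<Rightarrow> int ^ 'd::finite"
  assumes [measurable]: "f \<in> M \<rightarrow>\<^sub>M count_space UNIV" "g \<in> M \<rightarrow>\<^sub>M count_space UNIV"
  shows "(\<lambda>x. f x + g x) \<in> M \<rightarrow>\<^sub>M count_space UNIV"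
  by (rule measurable_compose_countable'[OF _ assms(1) countable_lattice]) measurable

text \<open>Finite support turns the average over the first step into a finite sum, which commutes
  freely with series and derivatives.\<close>

locale step_law =
  fixes \<pi> :: "(int ^ 'd::finite) pmf"
  assumes finite_steps: "finite (set_pmf \<pi>)"
begin

definition mark :: "((int ^ 'd) \<times> real) measure" where "mark = measure_pmf \<pi> \<Otimes>\<^sub>M expo"
definition marks :: "(nat \<Rightarrow> (int ^ 'd) \<times> real) measure" where "marks = PiM UNIV (\<lambda>_. mark)"

sublocale expo: prob_space expo by (rule prob_space_expo)
sublocale mark: prob_space mark
proof -
  interpret pair_prob_space "measure_pmf \<pi>" expo ..
  show "prob_space mark" unfolding mark_def by (rule prob_space_axioms)
qed
sublocale mseq: sequence_space mark ..
sublocale marks: prob_space marks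
  unfolding marks_def by (intro prob_space_PiM mark.prob_space_axioms)

lemma sets_mark [measurable_cong]: "sets mark = sets (count_space UNIV \<Otimes>\<^sub>M borel)"
  unfolding mark_def by (intro sets_pair_measure_cong) auto

lemma space_marks [simp]: "space marks = UNIV"
  by (simp add: marks_def space_PiM mark_def space_pair_measure)

lemma space_mark [simp]: "space mark = UNIV"
  by (simp add: mark_def space_pair_measure)

lemma coordinate_measurable [measurable]: "(\<lambda>s. s k) \<in> marks \<rightarrow>\<^sub>M mark"
  unfolding marks_def by simp

lemma step_measurable [measurable]: "(\<lambda>s. fst (s k)) \<in> marks \<rightarrow>\<^sub>M count_space UNIV"
  by (rule measurable_compose[OF coordinate_measurable]) measurable

lemma hold_measurable [measurable]: "(\<lambda>s. snd (s k)) \<in> borel_measurable marks"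
  by (rule measurable_compose[OF coordinate_measurable]) measurable

lemma pos_measurable [measurable]: "(\<lambda>s. pos s n) \<in> marks \<rightarrow>\<^sub>M count_space UNIV"
proof (induction n)
  case (Suc n)
  then show ?case unfolding pos_def by (simp add: add_measurable_lattice)
qed simp

lemma pos_measurable_real [measurable]: "(\<lambda>s. (V (pos s n) :: real)) \<in> borel_measurable marks"
  by (rule measurable_compose[OF pos_measurable]) simp

lemma clk_measurable [measurable]: "(\<lambda>s. clk V x s n) \<in> borel_measurable marks"
  unfolding clk_def by (intro borel_measurable_sum borel_measurable_times hold_measurable pos_measurable_real)

text \<open>Joint measurability is required because the renewal equation evaluates the path at the
  random time \<open>t - h * V x\<close> and integrates over \<open>h\<close>.\<close>

lemma walk_path_measurable2 [measurable]:
  "(\<lambda>(t, s). walk_path V x s t) \<in> borel \<Otimes>\<^sub>M marks \<rightarrow>\<^sub>M count_space UNIV"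
proof -
  have [measurable]: "(\<lambda>z. x + pos (snd z) n) \<in> borel \<Otimes>\<^sub>M marks \<rightarrow>\<^sub>M count_space UNIV" for n
    by (intro add_measurable_lattice) measurable
  have [measurable]: "(\<lambda>z. x + pos (snd z) (LEAST n. fst z < clk V x (snd z) (Suc n)))
    \<in> (borel \<Otimes>\<^sub>M marks) \<rightarrow>\<^sub>M count_space UNIV"
    by (rule measurable_compose_countable[where g="\<lambda>z. LEAST n. fst z < clk V x (snd z) (Suc n)"]) measurable
  show ?thesis unfolding walk_path_def split_beta' by measurable
qed

lemma walk_path_measurable [measurable (raw)]:
  assumes "f \<in> borel_measurable M" "g \<in> M \<rightarrow>\<^sub>M marks"
  shows "(\<lambda>z. walk_path V x (g z) (f z)) \<in> M \<rightarrow>\<^sub>M count_space UNIV"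
  using measurable_compose[OF measurable_Pair[OF assms] walk_path_measurable2] by simp

lemma visits_measurable [measurable (raw)]:
  assumes "f \<in> borel_measurable M" "g \<in> M \<rightarrow>\<^sub>M marks"
  shows "Measurable.pred M (\<lambda>z. visits (walk_path V x (g z)) (f z) L)"
  using assms(1)
proof (induction L arbitrary: f)
  case (Cons z L)
  obtain d y where z: "z = (d, y)" by (cases z)
  have [measurable]: "(\<lambda>z. f z + d) \<in> borel_measurable M" using Cons.prems by measurable
  have [measurable]: "Measurable.pred M (\<lambda>z. visits (walk_path V x (g z)) (f z + d) L)"
    by (rule Cons.IH) measurable
  have "(\<lambda>z. walk_path V x (g z) (f z + d)) \<in> M \<rightarrow>\<^sub>M count_space UNIV"
    by (rule walk_path_measurable) (use assms in measurable)
  then have [measurable]: "Measurable.pred M (\<lambda>z. walk_path V x (g z) (f z + d) = y)"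
    by measurable
  show ?case unfolding z visits.simps by measurable
qed simp

text \<open>Prepending an independent mark reproduces the law; every first-step decomposition below
  rests on this.\<close>

lemma marks_iter: "distr (mark \<Otimes>\<^sub>M marks) marks (\<lambda>(z, s). case_nat z s) = marks"
  using mseq.PiM_iter unfolding marks_def .

lemma case_nat_measurable [measurable]: "(\<lambda>z. case_nat (fst z) (snd z)) \<in> mark \<Otimes>\<^sub>M marks \<rightarrow>\<^sub>M marks"
  unfolding marks_def by (rule measurable_case_nat') measurable

end

section \<open>Exponential holding times and the renewal equation\<close>

lemma AE_expo_pos: "AE h in expo. 0 < h"
proof -
  have "AE h in lborel. h \<noteq> (0::real)" by (rule AE_lborel_singleton)
  then show ?thesis
    by (subst AE_density) (auto simp: exponential_density_def)
qed

lemma integral_expo: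
  fixes f :: "real \<Rightarrow> real"
  assumes [measurable]: "f \<in> borel_measurable borel"
  shows "(\<integral>h. f h \<partial>expo) = (\<integral>h. exponential_density 1 h * f h \<partial>lborel)"
  by (subst integral_density) (auto simp: exponential_density_nonneg)

text \<open>Translation by \<open>a\<close> multiplies the density by \<open>exp (- a)\<close>. The
  two integrands differ only at the endpoint, a null set.\<close>

lemma expo_memoryless:
  fixes f :: "real \<Rightarrow> real"
  assumes [measurable]: "f \<in> borel_measurable borel" and a: "0 \<le> a"
  shows "(\<integral>h. indicator {a<..} h * f (h - a) \<partial>expo) = exp (- a) * (\<integral>h. f h \<partial>expo)"
proof -
  have "(\<integral>h. indicator {a<..} h * f (h - a) \<partial>expo)
      = (\<integral>h. exponential_density 1 h * (indicator {a<..} h * f (h - a)) \<partial>lborel)"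
    by (rule integral_expo) measurable
  also have "\<dots> = (\<integral>h. exponential_density 1 (a + h) * (indicator {a<..} (a + h) * f h) \<partial>lborel)"
    by (subst lborel_integral_real_affine[where c=1 and t=a]) simp_all
  also have "\<dots> = (\<integral>h. exp (- a) * (exponential_density 1 h * f h) \<partial>lborel)"
  proof (rule integral_cong_AE)
    have "AE h in lborel. h \<noteq> (0::real)" by (rule AE_lborel_singleton)
    then show "AE h in lborel. exponential_density 1 (a + h) * (indicator {a<..} (a + h) * f h)
        = exp (- a) * (exponential_density 1 h * f h)"
      by eventually_elim (use a in \<open>auto simp: exponential_density_def indicator_def exp_add[symmetric]\<close>)
  qed measurable
  also have "\<dots> = exp (- a) * (\<integral>h. f h \<partial>expo)"
    by (subst integral_expo) simp_all
  finally show ?thesis .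
qed

lemma expo_prob_Icc: "0 \<le> a \<Longrightarrow> (\<integral>h. indicator {0..a} h \<partial>expo) = 1 - exp (- a :: real)"
proof -
  assume a: "0 \<le> a"
  interpret prob_space expo by (rule prob_space_expo)
  have 1: "(\<integral>h. indicator {a<..} h \<partial>expo) = exp (- a)"
    using expo_memoryless[of "\<lambda>_. 1" a] a prob_space by simp
  have "(\<integral>h. indicator {0..a} h + indicator {a<..} h \<partial>expo) = (\<integral>h. 1 \<partial>expo :: real)"
  proof (rule integral_cong_AE)
    show "AE h in expo. indicator {0..a} h + indicator {a<..} h = (1::real)"
      using AE_expo_pos by eventually_elim (auto simp: indicator_def)
  qed measurable
  moreover have "(\<integral>h. indicator {0..a} h + indicator {a<..} h \<partial>expo)
    = (\<integral>h. indicator {0..a} h \<partial>expo) + (\<integral>h. indicator {a<..} h \<partial>expo :: real)"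
    by (rule Bochner_Integration.integral_add) (auto intro!: integrable_const_bound[where B=1])
  ultimately show ?thesis using 1 prob_space by simp
qed

context step_law
begin

definition visit_prob :: "(int ^ 'd \<Rightarrow> real) \<Rightarrow> (real \<times> (int ^ 'd)) list \<Rightarrow> real \<Rightarrow> int ^ 'd \<Rightarrow> real" where
  "visit_prob V L t x = measure marks {s. visits (walk_path V x s) t L}"

lemma case_nat_measurable' [measurable (raw)]:
  assumes "f \<in> M \<rightarrow>\<^sub>M mark" "g \<in> M \<rightarrow>\<^sub>M marks"
  shows "(\<lambda>z. case_nat (f z) (g z)) \<in> M \<rightarrow>\<^sub>M marks"
  using measurable_compose[OF measurable_Pair[OF assms] case_nat_measurable] by simp

lemma mark_pair_measurable [measurable]: "(\<lambda>h. (e, h)) \<in> borel \<rightarrow>\<^sub>M mark"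
  by (subst measurable_cong_sets[OF refl sets_mark]) measurable

lemma hold_measurable_prob [measurable]:
  assumes [measurable]: "Measurable.pred marks P"
  shows "(\<lambda>h. measure marks {s. P (case_nat (e, h) s)}) \<in> borel_measurable borel"
proof -
  have [measurable]: "Measurable.pred (borel \<Otimes>\<^sub>M marks) (\<lambda>z. P (case_nat (e, fst z) (snd z)))"
  proof -
    have "(\<lambda>z. (e, fst z)) \<in> borel \<Otimes>\<^sub>M marks \<rightarrow>\<^sub>M mark"
      by (rule measurable_compose[OF measurable_fst mark_pair_measurable])
    then have "(\<lambda>z. case_nat (e, fst z) (snd z)) \<in> borel \<Otimes>\<^sub>M marks \<rightarrow>\<^sub>M marks"
      by (rule case_nat_measurable'[OF _ measurable_snd])
    then show ?thesis by (rule measurable_compose) (rule assms)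
  qed
  have "{z \<in> space (borel \<Otimes>\<^sub>M marks). P (case_nat (e, fst z) (snd z))} \<in> sets (borel \<Otimes>\<^sub>M marks)"
    by measurable
  from marks.measurable_emeasure_Pair[OF this]
  have "(\<lambda>h. emeasure marks {s. P (case_nat (e, h) s)}) \<in> borel_measurable borel"
    by (simp add: space_pair_measure vimage_def)
  then show ?thesis unfolding measure_def by measurable
qed

text \<open>Fubini over the first mark. The holding time is the outer variable because the renewal
  equation splits it at \<open>t / V x\<close>.\<close>

lemma marks_prob_split:
  assumes P [measurable]: "Measurable.pred marks P"
  shows "measure marks {s. P s}
    = (\<integral>h. (\<Sum>e\<in>set_pmf \<pi>. pmf \<pi> e * measure marks {s. P (case_nat (e, h) s)}) \<partial>expo)"
proof -
  interpret pm: pair_sigma_finite "measure_pmf \<pi>" expo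
    by (intro pair_sigma_finite.intro) (auto intro: prob_space_imp_sigma_finite prob_space_expo measure_pmf.prob_space_axioms)
  have cn: "(\<lambda>z. case_nat (fst z) (snd z)) \<in> mark \<Otimes>\<^sub>M marks \<rightarrow>\<^sub>M marks" by (rule case_nat_measurable)
  let ?Q = "{z \<in> space (mark \<Otimes>\<^sub>M marks). P (case_nat (fst z) (snd z))}"
  have Q: "?Q \<in> sets (mark \<Otimes>\<^sub>M marks)"
    using measurable_compose[OF cn P] by measurable
  have e: "emeasure marks {s. P (case_nat z s)} = ennreal (measure marks {s. P (case_nat z s)})" for z
    by (rule marks.emeasure_eq_measure)
  have Pz: "Pair z -` ?Q = {s. P (case_nat z s)}" for z
    by (auto simp: space_pair_measure)
  have mz: "(\<lambda>z. emeasure marks {s. P (case_nat z s)}) \<in> borel_measurable mark"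
    using marks.measurable_emeasure_Pair[OF Q] unfolding Pz .
  have "emeasure marks {s. P s} = emeasure (distr (mark \<Otimes>\<^sub>M marks) marks (\<lambda>(z, s). case_nat z s)) {s. P s}"
    by (simp only: marks_iter)
  also have "\<dots> = emeasure (mark \<Otimes>\<^sub>M marks) ?Q"
    using P by (subst emeasure_distr) (auto simp: split_beta' pred_def cn vimage_def intro!: arg_cong[where f="emeasure _"])
  also have "\<dots> = (\<integral>\<^sup>+z. emeasure marks {s. P (case_nat z s)} \<partial>mark)"
    by (subst marks.emeasure_pair_measure_alt[OF Q]) (simp only: Pz)
  also have "\<dots> = (\<integral>\<^sup>+h. \<integral>\<^sup>+e. emeasure marks {s. P (case_nat (e, h) s)} \<partial>measure_pmf \<pi> \<partial>expo)"
    unfolding mark_def by (rule pm.nn_integral_snd[symmetric]) (use mz in \<open>simp add: mark_def\<close>)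
  also have "\<dots> = (\<integral>\<^sup>+h. ennreal (\<Sum>e\<in>set_pmf \<pi>. pmf \<pi> e * measure marks {s. P (case_nat (e, h) s)}) \<partial>expo)"
  proof (intro nn_integral_cong)
    fix h
    have "(\<integral>\<^sup>+e. emeasure marks {s. P (case_nat (e, h) s)} \<partial>measure_pmf \<pi>)
        = (\<Sum>e\<in>set_pmf \<pi>. ennreal (measure marks {s. P (case_nat (e, h) s)}) * ennreal (pmf \<pi> e))"
      by (subst nn_integral_measure_pmf_finite[OF finite_steps]) (simp_all only: e zero_le)
    also have "\<dots> = (\<Sum>e\<in>set_pmf \<pi>. ennreal (pmf \<pi> e * measure marks {s. P (case_nat (e, h) s)}))"
      by (intro sum.cong refl) (simp add: ennreal_mult mult.commute)
    also have "\<dots> = ennreal (\<Sum>e\<in>set_pmf \<pi>. pmf \<pi> e * measure marks {s. P (case_nat (e, h) s)})"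
      by (intro sum_ennreal) simp
    finally show "(\<integral>\<^sup>+e. emeasure marks {s. P (case_nat (e, h) s)} \<partial>measure_pmf \<pi>) = \<dots>" .
  qed
  finally have "enn2real (emeasure marks {s. P s}) = enn2real (\<dots>)" by simp
  also have "\<dots> = (\<integral>h. (\<Sum>e\<in>set_pmf \<pi>. pmf \<pi> e * measure marks {s. P (case_nat (e, h) s)}) \<partial>expo)"
    by (intro integral_eq_nn_integral[symmetric]) (auto intro!: sum_nonneg)
  finally show ?thesis by (simp add: measure_def)
qed

lemma visit_prob_measurable [measurable]: "(\<lambda>t. visit_prob V L t x) \<in> borel_measurable borel"
proof -
  have "{z \<in> space (borel \<Otimes>\<^sub>M marks). visits (walk_path V x (snd z)) (fst z) L} \<in> sets (borel \<Otimes>\<^sub>M marks)"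
    by measurable
  from marks.measurable_emeasure_Pair[OF this]
  have "(\<lambda>t. emeasure marks {s. visits (walk_path V x s) t L}) \<in> borel_measurable borel"
    by (simp add: space_pair_measure vimage_def)
  then show ?thesis unfolding visit_prob_def measure_def by measurable
qed

lemma sum_pmf_set: "(\<Sum>e\<in>set_pmf \<pi>. pmf \<pi> e) = 1"
  using sum_pmf_eq_1[OF finite_steps order_refl] .

text \<open>Split at the first jump. If the first hold outlasts \<open>t\<close>, memorylessness
  makes the residual hold a fresh one and the walk starts anew from \<open>x\<close> at time 0: the
  first summand. Otherwise it restarts at \<open>x + e\<close> with \<open>t - h * V x\<close> time
  to go.\<close>

lemma visit_prob_renewal:
  assumes V: "0 < V x" and t: "0 \<le> t" and L: "\<forall>z\<in>set L. fst z \<ge> 0"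
  shows "visit_prob V L t x = exp (- (t / V x)) * visit_prob V L 0 x
     + (\<integral>h. indicator {0..t / V x} h * (\<Sum>e\<in>set_pmf \<pi>. pmf \<pi> e * visit_prob V L (t - h * V x) (x + e)) \<partial>expo)"
proof -
  let ?a = "t / V x"
  have a: "0 \<le> ?a" using V t by simp
  define \<Phi> where "\<Phi> h = (\<Sum>e\<in>set_pmf \<pi>. pmf \<pi> e * measure marks {s. visits (walk_path V x (case_nat (e, h) s)) 0 L})" for h
  define A where "A h = (\<Sum>e\<in>set_pmf \<pi>. pmf \<pi> e * visit_prob V L (t - h * V x) (x + e))" for h
  have pr: "Measurable.pred marks (\<lambda>s. visits (walk_path V x s) u L)" for u
    by measurable
  have [measurable]: "\<Phi> \<in> borel_measurable borel"
    unfolding \<Phi>_def using hold_measurable_prob[OF pr[of 0]] by measurable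
  have [measurable]: "A \<in> borel_measurable borel"
    unfolding A_def by measurable
  have bd: "(\<Sum>e\<in>set_pmf \<pi>. pmf \<pi> e * f e) \<le> 1" "0 \<le> (\<Sum>e\<in>set_pmf \<pi>. pmf \<pi> e * f e)"
    if "\<And>e. 0 \<le> f e \<and> f e \<le> 1" for f
  proof -
    have "(\<Sum>e\<in>set_pmf \<pi>. pmf \<pi> e * f e) \<le> (\<Sum>e\<in>set_pmf \<pi>. pmf \<pi> e * 1)"
      using that by (intro sum_mono mult_left_mono) auto
    then show "(\<Sum>e\<in>set_pmf \<pi>. pmf \<pi> e * f e) \<le> 1" by (simp add: sum_pmf_set)
  qed (use that in \<open>auto intro!: sum_nonneg\<close>)
  have b\<Phi>: "0 \<le> \<Phi> h" "\<Phi> h \<le> 1" for h unfolding \<Phi>_def by (intro bd; simp)+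
  have bA: "0 \<le> A h" "A h \<le> 1" for h unfolding A_def visit_prob_def by (intro bd; simp)+
  have v0: "visit_prob V L 0 x = (\<integral>h. \<Phi> h \<partial>expo)"
    unfolding visit_prob_def \<Phi>_def by (rule marks_prob_split[OF pr])
  have "visit_prob V L t x = (\<integral>h. (\<Sum>e\<in>set_pmf \<pi>. pmf \<pi> e * measure marks {s. visits (walk_path V x (case_nat (e, h) s)) t L}) \<partial>expo)"
    unfolding visit_prob_def by (rule marks_prob_split[OF pr])
  also have "\<dots> = (\<integral>h. indicator {?a<..} h * \<Phi> (h - ?a) + indicator {0..?a} h * A h \<partial>expo)"
  proof (rule integral_cong_AE)
    show "AE h in expo. (\<Sum>e\<in>set_pmf \<pi>. pmf \<pi> e * measure marks {s. visits (walk_path V x (case_nat (e, h) s)) t L})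
       = indicator {?a<..} h * \<Phi> (h - ?a) + indicator {0..?a} h * A h"
      using AE_expo_pos
    proof eventually_elim
      case (elim h)
      show ?case
      proof (cases "h \<le> ?a")
        case True
        then have hV: "h * V x \<le> t" using V by (simp add: field_simps)
        have "visits (walk_path V x (case_nat (e, h) s)) t L = visits (walk_path V (x + e) s) (t - h * V x) L" for e s
          by (rule visits_shift[OF _ L]) (use hV in \<open>simp add: walk_path_case_nat algebra_simps\<close>)
        then show ?thesis using True elim by (simp add: A_def visit_prob_def)
      next
        case False
        then have hV: "t < h * V x" using V by (simp add: field_simps)
        have tV: "t / V x * V x = t" using V by simp
        \<comment> \<open>Shortening the hold by the elapsed part \<open>t / V x\<close> has the
          same effect on the path as advancing time by \<open>t\<close>.\<close>
        have "visits (walk_path V x (case_nat (e, h) s)) t L = visits (walk_path V x (case_nat (e, h - ?a) s)) 0 L" for e s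
        proof (rule visits_shift[OF _ L])
          fix u :: real assume "0 \<le> u"
          have "(h - ?a) * V x = h * V x - t" using tV by (simp add: left_diff_distrib)
          then show "walk_path V x (case_nat (e, h) s) (t + u) = walk_path V x (case_nat (e, h - ?a) s) (0 + u)"
            by (simp add: walk_path_case_nat algebra_simps)
        qed
        then show ?thesis using False elim by (simp add: \<Phi>_def)
      qed
    qed
  qed (use hold_measurable_prob[OF pr] in measurable)
  also have "\<dots> = (\<integral>h. indicator {?a<..} h * \<Phi> (h - ?a) \<partial>expo) + (\<integral>h. indicator {0..?a} h * A h \<partial>expo)"
    by (intro Bochner_Integration.integral_add expo.integrable_const_bound[where B=1])
      (auto simp: indicator_def b\<Phi> bA)
  also have "(\<integral>h. indicator {?a<..} h * \<Phi> (h - ?a) \<partial>expo) = exp (- ?a) * visit_prob V L 0 x"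
    by (subst expo_memoryless[OF _ a]) (simp_all add: v0)
  finally show ?thesis by (simp add: A_def)
qed

section \<open>The semigroup\<close>

definition Gen :: "(int ^ 'd \<Rightarrow> real) \<Rightarrow> (int ^ 'd \<Rightarrow> real) \<Rightarrow> int ^ 'd \<Rightarrow> real" where
  "Gen q f x = q x * (\<Sum>e\<in>set_pmf \<pi>. pmf \<pi> e * (f (x + e) - f x))"

lemma Gen_scale: "q x * (\<Sum>e\<in>set_pmf \<pi>. pmf \<pi> e * (c * f (x + e) - c * f x)) = c * Gen q f x"
  unfolding Gen_def right_diff_distrib[symmetric] sum_distrib_left by (simp add: mult_ac)

definition sgp :: "(int ^ 'd \<Rightarrow> real) \<Rightarrow> (int ^ 'd \<Rightarrow> real) \<Rightarrow> real \<Rightarrow> int ^ 'd \<Rightarrow> real" where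
  "sgp q g t x = (\<Sum>n. t ^ n / fact n * (Gen q ^^ n) g x)"

text \<open>Since \<open>q \<le> 1\<close>, one application of \<open>Gen\<close> at most doubles
  the sup norm.\<close>

lemma Gen_pow_bound:
  assumes q: "\<And>x. 0 \<le> q x" "\<And>x. q x \<le> 1" and g: "\<And>x. \<bar>g x\<bar> \<le> B"
  shows "\<bar>(Gen q ^^ n) g x\<bar> \<le> 2 ^ n * B"
proof (induction n arbitrary: x)
  case (Suc n)
  let ?f = "(Gen q ^^ n) g"
  have B: "0 \<le> B" using g[of 0] by linarith
  have "\<bar>?f (x + e) - ?f x\<bar> \<le> 2 ^ Suc n * B" for e
    using Suc[of "x + e"] Suc[of x] by simp
  then have "\<bar>\<Sum>e\<in>set_pmf \<pi>. pmf \<pi> e * (?f (x + e) - ?f x)\<bar> \<le> (\<Sum>e\<in>set_pmf \<pi>. pmf \<pi> e * (2 ^ Suc n * B))"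
    by (intro order_trans[OF sum_abs] sum_mono) (simp only: abs_mult, intro mult_mono, auto)
  also have "\<dots> = 2 ^ Suc n * B" by (simp only: sum_distrib_right[symmetric] sum_pmf_set mult_1)
  finally have *: "\<bar>\<Sum>e\<in>set_pmf \<pi>. pmf \<pi> e * (?f (x + e) - ?f x)\<bar> \<le> 2 ^ Suc n * B" .
  have "\<bar>Gen q ?f x\<bar> \<le> 1 * (2 ^ Suc n * B)"
    unfolding Gen_def[of q ?f x] abs_mult by (intro mult_mono *) (use q[of x] B in auto)
  then show ?case by simp
qed (use g in simp)

context
  fixes q g :: "int ^ 'd \<Rightarrow> real" and B :: real
  assumes q: "\<And>x. 0 \<le> q x" "\<And>x. q x \<le> 1" and g: "\<And>x. \<bar>g x\<bar> \<le> B"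
begin

lemma sgp_term_bound: "\<bar>t ^ n / fact n * (Gen q ^^ n) g x\<bar> \<le> B * ((2 * \<bar>t\<bar>) ^ n / fact n)"
proof -
  have "\<bar>t ^ n / fact n * (Gen q ^^ n) g x\<bar> = \<bar>t\<bar> ^ n / fact n * \<bar>(Gen q ^^ n) g x\<bar>"
    by (simp add: abs_mult power_abs)
  also have "\<dots> \<le> \<bar>t\<bar> ^ n / fact n * (2 ^ n * B)"
    by (intro mult_left_mono Gen_pow_bound q g) simp_all
  finally show ?thesis by (simp add: power_mult_distrib algebra_simps)
qed

lemma summable_exp_scaled: "summable (\<lambda>n. B * ((2 * \<bar>t\<bar>) ^ n / fact n))" for t :: real
  using summable_exp_generic[of "2 * \<bar>t\<bar>"] by (intro summable_mult) (simp add: field_simps scaleR_conv_of_real)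

lemma summable_sgp: "summable (\<lambda>n. t ^ n / fact n * (Gen q ^^ n) g x)"
  by (rule summable_comparison_test'[OF summable_exp_scaled[of t]])
    (use sgp_term_bound[of t _ x] in simp)

lemma sgp_bound: "\<bar>sgp q g t x\<bar> \<le> B * exp (2 * \<bar>t\<bar>)"
proof -
  have s: "summable (\<lambda>n. \<bar>t ^ n / fact n * (Gen q ^^ n) g x\<bar>)"
    by (rule summable_comparison_test'[OF summable_exp_scaled[of t]])
      (use sgp_term_bound[of t _ x] in simp)
  have "\<bar>sgp q g t x\<bar> \<le> (\<Sum>n. \<bar>t ^ n / fact n * (Gen q ^^ n) g x\<bar>)"
    unfolding sgp_def by (rule summable_rabs[OF s])
  also have "\<dots> \<le> (\<Sum>n. B * ((2 * \<bar>t\<bar>) ^ n / fact n))"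
    by (intro suminf_le sgp_term_bound s summable_exp_scaled)
  also have "\<dots> = B * exp (2 * \<bar>t\<bar>)"
    using sums_mult[OF exp_converges[of "2 * \<bar>t\<bar>"], of B]
    by (intro sums_unique[symmetric]) (simp add: field_simps scaleR_conv_of_real)
  finally show ?thesis .
qed

lemma sgp_0: "sgp q g 0 x = g x"
proof -
  have "(\<lambda>n. 0 ^ n / fact n * (Gen q ^^ n) g x) = (\<lambda>n. (Gen q ^^ n) g x / fact n * 0 ^ n)" by auto
  then show ?thesis unfolding sgp_def using powser_zero[of "\<lambda>n. (Gen q ^^ n) g x / fact n"] by simp
qed

text \<open>The backward equation: the power series converges everywhere and \<open>Gen\<close> is a
  finite sum at each site, so it passes through the series.\<close>

lemma sgp_deriv: "((\<lambda>t. sgp q g t x) has_real_derivative Gen q (sgp q g t) x) (at t)"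
proof -
  define c where "c n = (Gen q ^^ n) g x / fact n" for n
  have cs: "summable (\<lambda>n. c n * y ^ n)" for y
    using summable_sgp[of y x] by (simp add: c_def mult.commute)
  have d: "diffs c n * t ^ n = t ^ n / fact n * Gen q ((Gen q ^^ n) g) x" for n
    by (simp add: diffs_def c_def field_simps del: of_nat_Suc)
  have 1: "((\<lambda>t. \<Sum>n. c n * t ^ n) has_real_derivative (\<Sum>n. diffs c n * t ^ n)) (at t)"
    by (rule termdiffs_strong_converges_everywhere[OF cs])
  have "(\<lambda>n. t ^ n / fact n * Gen q ((Gen q ^^ n) g) x) sums Gen q (sgp q g t) x"
  proof -
    have "(\<lambda>n. t ^ n / fact n * (Gen q ^^ n) g y) sums sgp q g t y" for y
      unfolding sgp_def by (rule summable_sums[OF summable_sgp])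
    then have "(\<lambda>n. q x * (\<Sum>e\<in>set_pmf \<pi>. pmf \<pi> e * (t ^ n / fact n * (Gen q ^^ n) g (x + e) - t ^ n / fact n * (Gen q ^^ n) g x)))
      sums (q x * (\<Sum>e\<in>set_pmf \<pi>. pmf \<pi> e * (sgp q g t (x + e) - sgp q g t x)))"
      by (intro sums_mult sums_sum sums_diff)
    then show ?thesis unfolding Gen_scale by (simp add: Gen_def[of q "sgp q g t"])
  qed
  then have "(\<Sum>n. diffs c n * t ^ n) = Gen q (sgp q g t) x"
    unfolding d by (rule sums_unique[symmetric])
  moreover have "(\<lambda>t. sgp q g t x) = (\<lambda>t. \<Sum>n. c n * t ^ n)"
    by (simp add: sgp_def c_def mult.commute)
  ultimately show ?thesis using 1 by simp
qed

lemma sgp_continuous: "continuous_on A (\<lambda>t. sgp q g t x)"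
  using sgp_deriv by (meson DERIV_isCont continuous_at_imp_continuous_on)

lemma sgp_measurable [measurable]: "(\<lambda>t. sgp q g t x) \<in> borel_measurable borel"
  by (intro borel_measurable_continuous_onI sgp_continuous)

end

end

section \<open>Uniqueness for the renewal equation and the transition probabilities\<close>

context step_law
begin

text \<open>Variation of constants for the backward equation. In \<open>F\<close> the factor
  \<open>exp (- h)\<close> cancels the diagonal term of the generator, so its derivative involves
  neighbours only; integrate it over \<open>{0..q x * t}\<close>.\<close>

lemma sgp_renewal:
  assumes q: "\<And>x. 0 < q x" "\<And>x. q x \<le> 1" and g: "\<And>x. \<bar>g x\<bar> \<le> B" and t: "0 \<le> t"
  shows "sgp q g t x = exp (- (q x * t)) * g x
    + (\<integral>h. indicator {0..q x * t} h * (\<Sum>e\<in>set_pmf \<pi>. pmf \<pi> e * sgp q g (t - h / q x) (x + e)) \<partial>expo)"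
proof -
  have q0: "0 \<le> q x" for x using q(1)[of x] by simp
  note deriv = sgp_deriv[OF q0 q(2) g] and cont = sgp_continuous[OF q0 q(2) g]
  note meas [measurable] = sgp_measurable[OF q0 q(2) g]
  define w where "w h = - (exp (- h) * (\<Sum>e\<in>set_pmf \<pi>. pmf \<pi> e * sgp q g (t - h / q x) (x + e)))" for h
  define F where "F h = exp (- h) * sgp q g (t - h / q x) x" for h
  have dF: "DERIV F h :> w h" for h
  proof -
    have qx: "q x \<noteq> 0" using q(1)[of x] by simp
    have "((\<lambda>h. t - h / q x) has_real_derivative (- 1 / q x)) (at h)"
      using qx by (auto intro!: derivative_eq_intros)
    from DERIV_chain2[OF deriv this]
    have d: "((\<lambda>h. sgp q g (t - h / q x) x) has_real_derivative Gen q (sgp q g (t - h / q x)) x * (- 1 / q x)) (at h)" .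
    have e: "((\<lambda>h. exp (- h)) has_real_derivative - exp (- h)) (at h)"
      by (auto intro!: derivative_eq_intros)
    have "Gen q (sgp q g (t - h / q x)) x * (- 1 / q x) = sgp q g (t - h / q x) x
        - (\<Sum>e\<in>set_pmf \<pi>. pmf \<pi> e * sgp q g (t - h / q x) (x + e))"
      using qx by (simp add: Gen_def right_diff_distrib sum_subtractf sum_distrib_right[symmetric] sum_pmf_set diff_divide_distrib)
    then show ?thesis using DERIV_mult[OF e d] unfolding F_def w_def
      by (simp add: algebra_simps)
  qed
  have cw: "continuous_on {0..q x * t} w"
    unfolding w_def
    by (intro continuous_intros continuous_on_compose2[OF cont[of UNIV]]) (use q(1)[of x] in auto)
  have "has_bochner_integral lborel (\<lambda>h. indicator {0..q x * t} h *\<^sub>R w h) (F (q x * t) - F 0)"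
    by (rule has_bochner_integral_FTC_Icc[OF _ _ cw])
      (use q0[of x] t dF in \<open>auto intro: has_field_derivative_at_within simp: has_real_derivative_iff_has_vector_derivative[symmetric]\<close>)
  then have "(\<integral>h. indicator {0..q x * t} h *\<^sub>R w h \<partial>lborel) = F (q x * t) - F 0"
    by (rule has_bochner_integral_integral_eq)
  also have "F (q x * t) = exp (- (q x * t)) * g x"
    using q(1)[of x] sgp_0[OF q0 q(2) g] by (simp add: F_def)
  also have "F 0 = sgp q g t x" by (simp add: F_def)
  also have "(\<integral>h. indicator {0..q x * t} h *\<^sub>R w h \<partial>lborel)
     = - (\<integral>h. indicator {0..q x * t} h * (\<Sum>e\<in>set_pmf \<pi>. pmf \<pi> e * sgp q g (t - h / q x) (x + e)) \<partial>expo)"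
    by (subst integral_expo, measurable, subst Bochner_Integration.integral_minus[symmetric])
      (auto intro!: Bochner_Integration.integral_cong simp: w_def exponential_density_def indicator_def)
  finally show ?thesis by simp
qed

text \<open>The difference of two solutions satisfies the equation without source term. It is
  integrated over holds of length at most \<open>q x * t \<le> T\<close>, an event of probability at
  most \<open>1 - exp (- T) < 1\<close> uniformly in the site, so its sup norm on
  \<open>{0..T}\<close> contracts to 0.\<close>

lemma renewal_unique:
  fixes F G :: "real \<Rightarrow> int ^ 'd \<Rightarrow> real"
  assumes q: "\<And>x. 0 < q x" "\<And>x. q x \<le> 1"
    and F [measurable]: "\<And>x. (\<lambda>t. F t x) \<in> borel_measurable borel"
    and G [measurable]: "\<And>x. (\<lambda>t. G t x) \<in> borel_measurable borel"
    and bF: "\<And>t x. 0 \<le> t \<Longrightarrow> t \<le> T \<Longrightarrow> \<bar>F t x\<bar> \<le> B"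
    and bG: "\<And>t x. 0 \<le> t \<Longrightarrow> t \<le> T \<Longrightarrow> \<bar>G t x\<bar> \<le> B"
    and rF: "\<And>t x. 0 \<le> t \<Longrightarrow> t \<le> T \<Longrightarrow> F t x = exp (- (q x * t)) * g x
      + (\<integral>h. indicator {0..q x * t} h * (\<Sum>e\<in>set_pmf \<pi>. pmf \<pi> e * F (t - h / q x) (x + e)) \<partial>expo)"
    and rG: "\<And>t x. 0 \<le> t \<Longrightarrow> t \<le> T \<Longrightarrow> G t x = exp (- (q x * t)) * g x
      + (\<integral>h. indicator {0..q x * t} h * (\<Sum>e\<in>set_pmf \<pi>. pmf \<pi> e * G (t - h / q x) (x + e)) \<partial>expo)"
    and T: "0 \<le> T"
  shows "F T x = G T x"
proof -
  have avg: "\<bar>\<Sum>e\<in>set_pmf \<pi>. pmf \<pi> e * f e\<bar> \<le> C" if "\<And>e. \<bar>f e\<bar> \<le> C" for f C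
  proof -
    have "\<bar>\<Sum>e\<in>set_pmf \<pi>. pmf \<pi> e * f e\<bar> \<le> (\<Sum>e\<in>set_pmf \<pi>. pmf \<pi> e * C)"
      by (intro order_trans[OF sum_abs] sum_mono) (simp add: abs_mult mult_left_mono that)
    then show ?thesis by (simp add: sum_distrib_right[symmetric] sum_pmf_set)
  qed
  define a where "a = 1 - exp (- T)"
  have a: "0 \<le> a" "a < 1" using T by (auto simp: a_def)
  have B: "0 \<le> B" using bF[of 0 0] T by linarith
  have range: "0 \<le> t - h / q x \<and> t - h / q x \<le> T" if "0 \<le> t" "t \<le> T" "h \<in> {0..q x * t}" for t h x
  proof -
    have "0 \<le> h / q x" "h / q x \<le> t" using that q(1)[of x] by (auto simp: field_simps)
    then show ?thesis using that by linarith
  qed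
  have int: "integrable expo (\<lambda>h. indicator {0..q x * t} h * (\<Sum>e\<in>set_pmf \<pi>. pmf \<pi> e * H (t - h / q x) (x + e)))"
    if [measurable]: "\<And>x. (\<lambda>t. H t x) \<in> borel_measurable borel"
      and bH: "\<And>t x. 0 \<le> t \<Longrightarrow> t \<le> T \<Longrightarrow> \<bar>H t x\<bar> \<le> C" and t: "0 \<le> t" "t \<le> T" and C: "0 \<le> C" for H C t x
  proof (rule expo.integrable_const_bound[where B=C])
    have "\<bar>indicator {0..q x * t} h * (\<Sum>e\<in>set_pmf \<pi>. pmf \<pi> e * H (t - h / q x) (x + e))\<bar> \<le> C" for h
      using range[OF t, of h x] C by (cases "h \<in> {0..q x * t}") (auto intro!: avg bH)
    then show "AE h in expo. norm (indicator {0..q x * t} h * (\<Sum>e\<in>set_pmf \<pi>. pmf \<pi> e * H (t - h / q x) (x + e))) \<le> C"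
      by simp
  qed measurable
  have contract: "\<bar>F t x - G t x\<bar> \<le> a * C"
    if C: "\<And>t x. 0 \<le> t \<Longrightarrow> t \<le> T \<Longrightarrow> \<bar>F t x - G t x\<bar> \<le> C" and t: "0 \<le> t" "t \<le> T" for t x C
  proof -
    have C0: "0 \<le> C" using C[OF t, of 0] by linarith
    have FG: "(\<lambda>t. F t x - G t x) \<in> borel_measurable borel" for x by measurable
    note iF = int[of F B t x, OF F bF t B] and iG = int[of G B t x, OF G bG t B]
      and iD = int[of "\<lambda>t x. F t x - G t x" C t x, OF FG C t C0]
    let ?D = "\<lambda>h. indicator {0..q x * t} h * (\<Sum>e\<in>set_pmf \<pi>. pmf \<pi> e * (F (t - h / q x) (x + e) - G (t - h / q x) (x + e)))"
    have "F t x - G t x = (\<integral>h. indicator {0..q x * t} h * (\<Sum>e\<in>set_pmf \<pi>. pmf \<pi> e * F (t - h / q x) (x + e)) \<partial>expo)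
       - (\<integral>h. indicator {0..q x * t} h * (\<Sum>e\<in>set_pmf \<pi>. pmf \<pi> e * G (t - h / q x) (x + e)) \<partial>expo)"
      using rF[OF t, of x] rG[OF t, of x] by linarith
    also have "\<dots> = (\<integral>h. ?D h \<partial>expo)"
      by (subst Bochner_Integration.integral_diff[OF iF iG, symmetric])
        (simp_all add: right_diff_distrib sum_subtractf)
    finally have eq: "F t x - G t x = (\<integral>h. ?D h \<partial>expo)" .
    have D: "\<bar>?D h\<bar> \<le> indicator {0..q x * t} h * C" for h
    proof (cases "h \<in> {0..q x * t}")
      case True
      then show ?thesis using avg[OF C] range[OF t True] by simp
    qed simp
    have iC: "integrable expo (\<lambda>h. indicator {0..q x * t} h * C)"
      by (rule expo.integrable_const_bound[where B=C]) (auto simp: indicator_def C0)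
    have "\<bar>\<integral>h. ?D h \<partial>expo\<bar> \<le> (\<integral>h. \<bar>?D h\<bar> \<partial>expo)" by (rule integral_abs_bound)
    also have "\<dots> \<le> (\<integral>h. indicator {0..q x * t} h * C \<partial>expo)"
      by (rule integral_mono[OF integrable_abs[OF iD] iC D])
    also have "\<dots> = (1 - exp (- (q x * t))) * C"
      using expo_prob_Icc[of "q x * t"] q(1)[of x] t by (simp add: less_imp_le)
    also have "\<dots> \<le> a * C"
    proof (intro mult_right_mono C0)
      have "q x * t \<le> 1 * T" using q(1)[of x] q(2)[of x] t by (intro mult_mono) auto
      then show "1 - exp (- (q x * t)) \<le> a" by (simp add: a_def)
    qed
    finally show ?thesis unfolding eq .
  qed
  have pow: "\<bar>F t x - G t x\<bar> \<le> a ^ n * (2 * B)" if "0 \<le> t" "t \<le> T" for t x n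
    using that
  proof (induction n arbitrary: t x)
    case 0
    then show ?case using bF[of t x] bG[of t x] by simp
  next
    case (Suc n)
    show ?case using contract[OF Suc.IH Suc.prems, of x] by (simp add: mult.assoc)
  qed
  have "(\<lambda>n. a ^ n * (2 * B)) \<longlonglongrightarrow> 0 * (2 * B)"
    using a by (intro tendsto_mult LIMSEQ_power_zero tendsto_const) auto
  then have "\<bar>F T x - G T x\<bar> \<le> 0 * (2 * B)"
    by (rule LIMSEQ_le_const) (use pow[OF T order_refl] in blast)
  then show ?thesis by simp
qed

lemma visit_prob_semigroup:
  assumes q: "\<And>x. 0 < q x" "\<And>x. q x \<le> 1" and t: "0 \<le> t" and L: "\<forall>z\<in>set L. fst z \<ge> 0"
  shows "visit_prob (\<lambda>x. 1 / q x) L t x = sgp q (visit_prob (\<lambda>x. 1 / q x) L 0) t x"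
proof -
  let ?V = "\<lambda>x. 1 / q x" and ?g = "visit_prob (\<lambda>x. 1 / q x) L 0"
  have q0: "0 \<le> q x" for x using q(1)[of x] by simp
  have b: "\<bar>visit_prob ?V L t x\<bar> \<le> 1" for t x unfolding visit_prob_def by simp
  show ?thesis
  \<comment> \<open>One bound serves both solutions: probabilities are at most 1, and the series is
    at most \<open>exp (2 * u)\<close> at time \<open>u \<le> t\<close>.\<close>
  proof (rule renewal_unique[OF q, where g="?g" and T=t and B="exp (2 * t)"])
    show "\<bar>visit_prob ?V L u x\<bar> \<le> exp (2 * t)" if "0 \<le> u" "u \<le> t" for u x
      using b[of u x] t by (meson one_le_exp_iff order_trans mult_nonneg_nonneg zero_le_numeral)
    show "\<bar>sgp q ?g u x\<bar> \<le> exp (2 * t)" if "0 \<le> u" "u \<le> t" for u x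
    proof -
      have "\<bar>sgp q ?g u x\<bar> \<le> 1 * exp (2 * \<bar>u\<bar>)" by (rule sgp_bound) (rule q0 q(2) b)+
      also have "\<dots> \<le> exp (2 * t)" using that by simp
      finally show ?thesis .
    qed
    show "visit_prob ?V L u x = exp (- (q x * u)) * ?g x
      + (\<integral>h. indicator {0..q x * u} h * (\<Sum>e\<in>set_pmf \<pi>. pmf \<pi> e * visit_prob ?V L (u - h / q x) (x + e)) \<partial>expo)"
      if "0 \<le> u" for u x
      using visit_prob_renewal[of ?V x u L] q(1)[of x] that L by (simp add: mult.commute)
    show "sgp q ?g u x = exp (- (q x * u)) * ?g x
      + (\<integral>h. indicator {0..q x * u} h * (\<Sum>e\<in>set_pmf \<pi>. pmf \<pi> e * sgp q ?g (u - h / q x) (x + e)) \<partial>expo)"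
      if "0 \<le> u" for u x
      by (rule sgp_renewal[of q ?g 1, OF q b that])
  qed (use t sgp_measurable[of q ?g 1, OF q0 q(2) b] in auto)
qed

lemma AE_holds_pos: "AE s in marks. \<forall>k. 0 < snd (s k)"
proof -
  have "AE z in mark. 0 < snd z"
  proof -
    interpret pair_prob_space "measure_pmf \<pi>" expo ..
    have "AE z in measure_pmf \<pi> \<Otimes>\<^sub>M expo. 0 < snd z"
      by (rule AE_pair_measure) (use AE_expo_pos in simp_all)
    then show ?thesis unfolding mark_def .
  qed
  then have "AE s in marks. 0 < snd (s k)" for k
    unfolding marks_def by (intro AE_PiM_component[where i=k]) (simp_all add: mark.prob_space_axioms)
  then show ?thesis by (subst AE_all_countable) simp
qed

lemma walk_path_0: "0 < snd (s 0) * V x \<Longrightarrow> walk_path V x s 0 = x"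
proof -
  assume "0 < snd (s 0) * V x"
  then have *: "0 < clk V x s (Suc 0)" by (simp add: clk_def)
  then have "(LEAST n. 0 < clk V x s (Suc n)) = 0" by (intro Least_equality) auto
  then show ?thesis using * unfolding walk_path_def by auto
qed

definition kernel :: "(int ^ 'd \<Rightarrow> real) \<Rightarrow> real \<Rightarrow> int ^ 'd \<Rightarrow> int ^ 'd \<Rightarrow> real" where
  "kernel q t x y = sgp q (indicator {y}) t x"

fun path_weight :: "(int ^ 'd \<Rightarrow> real) \<Rightarrow> int ^ 'd \<Rightarrow> (real \<times> (int ^ 'd)) list \<Rightarrow> real" where
  "path_weight q x [] = 1"
| "path_weight q x ((d, y) # L) = kernel q d x y * path_weight q y L"

lemma Gen_cmult: "Gen q (\<lambda>x. c * f x) = (\<lambda>x. c * Gen q f x)"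
  using Gen_scale[of q _ c f] by (simp add: Gen_def fun_eq_iff)

lemma Gen_pow_cmult: "(Gen q ^^ n) (\<lambda>x. c * f x) = (\<lambda>x. c * (Gen q ^^ n) f x)"
  by (induction n) (simp_all add: Gen_cmult)

lemma sgp_cmult:
  assumes "\<And>x. 0 \<le> q x" "\<And>x. q x \<le> 1" "\<And>x. \<bar>g x\<bar> \<le> B"
  shows "sgp q (\<lambda>x. c * g x) t x = c * sgp q g t x"
  unfolding sgp_def Gen_pow_cmult
  using suminf_mult[OF summable_sgp[of q g B t x, OF assms], of c] by (simp add: mult_ac)

text \<open>The Markov property at fixed times. The first increment becomes the start time; what
  remains is, at time 0, a multiple of the indicator of \<open>y\<close>, and the semigroup turns it
  into one kernel factor.\<close>

theorem visit_prob_eq_path_weight: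
  assumes q: "\<And>x. 0 < q x" "\<And>x. q x \<le> 1" and L: "\<forall>z\<in>set L. fst z \<ge> 0"
  shows "visit_prob (\<lambda>x. 1 / q x) L 0 x = path_weight q x L"
  using L
proof (induction L arbitrary: x)
  case Nil
  then show ?case using marks.prob_space by (simp add: visit_prob_def)
next
  case (Cons z L)
  obtain d y where z: "z = (d, y)" by (cases z)
  let ?V = "\<lambda>x. 1 / q x"
  have q0: "0 \<le> q x" for x using q(1)[of x] by simp
  have "visit_prob ?V (z # L) 0 x = visit_prob ?V ((0, y) # L) d x"
    by (simp add: visit_prob_def z)
  also have "\<dots> = sgp q (visit_prob ?V ((0, y) # L) 0) d x"
    by (rule visit_prob_semigroup[OF q]) (use Cons.prems z in auto)
  also have "visit_prob ?V ((0, y) # L) 0 = (\<lambda>x. path_weight q y L * indicator {y} x)"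
  proof
    fix x
    \<comment> \<open>A positive first hold is essential: with hold 0 the path would already have
      left \<open>x\<close> at time 0.\<close>
    have AE: "AE s in marks. walk_path ?V x s 0 = x"
      using AE_holds_pos by eventually_elim (simp add: walk_path_0 q)
    have "visit_prob ?V ((0, y) # L) 0 x = measure marks {s. x = y \<and> visits (walk_path ?V x s) 0 L}"
      unfolding visit_prob_def
    proof (rule marks.finite_measure_eq_AE)
      show "AE s in marks. (s \<in> {s. visits (walk_path ?V x s) 0 ((0, y) # L)}) =
          (s \<in> {s. x = y \<and> visits (walk_path ?V x s) 0 L})"
        using AE by eventually_elim auto
      have "{s\<in>space marks. visits (walk_path ?V x s) 0 ((0, y) # L)} \<in> sets marks" by measurable
      then show "{s. visits (walk_path ?V x s) 0 ((0, y) # L)} \<in> sets marks" by simp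
      have "{s\<in>space marks. x = y \<and> visits (walk_path ?V x s) 0 L} \<in> sets marks" by measurable
      then show "{s. x = y \<and> visits (walk_path ?V x s) 0 L} \<in> sets marks" by simp
    qed
    also have "\<dots> = path_weight q y L * indicator {y} x"
      using Cons.IH[of y] Cons.prems by (auto simp: visit_prob_def indicator_def)
    finally show "visit_prob ?V ((0, y) # L) 0 x = path_weight q y L * indicator {y} x" .
  qed
  also have "sgp q \<dots> d x = path_weight q y L * sgp q (indicator {y}) d x"
    by (rule sgp_cmult[OF q0 q(2), where B=1]) (simp add: indicator_def)
  finally show ?case by (simp add: z kernel_def)
qed

end

section \<open>Laws on path space\<close>

lemma space_path_space: "space path_space =
    {Y \<in> extensional {0..}. \<forall>t\<ge>0. continuous (at_right t) (Y :: real \<Rightarrow> int ^ 'd::finite)}"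
  by (auto simp: path_space_def space_restrict_space space_PiM PiE_def)

lemma path_eval_measurable: "0 \<le> t \<Longrightarrow> (\<lambda>Y. Y t) \<in> path_space \<rightarrow>\<^sub>M count_space (UNIV :: (int ^ 'd::finite) set)"
  unfolding path_space_def by (intro measurable_restrict_space1 measurable_component_singleton) simp

lemma measurable_into_path_space:
  assumes "\<And>t. 0 \<le> t \<Longrightarrow> (\<lambda>s. f s t) \<in> M \<rightarrow>\<^sub>M count_space (UNIV :: (int ^ 'd::finite) set)"
    and "\<And>s. s \<in> space M \<Longrightarrow> f s \<in> space path_space"
  shows "f \<in> M \<rightarrow>\<^sub>M path_space"
  unfolding path_space_def
proof (rule measurable_restrict_space2)
  show "f \<in> space M \<rightarrow> {Y. \<forall>t\<ge>0. continuous (at_right t) Y}"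
    using assms(2) by (auto simp: space_path_space)
  show "f \<in> M \<rightarrow>\<^sub>M (\<Pi>\<^sub>M t\<in>{0..}. count_space UNIV)"
    by (rule measurable_PiM_single') (use assms in \<open>auto simp: space_path_space PiE_def\<close>)
qed

definition cyl :: "real set \<Rightarrow> (real \<Rightarrow> int ^ 'd::finite) \<Rightarrow> (real \<Rightarrow> int ^ 'd) set" where
  "cyl J y = {Y \<in> space path_space. \<forall>t\<in>J. Y t = y t}"

text \<open>The empty set is added because cylinders with contradictory values meet in it.\<close>

definition cylinders :: "(real \<Rightarrow> int ^ 'd::finite) set set" where
  "cylinders = insert {} {cyl J y |J y. finite J \<and> J \<subseteq> {0..}}"

lemma cyl_sets:
  assumes "finite J" "J \<subseteq> {0..}" shows "cyl J y \<in> sets path_space"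
  unfolding cyl_def
proof (rule sets.sets_Collect_finite_All[OF _ assms(1)])
  fix t assume "t \<in> J"
  then have "0 \<le> t" using assms by auto
  from measurable_sets[OF path_eval_measurable[OF this], of "{y t}"]
  show "{Y \<in> space path_space. Y t = y t} \<in> sets path_space"
    by (simp add: vimage_def Int_def conj_commute)
qed

lemma cylinders_subset: "cylinders \<subseteq> Pow (space path_space)"
  by (auto simp: cylinders_def cyl_def)

lemma Int_stable_cylinders: "Int_stable cylinders"
proof (rule Int_stableI)
  fix A B :: "(real \<Rightarrow> int ^ 'd) set" assume AB: "A \<in> cylinders" "B \<in> cylinders"
  show "A \<inter> B \<in> cylinders"
  proof (cases "A = {} \<or> B = {}")
    case True then show ?thesis by (auto simp: cylinders_def)
  next
    case False
    then obtain J y J' y' where J: "A = cyl J y" "finite J" "J \<subseteq> {0..}"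
      and J': "B = cyl J' y'" "finite J'" "J' \<subseteq> {0..}"
      using AB by (auto simp: cylinders_def)
    show ?thesis
    proof (cases "\<forall>t\<in>J \<inter> J'. y t = y' t")
      case True
      have "A \<inter> B = cyl (J \<union> J') (\<lambda>t. if t \<in> J then y t else y' t)"
        using True by (auto simp: J(1) J'(1) cyl_def)
      then show ?thesis using J J' unfolding cylinders_def by blast
    next
      case False
      then have "A \<inter> B = {}" by (force simp: J(1) J'(1) cyl_def)
      then show ?thesis by (simp add: cylinders_def)
    qed
  qed
qed

text \<open>One inclusion is measurability of the identity into \<open>path_space\<close>; single
  coordinate values suffice for it, as the lattice is countable.\<close>

lemma sets_path_space_cylinders:
  "sets (path_space :: (real \<Rightarrow> int ^ 'd::finite) measure) = sigma_sets (space path_space) cylinders"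
proof (intro equalityI subsetI)
  fix A assume A: "A \<in> sets (path_space :: (real \<Rightarrow> int ^ 'd) measure)"
  let ?N = "sigma (space path_space) (cylinders :: (real \<Rightarrow> int ^ 'd) set set)"
  have sp: "space ?N = space (path_space :: (real \<Rightarrow> int ^ 'd) measure)"
    and se: "sets ?N = sigma_sets (space path_space) (cylinders :: (real \<Rightarrow> int ^ 'd) set set)"
    using cylinders_subset[where 'a='d] by (simp_all only: space_measure_of sets_measure_of)
  have "(\<lambda>Y. Y) \<in> ?N \<rightarrow>\<^sub>M path_space"
  proof (rule measurable_into_path_space)
    fix t :: real assume t: "0 \<le> t"
    show "(\<lambda>Y. Y t) \<in> ?N \<rightarrow>\<^sub>M count_space UNIV"
      unfolding measurable_count_space_eq_countable[OF countable_lattice]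
    proof (intro conjI ballI)
      fix a :: "int ^ 'd"
      have "(\<lambda>Y. Y t) -` {a} \<inter> space ?N = cyl {t} (\<lambda>_. a)"
        by (auto simp: sp cyl_def)
      also have "\<dots> \<in> cylinders" using t by (auto simp: cylinders_def)
      finally show "(\<lambda>Y. Y t) -` {a} \<inter> space ?N \<in> sets ?N" unfolding se by blast
    qed simp
  qed (simp add: sp)
  from measurable_sets[OF this A] have "A \<inter> space path_space \<in> sets ?N" by (simp add: sp)
  then show "A \<in> sigma_sets (space path_space) cylinders"
    using sets.sets_into_space[OF A] by (simp add: se Int_absorb2)
next
  fix A assume "A \<in> sigma_sets (space path_space) (cylinders :: (real \<Rightarrow> int ^ 'd) set set)"
  then show "A \<in> sets path_space"
    by (rule sets.sigma_sets_subset[THEN subsetD, rotated]) (auto simp: cylinders_def cyl_sets)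
qed

text \<open>\<open>quenched_law\<close> prescribes ordered times beginning with 0, whereas a
  cylinder has an unordered time set. So the times are sorted, 0 is inserted, and the value there is
  the start 0 if \<open>J\<close> leaves it free.\<close>

definition cyl_weight ::
  "real \<Rightarrow> real ^ 'd \<Rightarrow> real \<Rightarrow> 'd::finite env \<Rightarrow> real set \<Rightarrow> (real \<Rightarrow> int ^ 'd) \<Rightarrow> real" where
  "cyl_weight lam l \<beta> \<omega> J y =
     (let T = sorted_list_of_set (insert 0 J); z = (if 0 \<in> J then y else y(0 := 0)) in
      if z 0 = 0
      then \<Prod>i<length T - 1. transition_prob lam l \<beta> \<omega> (T ! Suc i - T ! i) (z (T ! i)) (z (T ! Suc i))
      else 0)"

lemma quenched_law_cyl:
  assumes Q: "quenched_law lam l \<beta> \<omega> Q" and J: "finite J" "J \<subseteq> {0..}"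
  shows "measure Q (cyl J y) = cyl_weight lam l \<beta> \<omega> J y"
proof -
  interpret Q: prob_space Q using Q by (simp add: quenched_law_def)
  have sQ [simp]: "sets Q = sets path_space" using Q by (simp add: quenched_law_def)
  have spQ [simp]: "space Q = space path_space" by (rule sets_eq_imp_space_eq) simp
  have fd: "measure Q {Y \<in> space path_space. \<forall>i\<le>n. Y (t i) = x i} =
      (if x 0 = 0 then \<Prod>i<n. transition_prob lam l \<beta> \<omega> (t (Suc i) - t i) (x i) (x (Suc i)) else 0)"
    if "t 0 = 0" "\<forall>i<n. t i \<le> t (Suc i)" for n and t :: "nat \<Rightarrow> real" and x
    using Q that unfolding quenched_law_def by simp
  define T where "T = sorted_list_of_set (insert 0 J)"
  define z where "z = (if 0 \<in> J then y else y(0 := 0))"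
  have T: "set T = insert 0 J" "sorted T"
    using J(1) unfolding T_def by (simp_all only: set_sorted_list_of_set finite.insertI sorted_sorted_list_of_set)
  have len: "0 < length T" using T(1) by (cases T) auto
  have T0: "T ! 0 = 0"
  proof -
    obtain i where i: "i < length T" "T ! i = 0" using T(1) by (metis in_set_conv_nth insertI1)
    have "T ! 0 \<le> T ! i" using sorted_nth_mono[OF T(2) le0 i(1)] .
    moreover have "0 \<le> T ! 0" using T(1) J(2) len by (metis atLeast_iff insertE nth_mem order_refl subsetD)
    ultimately show ?thesis using i by simp
  qed
  \<comment> \<open>The marginal at time 0 shows that the start is 0 almost surely, so inserting
    time 0 into the cylinder costs nothing.\<close>
  have start: "measure Q (cyl {0} (\<lambda>_. 0)) = 1"
    using fd[of "\<lambda>_. 0" 0 "\<lambda>_. 0"] by (simp add: cyl_def)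
  have AE0: "AE Y in Q. Y 0 = 0"
    using Q.AE_prob_1[OF start] by eventually_elim (simp add: cyl_def)
  have "measure Q (cyl J y) = measure Q (cyl (insert 0 J) z)"
  proof (rule Q.finite_measure_eq_AE)
    show "AE Y in Q. (Y \<in> cyl J y) = (Y \<in> cyl (insert 0 J) z)"
      using AE0 by eventually_elim (auto simp: cyl_def z_def)
  qed (use J in \<open>auto intro!: cyl_sets\<close>)
  also have "cyl (insert 0 J) z = {Y \<in> space path_space. \<forall>i\<le>length T - 1. Y (T ! i) = z (T ! i)}"
  proof -
    have "(\<forall>t\<in>insert 0 J. Y t = z t) \<longleftrightarrow> (\<forall>i\<le>length T - 1. Y (T ! i) = z (T ! i))" for Y
    proof -
      have "(\<forall>t\<in>insert 0 J. Y t = z t) \<longleftrightarrow> (\<forall>t\<in>set T. Y t = z t)" by (simp only: T(1))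
      also have "\<dots> \<longleftrightarrow> (\<forall>i<length T. Y (T ! i) = z (T ! i))" by (rule all_set_conv_all_nth)
      also have "\<dots> \<longleftrightarrow> (\<forall>i\<le>length T - 1. Y (T ! i) = z (T ! i))" using len by (auto simp: less_eq_Suc_le)
      finally show ?thesis .
    qed
    then show ?thesis unfolding cyl_def by blast
  qed
  also have "measure Q \<dots> = cyl_weight lam l \<beta> \<omega> J y"
    by (subst fd) (use T(2) T0 in \<open>auto simp: cyl_weight_def Let_def T_def[symmetric] z_def[symmetric] sorted_nth_mono\<close>)
  finally show ?thesis .
qed

text \<open>Cylinder probabilities are prescribed and cylinders generate. Hence results for an
  arbitrary \<open>Q\<close> may be proved for one convenient realization.\<close>

lemma quenched_law_unique:
  assumes "quenched_law lam l \<beta> \<omega> Q" "quenched_law lam l \<beta> \<omega> Q'"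
  shows "Q = Q'"
proof (rule measure_eqI_generator_eq[OF Int_stable_cylinders cylinders_subset, where A="\<lambda>_. space path_space"])
  interpret Q: prob_space Q using assms by (simp add: quenched_law_def)
  interpret Q': prob_space Q' using assms by (simp add: quenched_law_def)
  show "sets Q = sigma_sets (space path_space) cylinders" "sets Q' = sigma_sets (space path_space) cylinders"
    using assms by (simp_all add: quenched_law_def sets_path_space_cylinders)
  show "emeasure Q X = emeasure Q' X" if "X \<in> cylinders" for X
    using that quenched_law_cyl[OF assms(1)] quenched_law_cyl[OF assms(2)]
    by (auto simp: cylinders_def Q.emeasure_eq_measure Q'.emeasure_eq_measure)
  have "space path_space = cyl {} (\<lambda>_. 0)" by (simp add: cyl_def)
  then show "range (\<lambda>_. space path_space) \<subseteq> cylinders" by (force simp: cylinders_def)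
  show "emeasure Q (space path_space) \<noteq> \<infinity>" by simp
qed simp

section \<open>Measurability in the environment\<close>

lemma jump_weight_measurable [measurable]: "(\<lambda>\<omega>. jump_weight lam l \<beta> \<omega> x e) \<in> borel_measurable (perc p)"
  unfolding jump_weight_def by measurable

lemma generator_pow_measurable [measurable]:
  "(\<lambda>\<omega>. (generator lam l \<beta> \<omega> ^^ n) g x) \<in> borel_measurable (perc p)"
proof (induction n arbitrary: x)
  case (Suc n)
  note Suc [measurable]
  have "(\<lambda>\<omega>. generator lam l \<beta> \<omega> ((generator lam l \<beta> \<omega> ^^ n) g) x) \<in> borel_measurable (perc p)"
    unfolding generator_def[of lam l \<beta> _ "(generator lam l \<beta> _ ^^ n) g"]
    by measurable
  then show ?case by simp
qed simp

lemma transition_prob_measurable [measurable]: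
  "(\<lambda>\<omega>. transition_prob lam l \<beta> \<omega> t x y) \<in> borel_measurable (perc p)"
  unfolding transition_prob_def by measurable

lemma cyl_weight_measurable [measurable]:
  "(\<lambda>\<omega>. cyl_weight lam l \<beta> \<omega> J y) \<in> borel_measurable (perc p)"
  unfolding cyl_weight_def Let_def by measurable

text \<open>The bind in \<open>annealed_law\<close> behaves well for measurable kernels. Although
  \<open>Q\<close> is arbitrary, its cylinder probabilities are explicit measurable functions of the
  environment.\<close>

lemma quenched_law_measurable:
  fixes Q :: "'d::finite env \<Rightarrow> (real \<Rightarrow> int ^ 'd) measure"
  assumes Q: "\<And>\<omega>. quenched_law lam l \<beta> \<omega> (Q \<omega>)"
  shows "Q \<in> perc p \<rightarrow>\<^sub>M subprob_algebra path_space"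
proof (rule measurable_prob_algebraD, rule measurable_prob_algebra_generated[OF sets_path_space_cylinders Int_stable_cylinders cylinders_subset])
  fix \<omega> show "prob_space (Q \<omega>)" "sets (Q \<omega>) = sets path_space" using Q[of \<omega>] by (simp_all add: quenched_law_def)
next
  fix A :: "(real \<Rightarrow> int ^ 'd) set" assume "A \<in> cylinders"
  then consider "A = {}" | J y where "A = cyl J y" "finite J" "J \<subseteq> {0..}" by (auto simp: cylinders_def)
  then show "(\<lambda>\<omega>. emeasure (Q \<omega>) A) \<in> borel_measurable (perc p)"
  proof cases
    case 2
    have "emeasure (Q \<omega>) A = ennreal (cyl_weight lam l \<beta> \<omega> J y)" for \<omega>
    proof -
      interpret prob_space "Q \<omega>" using Q[of \<omega>] by (simp add: quenched_law_def)
      show ?thesis unfolding emeasure_eq_measure 2(1) quenched_law_cyl[OF Q 2(2,3)] ..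
    qed
    then show ?thesis by simp
  qed simp
qed

section \<open>The jump law\<close>

definition nbrs :: "(int ^ 'd::finite) set" where "nbrs = {e. adj e 0}"

lemma finite_nbrs: "finite (nbrs :: (int ^ 'd::finite) set)"
proof (rule finite_subset[OF _ finite_sbox[of 0 1]])
  have "adj 0 e" if "adj e 0" for e :: "int ^ 'd" using that by (simp add: adj_def abs_minus_commute)
  then show "(nbrs :: (int ^ 'd) set) \<subseteq> sbox 0 1" using adj_sbox unfolding nbrs_def by blast
qed

lemma axis_nbrs: "\<bar>c\<bar> = 1 \<Longrightarrow> axis i c \<in> (nbrs :: (int ^ 'd::finite) set)"
  unfolding nbrs_def adj_def
  by (simp add: axis_def if_distrib[of abs] cong: if_cong)

lemma nbrs_nonempty: "(nbrs :: (int ^ 'd::finite) set) \<noteq> {}"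
  using axis_nbrs[of 1] by fastforce

lemma K_norm_nbrs: "K_norm lam l = inverse (\<Sum>e\<in>nbrs. exp (lam * (l \<bullet> to_real e)))"
  by (simp add: K_norm_def nbrs_def)

lemma K_norm_pos: "0 < K_norm lam (l :: real ^ 'd::finite)"
  unfolding K_norm_nbrs using finite_nbrs[where 'd='d] nbrs_nonempty[where 'd='d] by (simp add: sum_pos)

definition jump_pmf :: "real \<Rightarrow> real ^ 'd::finite \<Rightarrow> (int ^ 'd) pmf" where
  "jump_pmf lam l = embed_pmf (\<lambda>e. if e \<in> nbrs then K_norm lam l * exp (lam * (l \<bullet> to_real e)) else 0)"

lemma pmf_jump_pmf:
  fixes l :: "real ^ 'd::finite"
  shows "pmf (jump_pmf lam l) e = (if e \<in> nbrs then K_norm lam l * exp (lam * (l \<bullet> to_real e)) else 0)"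
  unfolding jump_pmf_def
proof (rule pmf_embed_pmf)
  let ?f = "\<lambda>e. if e \<in> nbrs then K_norm lam l * exp (lam * (l \<bullet> to_real e)) else 0"
  show "0 \<le> ?f e" for e using K_norm_pos[of lam l] by simp
  have "(\<integral>\<^sup>+e. ennreal (?f e) \<partial>count_space UNIV) = (\<integral>\<^sup>+e. ennreal (?f e) * indicator nbrs e \<partial>count_space UNIV)"
    by (intro nn_integral_cong) (simp add: indicator_def)
  also have "\<dots> = (\<Sum>e\<in>nbrs. ennreal (?f e))"
    by (subst nn_integral_count_space_indicator[symmetric]) (simp_all add: nn_integral_count_space_finite finite_nbrs)
  also have "\<dots> = ennreal (\<Sum>e\<in>nbrs. K_norm lam l * exp (lam * (l \<bullet> to_real e)))"
    using K_norm_pos[of lam l] by (subst sum_ennreal) (auto intro!: less_imp_le)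
  also have "(\<Sum>e\<in>nbrs. K_norm lam l * exp (lam * (l \<bullet> to_real e))) = 1"
    using K_norm_pos[of lam l] by (simp add: sum_distrib_left[symmetric] K_norm_nbrs)
  finally show "(\<integral>\<^sup>+e. ennreal (?f e) \<partial>count_space UNIV) = 1" by simp
qed

lemma set_jump_pmf: "set_pmf (jump_pmf lam l) = nbrs"
  using K_norm_pos[of lam l] by (auto simp: set_pmf_eq pmf_jump_pmf)

global_interpretation J: step_law "jump_pmf lam l" for lam l
  by unfold_locales (simp add: set_jump_pmf finite_nbrs)

lemma generator_eq_Gen:
  fixes l :: "real ^ 'd::finite"
  assumes fin: "\<And>x. cluster_size \<omega> x \<noteq> \<infinity>"
  shows "generator lam l \<beta> \<omega> = J.Gen lam l (\<lambda>x. 1 / trap \<beta> \<omega> x)"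
proof (intro ext)
  fix f :: "int ^ 'd \<Rightarrow> real" and x :: "int ^ 'd"
  obtain n where n: "cluster_size \<omega> x = enat n" using fin[of x] by auto
  have "generator lam l \<beta> \<omega> f x = K_norm lam l * (\<Sum>e\<in>nbrs. exp (lam * (l \<bullet> to_real e) - \<beta> * real n) * (f (x + e) - f x))"
    by (simp add: generator_def jump_weight_def n nbrs_def)
  also have "\<dots> = exp (- \<beta> * real n) * (\<Sum>e\<in>nbrs. K_norm lam l * exp (lam * (l \<bullet> to_real e)) * (f (x + e) - f x))"
    unfolding sum_distrib_left by (intro sum.cong refl) (simp add: exp_diff exp_minus field_simps)
  also have "\<dots> = J.Gen lam l (\<lambda>x. 1 / trap \<beta> \<omega> x) f x"
    unfolding J.Gen_def set_jump_pmf
    by (simp add: trap_def n exp_minus field_simps pmf_jump_pmf cong: sum.cong)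
  finally show "generator lam l \<beta> \<omega> f x = J.Gen lam l (\<lambda>x. 1 / trap \<beta> \<omega> x) f x" .
qed

lemma transition_prob_eq_kernel:
  assumes "\<And>x. cluster_size \<omega> x \<noteq> \<infinity>"
  shows "transition_prob lam l \<beta> \<omega> t x y = J.kernel lam l (\<lambda>x. 1 / trap \<beta> \<omega> x) t x y"
  unfolding transition_prob_def J.kernel_def J.sgp_def generator_eq_Gen[OF assms] ..

lemma trap_ge_1: "0 \<le> \<beta> \<Longrightarrow> cluster_size \<omega> x \<noteq> \<infinity> \<Longrightarrow> 1 \<le> trap \<beta> \<omega> x"
  by (auto simp: trap_def)

section \<open>The time-changed walk realizes the quenched law\<close>

lemma visits_map_iff:
  "visits Y (t 0) (map (\<lambda>i. (t (Suc i) - t i, x (Suc i))) [0..<n]) \<longleftrightarrow> (\<forall>i<n. Y (t (Suc i)) = x (Suc i))"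
  for t :: "nat \<Rightarrow> real"
proof (induction n arbitrary: t x)
  case (Suc n)
  have "visits Y (t 0) (map (\<lambda>i. (t (Suc i) - t i, x (Suc i))) [0..<Suc n]) \<longleftrightarrow>
     Y (t 1) = x 1 \<and> visits Y (t (Suc 0)) (map (\<lambda>i. (t (Suc (Suc i)) - t (Suc i), x (Suc (Suc i)))) [0..<n])"
    by (simp add: upt_conv_Cons map_Suc_upt[symmetric] comp_def del: upt_Suc)
  also have "\<dots> \<longleftrightarrow> Y (t 1) = x 1 \<and> (\<forall>i<n. Y (t (Suc (Suc i))) = x (Suc (Suc i)))"
    using Suc.IH[of "\<lambda>i. t (Suc i)" "\<lambda>i. x (Suc i)"] by simp
  also have "\<dots> \<longleftrightarrow> (\<forall>i<Suc n. Y (t (Suc i)) = x (Suc i))"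
    by (simp add: All_less_Suc2)
  finally show ?case .
qed simp

context step_law
begin

lemma path_weight_map:
  "path_weight q (x 0) (map (\<lambda>i. (t (Suc i) - t i, x (Suc i))) [0..<n])
     = (\<Prod>i<n. kernel q (t (Suc i) - t i) (x i) (x (Suc i)))"
proof (induction n arbitrary: t x)
  case (Suc n)
  have "path_weight q (x 0) (map (\<lambda>i. (t (Suc i) - t i, x (Suc i))) [0..<Suc n]) =
     kernel q (t 1 - t 0) (x 0) (x 1) *
     path_weight q (x (Suc 0)) (map (\<lambda>i. (t (Suc (Suc i)) - t (Suc i), x (Suc (Suc i)))) [0..<n])"
    by (simp add: upt_conv_Cons map_Suc_upt[symmetric] comp_def del: upt_Suc)
  also have "\<dots> = (\<Prod>i<Suc n. kernel q (t (Suc i) - t i) (x i) (x (Suc i)))"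
    using Suc.IH[of "\<lambda>i. x (Suc i)" "\<lambda>i. t (Suc i)"] by (simp add: prod.lessThan_Suc_shift del: prod.lessThan_Suc)
  finally show ?case .
qed simp

text \<open>Elements of \<open>path_space\<close> are extensional on \<open>{0..}\<close>, so the
  walk has to be restricted to nonnegative times.\<close>

definition ext_path :: "(int ^ 'd \<Rightarrow> real) \<Rightarrow> (nat \<Rightarrow> (int ^ 'd) \<times> real) \<Rightarrow> real \<Rightarrow> int ^ 'd" where
  "ext_path V s = (\<lambda>t\<in>{0..}. walk_path V 0 s t)"

lemma ext_path_measurable [measurable]: "ext_path V \<in> marks \<rightarrow>\<^sub>M path_space"
proof (rule measurable_into_path_space)
  fix t :: real assume "0 \<le> t"
  then have "(\<lambda>s. ext_path V s t) = (\<lambda>s. walk_path V 0 s t)" by (intro ext) (simp add: ext_path_def)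
  moreover have "(\<lambda>s. walk_path V 0 s t) \<in> marks \<rightarrow>\<^sub>M count_space UNIV"
    by (rule walk_path_measurable) simp_all
  ultimately show "(\<lambda>s. ext_path V s t) \<in> marks \<rightarrow>\<^sub>M count_space UNIV" by (simp only:)
next
  fix s :: "nat \<Rightarrow> (int ^ 'd) \<times> real"
  have "continuous (at_right t) (ext_path V s)" if t: "0 \<le> t" for t
  proof -
    obtain b where b: "b > t" "\<forall>u\<in>{t..<b}. walk_path V 0 s u = walk_path V 0 s t"
      using walk_path_right_continuous by blast
    have "\<forall>\<^sub>F u in at_right t. ext_path V s u = ext_path V s t"
      unfolding eventually_at_right_field
    proof (intro exI[of _ b] conjI allI impI)
      fix u assume u: "t < u" "u < b"
      then have "walk_path V 0 s u = walk_path V 0 s t" using b(2) by (meson atLeastLessThan_iff less_imp_le)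
      then show "ext_path V s u = ext_path V s t" using t u by (simp add: ext_path_def)
    qed (rule b(1))
    then show ?thesis unfolding continuous_within by (rule tendsto_eventually)
  qed
  then show "ext_path V s \<in> space path_space"
    by (auto simp: space_path_space ext_path_def)
qed

end

lemma quenched_law_walk:
  fixes l :: "real ^ 'd::finite"
  assumes fin: "\<And>x. cluster_size \<omega> x \<noteq> \<infinity>" and \<beta>: "0 \<le> \<beta>"
  shows "quenched_law lam l \<beta> \<omega> (distr (J.marks lam l) path_space (J.ext_path (trap \<beta> \<omega>)))"
proof -
  let ?M = "J.marks lam l" and ?V = "trap \<beta> \<omega>"
  let ?q = "\<lambda>x. 1 / ?V x" and ?Q = "distr ?M path_space (J.ext_path ?V)"
  have V: "1 \<le> ?V x" for x by (rule trap_ge_1[OF \<beta> fin])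
  have q: "0 < ?q x" "?q x \<le> 1" for x using V[of x] by simp_all
  have Vq: "(\<lambda>x. 1 / ?q x) = ?V" by simp
  have "measure ?Q {Y \<in> space ?Q. \<forall>i\<le>n. Y (t i) = x i} =
          (if x 0 = 0 then \<Prod>i<n. transition_prob lam l \<beta> \<omega> (t (Suc i) - t i) (x i) (x (Suc i)) else 0)"
    if t: "t 0 = 0" "\<forall>i<n. t i \<le> t (Suc i)" for n and t :: "nat \<Rightarrow> real" and x :: "nat \<Rightarrow> int ^ 'd"
  proof -
    have tpos: "0 \<le> t i" if "i \<le> n" for i using that
    proof (induction i)
      case (Suc i) then show ?case using t(2) by (meson Suc_le_lessD less_imp_le order_trans)
    qed (simp add: t)
    let ?L = "map (\<lambda>i. (t (Suc i) - t i, x (Suc i))) [0..<n]"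
    have "{Y \<in> space path_space. \<forall>i\<le>n. Y (t i) = x i} = (\<Inter>i\<in>{..n}. cyl {t i} (\<lambda>_. x i))"
      by (auto simp: cyl_def)
    also have "\<dots> \<in> sets path_space"
      using tpos by (intro sets.finite_INT) (auto intro!: cyl_sets)
    finally have set: "{Y \<in> space path_space. \<forall>i\<le>n. Y (t i) = x i} \<in> sets path_space" .
    have sp: "J.ext_path ?V s \<in> space path_space" for s
      using measurable_space[OF J.ext_path_measurable[of ?V lam l], of s] by simp
    have "measure ?Q {Y \<in> space ?Q. \<forall>i\<le>n. Y (t i) = x i} =
        measure ?M (J.ext_path ?V -` {Y \<in> space path_space. \<forall>i\<le>n. Y (t i) = x i} \<inter> space ?M)"
      unfolding space_distr by (rule measure_distr[OF J.ext_path_measurable set])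
    also have "J.ext_path ?V -` {Y \<in> space path_space. \<forall>i\<le>n. Y (t i) = x i} \<inter> space ?M
        = {s. \<forall>i\<le>n. J.ext_path ?V s (t i) = x i}"
      using sp by auto
    also have "measure ?M \<dots> = measure ?M {s. \<forall>i\<le>n. walk_path ?V 0 s (t i) = x i}"
      using tpos by (intro arg_cong[where f="measure ?M"]) (auto simp: J.ext_path_def)
    \<comment> \<open>Time 0 is split off, since the path starts at 0 almost surely; the later times
      become increments.\<close>
    also have "\<dots> = measure ?M {s. x 0 = 0 \<and> visits (walk_path ?V 0 s) 0 ?L}"
    proof (rule J.marks.finite_measure_eq_AE)
      have "AE s in ?M. walk_path ?V 0 s 0 = 0"
        using J.AE_holds_pos
      proof eventually_elim
        case (elim s) then show ?case using V[of 0] by (intro J.walk_path_0) simp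
      qed
      then show "AE s in ?M. (s \<in> {s. \<forall>i\<le>n. walk_path ?V 0 s (t i) = x i}) = (s \<in> {s. x 0 = 0 \<and> visits (walk_path ?V 0 s) 0 ?L})"
      proof eventually_elim
        case (elim s)
        have "(\<forall>i\<le>n. walk_path ?V 0 s (t i) = x i) \<longleftrightarrow> (\<forall>i<Suc n. walk_path ?V 0 s (t i) = x i)"
          by (simp add: less_Suc_eq_le)
        also have "\<dots> \<longleftrightarrow> x 0 = 0 \<and> (\<forall>i<n. walk_path ?V 0 s (t (Suc i)) = x (Suc i))"
          using elim t(1) by (auto simp: All_less_Suc2)
        finally show ?case using visits_map_iff[of "walk_path ?V 0 s" t x n] t(1) by simp
      qed
      have "{s\<in>space ?M. \<forall>i\<in>{..n}. walk_path ?V 0 s (t i) = x i} \<in> sets ?M" by measurable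
      then show "{s. \<forall>i\<le>n. walk_path ?V 0 s (t i) = x i} \<in> sets ?M" unfolding J.space_marks atMost_iff Ball_def by (simp only: UNIV_I simp_thms)
      have "{s\<in>space ?M. x 0 = 0 \<and> visits (walk_path ?V 0 s) 0 ?L} \<in> sets ?M" by measurable
      then show "{s. x 0 = 0 \<and> visits (walk_path ?V 0 s) 0 ?L} \<in> sets ?M" by (simp only: J.space_marks UNIV_I simp_thms)
    qed
    also have "\<dots> = (if x 0 = 0 then J.visit_prob lam l ?V ?L 0 (x 0) else 0)"
      by (simp add: J.visit_prob_def)
    also have "J.visit_prob lam l ?V ?L 0 (x 0) = J.path_weight lam l ?q (x 0) ?L"
    proof -
      have "\<forall>z\<in>set ?L. 0 \<le> fst z" using t(2) by auto
      from J.visit_prob_eq_path_weight[of ?q, OF q this] show ?thesis unfolding Vq .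
    qed
    also have "\<dots> = (\<Prod>i<n. transition_prob lam l \<beta> \<omega> (t (Suc i) - t i) (x i) (x (Suc i)))"
      unfolding J.path_weight_map transition_prob_eq_kernel[OF fin] ..
    finally show ?thesis .
  qed
  moreover have "prob_space ?Q" by (rule J.marks.prob_space_distr, rule J.ext_path_measurable)
  ultimately show ?thesis by (simp add: quenched_law_def)
qed

text \<open>In almost every environment all clusters are finite, and there uniqueness identifies
  \<open>Q \<omega>\<close> with the law of the time-changed walk. Measurability of \<open>P\<close>
  lets the almost sure statement pass through the bind.\<close>

theorem annealed_AE_transfer:
  fixes Q :: "'d::finite env \<Rightarrow> (real \<Rightarrow> int ^ 'd) measure"
  assumes Q: "\<And>\<omega>. quenched_law lam l \<beta> \<omega> (Q \<omega>)" and \<beta>: "0 \<le> \<beta>"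
    and decay: "cluster_decay_rate TYPE('d) p \<xi>"
    and P: "Measurable.pred path_space P"
    and AE: "AE \<omega> in perc p. AE s in J.marks lam l. P (J.ext_path (trap \<beta> \<omega>) s)"
  shows "AE (\<omega>, Y) in annealed_law p Q. P Y"
proof -
  note Qm = quenched_law_measurable[OF Q, of p]
  have "case_prod Pair \<in> perc p \<Otimes>\<^sub>M path_space \<rightarrow>\<^sub>M perc p \<Otimes>\<^sub>M (path_space :: (real \<Rightarrow> int ^ 'd) measure)"
    by simp
  from measurable_distr2[OF this Qm]
  have B: "(\<lambda>\<omega>. distr (Q \<omega>) (perc p \<Otimes>\<^sub>M path_space) (Pair \<omega>)) \<in> perc p \<rightarrow>\<^sub>M subprob_algebra (perc p \<Otimes>\<^sub>M path_space)" .
  have Pm: "Measurable.pred (perc p \<Otimes>\<^sub>M path_space) (\<lambda>z. P (snd z))"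
    by (rule measurable_compose[OF measurable_snd P])
  have "AE \<omega> in perc p. AE z in distr (Q \<omega>) (perc p \<Otimes>\<^sub>M path_space) (Pair \<omega>). P (snd z)"
    using AE AE_cluster_finite[OF decay]
  proof eventually_elim
    case (elim \<omega>)
    have sQ: "sets (Q \<omega>) = sets path_space" using Q[of \<omega>] by (simp add: quenched_law_def)
    have Qe: "Q \<omega> = distr (J.marks lam l) path_space (J.ext_path (trap \<beta> \<omega>))"
      by (rule quenched_law_unique[OF Q[of \<omega>]], rule quenched_law_walk) (use elim \<beta> in auto)
    have "AE Y in Q \<omega>. P Y"
      unfolding Qe by (rule AE_distr_iff[OF J.ext_path_measurable, THEN iffD2])
        (use P elim(1) in \<open>simp_all only: pred_def\<close>)
    moreover have "Pair \<omega> \<in> Q \<omega> \<rightarrow>\<^sub>M perc p \<Otimes>\<^sub>M path_space"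
      unfolding measurable_cong_sets[OF sQ refl] by (rule measurable_Pair1') simp
    moreover have "{z \<in> space (perc p \<Otimes>\<^sub>M path_space). P (snd z)} \<in> sets (perc p \<Otimes>\<^sub>M path_space)"
      using Pm by (simp only: pred_def)
    ultimately show ?case by (subst AE_distr_iff) simp_all
  qed
  then have "AE z in annealed_law p Q. P (snd z)"
    unfolding annealed_law_def by (subst AE_bind[OF B Pm])
  then show ?thesis by (simp add: split_beta')
qed

section \<open>Simple random walk on the integers\<close>

text \<open>Pascal's rule in summed form; it drives both binomial inductions below.\<close>

lemma sum_binomial_Suc:
  fixes f :: "nat \<Rightarrow> real"
  shows "(\<Sum>k\<le>Suc m. real (Suc m choose k) * f k) = (\<Sum>k\<le>m. real (m choose k) * (f k + f (Suc k)))"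
proof -
  have "(\<Sum>k\<le>Suc m. real (Suc m choose k) * f k) = f 0 + (\<Sum>k\<le>m. real (Suc m choose Suc k) * f (Suc k))"
    by (subst sum.atMost_Suc_shift) simp
  also have "\<dots> = f 0 + (\<Sum>k\<le>m. real (m choose Suc k) * f (Suc k)) + (\<Sum>k\<le>m. real (m choose k) * f (Suc k))"
    by (simp add: distrib_right sum.distrib)
  also have "f 0 + (\<Sum>k\<le>m. real (m choose Suc k) * f (Suc k)) = (\<Sum>k\<le>Suc m. real (m choose k) * f k)"
    by (subst sum.atMost_Suc_shift) simp
  also have "\<dots> = (\<Sum>k\<le>m. real (m choose k) * f k)" by simp
  finally show ?thesis by (simp add: distrib_left sum.distrib)
qed

text \<open>The mass function of simple random walk on the line, in the recursive form that
  conditioning on the first step produces.\<close>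

primrec srw :: "nat \<Rightarrow> int \<Rightarrow> real" where
  "srw 0 u = (if u = 0 then 1 else 0)"
| "srw (Suc m) u = (srw m (u - 1) + srw m (u + 1)) / 2"

lemma srw_binomial: "srw m u = (\<Sum>k\<le>m. real (m choose k) * (if u = 2 * int k - int m then 1 / 2 ^ m else 0))"
proof (induction m arbitrary: u)
  case (Suc m)
  have "(\<Sum>k\<le>Suc m. real (Suc m choose k) * (if u = 2 * int k - int (Suc m) then 1 / 2 ^ Suc m else 0))
     = (\<Sum>k\<le>m. real (m choose k) * ((if u = 2 * int k - int (Suc m) then 1 / 2 ^ Suc m else 0)
         + (if u = 2 * int (Suc k) - int (Suc m) then 1 / 2 ^ Suc m else 0)))"
    by (rule sum_binomial_Suc)
  also have "\<dots> = (\<Sum>k\<le>m. (real (m choose k) * (if u + 1 = 2 * int k - int m then 1 / 2 ^ m else 0)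
      + real (m choose k) * (if u - 1 = 2 * int k - int m then 1 / 2 ^ m else 0)) / 2)"
    by (intro sum.cong refl) (auto simp: algebra_simps)
  also have "\<dots> = (srw m (u + 1) + srw m (u - 1)) / 2"
    by (simp only: sum_divide_distrib[symmetric] sum.distrib Suc.IH)
  finally show ?case by (simp add: add.commute)
qed simp

lemma srw_nonneg: "0 \<le> srw m u"
  by (induction m arbitrary: u) auto

lemma central_binomial_Suc:
  "real (Suc n) * real (2 * Suc n choose Suc n) = 2 * (2 * real n + 1) * real (2 * n choose n)"
proof -
  have "Suc n * (2 * Suc n choose Suc n) = (2 * Suc n) * (Suc (2 * n) choose n)"
    using Suc_times_binomial_eq[of "Suc (2 * n)" n] by (simp add: mult.commute)
  then have 1: "Suc n * (2 * Suc n choose Suc n) = 2 * (Suc n * (Suc (2 * n) choose n))"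
    by simp
  have "Suc (2 * n) choose n = Suc (2 * n) choose Suc n"
    using binomial_symmetric[of n "Suc (2 * n)"] by simp
  then have 2: "Suc n * (Suc (2 * n) choose n) = Suc (2 * n) * (2 * n choose n)"
    using Suc_times_binomial_eq[of "2 * n" n] by (simp add: mult.commute)
  have "Suc n * (2 * Suc n choose Suc n) = 2 * (Suc (2 * n) * (2 * n choose n))"
    using 1 2 by simp
  then have "real (Suc n * (2 * Suc n choose Suc n)) = real (2 * (Suc (2 * n) * (2 * n choose n)))"
    by (rule arg_cong)
  then show ?thesis by (simp add: algebra_simps)
qed

text \<open>For the square with weight \<open>2n + 1\<close> the induction closes, because
  consecutive terms have ratio \<open>(2n + 1)(2n + 3) / (2n + 2)^2 \<le> 1\<close>.\<close>

lemma central_binomial_bound: "(real (2 * n choose n) / 4 ^ n)\<^sup>2 * (2 * real n + 1) \<le> 1"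
proof (induction n)
  case (Suc n)
  define a where "a = real (2 * n choose n) / 4 ^ n"
  have e: "real (2 * Suc n choose Suc n) / 4 ^ Suc n = a * ((2 * real n + 1) / (2 * real n + 2))"
  proof -
    define A where "A = real (2 * Suc n choose Suc n)"
    define B where "B = real (2 * n choose n)"
    have "A = 2 * (2 * real n + 1) * B / (real n + 1)"
      using central_binomial_Suc[of n] unfolding A_def[symmetric] B_def[symmetric] by (simp add: field_simps)
    then have "A / 4 ^ Suc n = 2 * (2 * real n + 1) * B / (real n + 1) / 4 ^ Suc n" by (rule arg_cong)
    also have "\<dots> = B / 4 ^ n * ((2 * real n + 1) / (2 * real n + 2))"
    proof -
      define r where "r = real n + 1"
      define w where "w = 2 * real n + 1"
      have "r \<noteq> 0" "2 * real n + 2 = 2 * r" by (simp_all add: r_def)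
      then show ?thesis unfolding w_def[symmetric] by (simp add: r_def[symmetric])
    qed
    finally show ?thesis unfolding a_def A_def[symmetric] B_def[symmetric] .
  qed
  have "(a * ((2 * real n + 1) / (2 * real n + 2)))\<^sup>2 * (2 * real n + 3)
      = (a\<^sup>2 * (2 * real n + 1)) * ((2 * real n + 1) * (2 * real n + 3) / (2 * real n + 2)\<^sup>2)"
    by (simp add: power2_eq_square field_simps)
  also have "\<dots> \<le> 1 * 1"
  proof (intro mult_mono)
    show "a\<^sup>2 * (2 * real n + 1) \<le> 1" using Suc by (simp add: a_def)
    show "(2 * real n + 1) * (2 * real n + 3) / (2 * real n + 2)\<^sup>2 \<le> 1"
    proof (subst divide_le_eq_1_pos)
      show "0 < (2 * real n + 2)\<^sup>2" by (intro zero_less_power) simp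
    qed (simp add: power2_eq_square algebra_simps)
  qed auto
  finally show ?case unfolding e by (simp add: algebra_simps)
qed simp

text \<open>It suffices to treat the middle coefficient; that of row \<open>2n + 1\<close> is half
  the central one of row \<open>2n + 2\<close>.\<close>

lemma max_binomial_bound: "(real (m choose k) / 2 ^ m)\<^sup>2 * (real m + 1) \<le> 1"
proof -
  have mono: "(real (m choose k) / 2 ^ m)\<^sup>2 * (real m + 1) \<le> (real (m choose (m div 2)) / 2 ^ m)\<^sup>2 * (real m + 1)"
    by (intro mult_right_mono power_mono divide_right_mono) (simp_all add: binomial_maximum)
  show ?thesis
  proof (rule order_trans[OF mono], cases "even m")
    case True
    then obtain n where n: "m = 2 * n" by auto
    show "(real (m choose (m div 2)) / 2 ^ m)\<^sup>2 * (real m + 1) \<le> 1"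
      using central_binomial_bound[of n] by (simp add: n power_mult)
  next
    case False
    then obtain n where n: "m = 2 * n + 1" using oddE by blast
    have "2 * Suc n choose Suc n = 2 * (m choose n)"
      using binomial_symmetric[of n "Suc (2 * n)"] by (simp add: n)
    then have "real (2 * Suc n choose Suc n) = 2 * real (m choose n)" by linarith
    then have "real (m choose n) / 2 ^ m = real (2 * Suc n choose Suc n) / 4 ^ Suc n"
      by (simp add: n power_mult power_add)
    moreover have le: "(real (2 * Suc n choose Suc n) / 4 ^ Suc n)\<^sup>2 * (real m + 1)
        \<le> (real (2 * Suc n choose Suc n) / 4 ^ Suc n)\<^sup>2 * (2 * real (Suc n) + 1)"
      by (intro mult_left_mono) (simp_all add: n)
    moreover have "m div 2 = n" using n by simp
    ultimately show "(real (m choose (m div 2)) / 2 ^ m)\<^sup>2 * (real m + 1) \<le> 1"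
      using order_trans[OF le central_binomial_bound[of "Suc n"]] by (simp only:)
  qed
qed

lemma srw_bound: "srw m u \<le> 1 / sqrt (real m + 1)"
proof -
  have "srw m u \<le> 1 / sqrt (real m + 1)" if k: "k \<le> m" "u = 2 * int k - int m" for k
  proof -
    have "srw m u = (\<Sum>j\<le>m. if j = k then real (m choose k) / 2 ^ m else 0)"
      unfolding srw_binomial by (intro sum.cong refl) (auto simp: k)
    also have "\<dots> = real (m choose k) / 2 ^ m" using k by simp
    finally have e: "srw m u = real (m choose k) / 2 ^ m" .
    have sq: "(sqrt (real m + 1))\<^sup>2 = real m + 1" by simp
    have "(srw m u * sqrt (real m + 1))\<^sup>2 \<le> 1\<^sup>2"
      using max_binomial_bound[of m k] unfolding power_mult_distrib sq e by simp
    then have "srw m u * sqrt (real m + 1) \<le> 1" by (rule power2_le_imp_le) simp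
    then show ?thesis by (simp add: field_simps)
  qed
  moreover have "srw m u = 0" if "\<nexists>k. k \<le> m \<and> u = 2 * int k - int m"
    unfolding srw_binomial by (intro sum.neutral ballI) (use that in auto)
  ultimately show ?thesis by (cases "\<exists>k. k \<le> m \<and> u = 2 * int k - int m") auto
qed

text \<open>Absorption turns \<open>(n choose m) / (m + 1)\<close> into
  \<open>(Suc n choose Suc m) / (n + 1)\<close>; what remains is the expansion of
  \<open>(q + (1 - q)) ^ Suc n\<close> without its first term.\<close>

lemma binomial_inverse_bound:
  assumes q: "0 < q" "q \<le> (1::real)"
  shows "(\<Sum>m\<le>n. real (n choose m) * (q ^ m * (1 - q) ^ (n - m) / (real m + 1))) \<le> 1 / ((real n + 1) * q)"
proof -
  have "(\<Sum>m\<le>n. real (n choose m) * (q ^ m * (1 - q) ^ (n - m) / (real m + 1))) * ((real n + 1) * q)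
      = (\<Sum>m\<le>n. real (Suc n choose Suc m) * q ^ Suc m * (1 - q) ^ (Suc n - Suc m))"
    unfolding sum_distrib_right
  proof (intro sum.cong refl)
    fix m
    have "Suc n * (n choose m) = (Suc n choose Suc m) * Suc m" by (rule Suc_times_binomial_eq)
    then have "real (Suc n * (n choose m)) = real ((Suc n choose Suc m) * Suc m)" by (rule arg_cong)
    then have b: "(real n + 1) * real (n choose m) = real (Suc n choose Suc m) * (real m + 1)"
      by (simp only: of_nat_mult of_nat_Suc) (simp only: add.commute)
    have "real (n choose m) * (q ^ m * (1 - q) ^ (n - m) / (real m + 1)) * ((real n + 1) * q)
        = ((real n + 1) * real (n choose m)) * (q ^ Suc m * (1 - q) ^ (n - m)) / (real m + 1)"
      by simp
    also have "\<dots> = real (Suc n choose Suc m) * q ^ Suc m * (1 - q) ^ (Suc n - Suc m)"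
      unfolding b by simp
    finally show "real (n choose m) * (q ^ m * (1 - q) ^ (n - m) / (real m + 1)) * ((real n + 1) * q)
        = real (Suc n choose Suc m) * q ^ Suc m * (1 - q) ^ (Suc n - Suc m)" .
  qed
  also have "\<dots> \<le> (\<Sum>m\<le>Suc n. real (Suc n choose m) * q ^ m * (1 - q) ^ (Suc n - m))"
    unfolding sum.atMost_Suc_shift[of "\<lambda>m. real (Suc n choose m) * q ^ m * (1 - q) ^ (Suc n - m)" n]
    using q by simp
  also have "\<dots> = 1"
    using binomial_ring[of q "1 - q" "Suc n"] by (simp del: sum.atMost_Suc)
  finally show ?thesis using q by (subst pos_le_divide_eq) auto
qed

text \<open>\<open>(a, b) \<mapsto> (a + b, a - b)\<close> turns a step of the planar walk into two independent steps on the line;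
  conditioning on the binomial number of steps inside the plane gives a mixture of such products.\<close>

lemma thinned_product_bound:
  fixes M :: "nat \<Rightarrow> int \<Rightarrow> int \<Rightarrow> real"
  assumes q: "0 < q" "q \<le> 1"
    and M0: "\<And>a b. M 0 a b = (if a = 0 \<and> b = 0 then 1 else 0)"
    and MS: "\<And>n a b. M (Suc n) a b = q / 4 * (M n (a - 1) b + M n (a + 1) b + M n a (b - 1) + M n a (b + 1)) + (1 - q) * M n a b"
  shows "M n a b \<le> 1 / ((real n + 1) * q)"
proof -
  let ?S = "\<lambda>k a b. srw k (a + b) * srw k (a - b)"
  have S: "?S (Suc k) a b = (?S k (a - 1) b + ?S k (a + 1) b + ?S k a (b - 1) + ?S k a (b + 1)) / 4" for k a b
    by (simp add: algebra_simps add_divide_distrib)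
  have M: "M n a b = (\<Sum>m\<le>n. real (n choose m) * (q ^ m * (1 - q) ^ (n - m) * ?S m a b))" for n a b
  proof (induction n arbitrary: a b)
    case 0 then show ?case by (auto simp: M0)
  next
    case (Suc n)
    let ?w = "\<lambda>m. real (n choose m) * (q ^ m * (1 - q) ^ (n - m))"
    have "(\<Sum>m\<le>Suc n. real (Suc n choose m) * (q ^ m * (1 - q) ^ (Suc n - m) * ?S m a b))
       = (\<Sum>m\<le>n. real (n choose m) * (q ^ m * (1 - q) ^ (Suc n - m) * ?S m a b
            + q ^ Suc m * (1 - q) ^ (Suc n - Suc m) * ?S (Suc m) a b))"
      by (rule sum_binomial_Suc)
    also have "\<dots> = (\<Sum>m\<le>n. q / 4 * (?w m * ?S m (a - 1) b + ?w m * ?S m (a + 1) b + ?w m * ?S m a (b - 1) + ?w m * ?S m a (b + 1))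
        + (1 - q) * (?w m * ?S m a b))"
    proof (intro sum.cong refl)
      fix m assume "m \<in> {..n}"
      then have e: "(1 - q) ^ (Suc n - m) = (1 - q) * (1 - q) ^ (n - m)" by (simp add: Suc_diff_le)
      show "real (n choose m) * (q ^ m * (1 - q) ^ (Suc n - m) * ?S m a b
            + q ^ Suc m * (1 - q) ^ (Suc n - Suc m) * ?S (Suc m) a b)
          = q / 4 * (?w m * ?S m (a - 1) b + ?w m * ?S m (a + 1) b + ?w m * ?S m a (b - 1) + ?w m * ?S m a (b + 1))
        + (1 - q) * (?w m * ?S m a b)"
        unfolding e S by (simp add: field_simps del: srw.simps)
    qed
    also have "\<dots> = q / 4 * (M n (a - 1) b + M n (a + 1) b + M n a (b - 1) + M n a (b + 1)) + (1 - q) * M n a b"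
      unfolding Suc.IH by (simp only: sum.distrib sum_distrib_left mult.assoc distrib_left)
    finally show ?case unfolding MS ..
  qed
  have "?S m a b \<le> 1 / (real m + 1)" for m
  proof -
    have "?S m a b \<le> 1 / sqrt (real m + 1) * (1 / sqrt (real m + 1))"
      by (intro mult_mono srw_bound srw_nonneg) simp
    then show ?thesis by simp
  qed
  then have "M n a b \<le> (\<Sum>m\<le>n. real (n choose m) * (q ^ m * (1 - q) ^ (n - m) * (1 / (real m + 1))))"
    unfolding M using q by (intro sum_mono mult_left_mono) auto
  also have "\<dots> \<le> 1 / ((real n + 1) * q)" using binomial_inverse_bound[OF q, of n] by simp
  finally show ?thesis .
qed

section \<open>The embedded walk\<close>

lemma pos_shift: "pos (\<lambda>i. s (i + j)) i = pos s (i + j) - pos s j"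
proof -
  have "pos s (j + i) = pos s j + pos (\<lambda>k. s (k + j)) i"
    by (induction i) (simp_all add: pos_def add.commute add.left_commute)
  then show ?thesis by (simp add: add.commute)
qed

context step_law
begin

lemma pos_pred_measurable [measurable]: "Measurable.pred marks (\<lambda>s. P (pos s n))"
  by (rule measurable_compose[OF pos_measurable]) simp

lemma pos_sets: "{s. P (pos s n)} \<in> sets marks"
  using pos_pred_measurable[of P n] by (simp add: pred_def)

lemma pos_prob_Suc:
  "measure marks {s. R (pos s (Suc n))} = (\<Sum>e\<in>set_pmf \<pi>. pmf \<pi> e * measure marks {s. R (e + pos s n)})"
proof -
  have "measure marks {s. R (pos s (Suc n))}
     = (\<integral>h. (\<Sum>e\<in>set_pmf \<pi>. pmf \<pi> e * measure marks {s. R (pos (case_nat (e, h) s) (Suc n))}) \<partial>expo)"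
    by (rule marks_prob_split[OF pos_pred_measurable])
  also have "\<dots> = (\<integral>h. (\<Sum>e\<in>set_pmf \<pi>. pmf \<pi> e * measure marks {s. R (e + pos s n)}) \<partial>expo)"
    by (simp only: pos_case_nat fst_conv)
  finally show ?thesis using expo.prob_space by simp
qed

lemma distr_shift: "distr marks marks (\<lambda>s i. s (i + j)) = marks"
proof -
  have "distr marks (PiM UNIV (\<lambda>_. mark)) (\<lambda>s. \<lambda>i\<in>UNIV. s (i + j)) = PiM (UNIV :: nat set) (\<lambda>_. mark)"
    unfolding marks_def
    by (rule distr_PiM_reindex[where f="\<lambda>i. i + j" and K=UNIV and I=UNIV and M="\<lambda>_. mark"])
      (auto simp: mark.prob_space_axioms)
  then show ?thesis by (simp add: marks_def restrict_UNIV)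
qed

lemma increment_prob: "measure marks {s. R (pos s (i + j) - pos s j)} = measure marks {s. R (pos s i)}"
proof -
  have m: "(\<lambda>s i. s (i + j)) \<in> marks \<rightarrow>\<^sub>M marks"
    unfolding marks_def by (rule measurable_PiM_single') (auto simp: space_PiM)
  have "measure marks {s. R (pos s i)} = measure (distr marks marks (\<lambda>s i. s (i + j))) {s. R (pos s i)}"
    by (simp only: distr_shift)
  also have "\<dots> = measure marks ((\<lambda>s i. s (i + j)) -` {s. R (pos s i)} \<inter> space marks)"
    by (rule measure_distr[OF m pos_sets])
  also have "(\<lambda>s i. s (i + j)) -` {s. R (pos s i)} \<inter> space marks = {s. R (pos s (i + j) - pos s j)}"
    by (simp add: pos_shift vimage_def)
  finally show ?thesis ..
qed

text \<open>Condition on the first step and let the threshold \<open>c\<close> vary in the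
  induction: each step then contributes one factor \<open>\<rho>\<close>, as in the exponential
  Markov inequality.\<close>

lemma chernoff:
  assumes add: "\<And>x y. \<phi> (x + y) = \<phi> x + \<phi> y" and z: "\<phi> 0 = (0 :: real)"
    and \<rho>: "(\<Sum>e\<in>set_pmf \<pi>. pmf \<pi> e * exp (- \<phi> e)) \<le> \<rho>"
  shows "measure marks {s. \<phi> (pos s n) \<le> c} \<le> exp c * \<rho> ^ n"
proof (induction n arbitrary: c)
  case 0
  then show ?case using z marks.prob_le_1 by (cases "0 \<le> c") (auto intro: order_trans)
next
  case (Suc n)
  have "0 \<le> (\<Sum>e\<in>set_pmf \<pi>. pmf \<pi> e * exp (- \<phi> e))" by (intro sum_nonneg) simp
  then have \<rho>0: "0 \<le> \<rho>" using \<rho> by linarith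
  have "measure marks {s. \<phi> (pos s (Suc n)) \<le> c} = (\<Sum>e\<in>set_pmf \<pi>. pmf \<pi> e * measure marks {s. \<phi> (pos s n) \<le> c - \<phi> e})"
    using pos_prob_Suc[of "\<lambda>x. \<phi> x \<le> c" n] by (simp add: add le_diff_eq add.commute)
  also have "\<dots> \<le> (\<Sum>e\<in>set_pmf \<pi>. pmf \<pi> e * (exp (c - \<phi> e) * \<rho> ^ n))"
    by (intro sum_mono mult_left_mono Suc.IH) simp
  also have "\<dots> = (exp c * \<rho> ^ n) * (\<Sum>e\<in>set_pmf \<pi>. pmf \<pi> e * exp (- \<phi> e))"
    unfolding sum_distrib_left by (intro sum.cong refl) (simp add: exp_diff exp_minus field_simps)
  also have "\<dots> \<le> (exp c * \<rho> ^ n) * \<rho>"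
    using \<rho> \<rho>0 by (intro mult_left_mono) auto
  finally show ?case by (simp add: mult_ac)
qed

end

lemma nbrs_uminus: "e \<in> nbrs \<longleftrightarrow> - e \<in> nbrs"
  by (simp add: nbrs_def adj_def)

lemma sum_nbrs_uminus: "(\<Sum>e\<in>nbrs. f (- e)) = (\<Sum>e\<in>nbrs. f e)"
  by (rule sum.reindex_bij_witness[where i=uminus and j=uminus]) (auto simp: nbrs_uminus[symmetric])

lemma to_real_add: "to_real (x + y) = to_real x + to_real y"
  and to_real_uminus: "to_real (- x) = - to_real x"
  and to_real_0 [simp]: "to_real 0 = 0"
  by (simp_all add: to_real_def vec_eq_iff)

lemma cosh_gt_1: "(x::real) \<noteq> 0 \<Longrightarrow> 2 < exp x + exp (- x)"
proof -
  assume "x \<noteq> 0"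
  then have "exp (x / 2) \<noteq> exp (- x / 2)" by simp
  then have "0 < (exp (x / 2) - exp (- x / 2))\<^sup>2" by simp
  also have "(exp (x / 2) - exp (- x / 2))\<^sup>2 = exp x + exp (- x) - 2"
    by (simp add: power2_diff exp_add[symmetric] exp_double[symmetric] flip: exp_of_nat_mult)
  finally show ?thesis by simp
qed

lemma cosh_ge_1: "2 \<le> exp x + exp (- x :: real)"
  using cosh_gt_1[of x] by (cases "x = 0") auto

text \<open>Under the tilt by \<open>exp (- lam l \<bullet> e)\<close> all jumps get the same weight.\<close>

lemma drift_contraction:
  fixes l :: "real ^ 'd::finite"
  assumes lam: "0 < lam" and l: "norm l = 1"
  shows "K_norm lam l * real (card (nbrs :: (int ^ 'd) set)) < 1"
proof -
  let ?N = "nbrs :: (int ^ 'd) set" and ?u = "\<lambda>e. lam * (l \<bullet> to_real e)"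
  have "l \<noteq> 0" using l by auto
  then obtain i where i: "l $ i \<noteq> 0" by (auto simp: vec_eq_iff)
  have ax: "axis i 1 \<in> ?N" by (rule axis_nbrs) simp
  have "to_real (axis i 1 :: int ^ 'd) = axis i 1" by (simp add: to_real_def axis_def vec_eq_iff)
  then have ui: "?u (axis i 1) \<noteq> 0" using i lam by (simp add: inner_axis)
  have "real (card ?N) * 2 = (\<Sum>e\<in>?N. 2)" by simp
  also have "\<dots> < (\<Sum>e\<in>?N. exp (?u e) + exp (- ?u e))"
    by (rule sum_strict_mono_ex1[OF finite_nbrs]) (use cosh_ge_1 cosh_gt_1[OF ui] ax in blast)+
  also have "\<dots> = (\<Sum>e\<in>?N. exp (?u e)) + (\<Sum>e\<in>?N. exp (?u (- e)))"
    by (simp add: sum.distrib to_real_uminus)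
  also have "\<dots> = 2 * (\<Sum>e\<in>?N. exp (?u e))"
    using sum_nbrs_uminus[of "\<lambda>e. exp (?u e)"] by simp
  finally have "real (card ?N) < (\<Sum>e\<in>?N. exp (?u e))" by simp
  moreover have "0 < (\<Sum>e\<in>?N. exp (?u e))" using calculation by (meson of_nat_0_le_iff order.strict_trans1)
  ultimately show ?thesis by (simp add: K_norm_nbrs field_simps)
qed

lemma drift_chernoff:
  fixes l :: "real ^ 'd::finite"
  shows "measure (J.marks lam l) {s. lam * (l \<bullet> to_real (pos s n)) \<le> c}
    \<le> exp c * (K_norm lam l * real (card (nbrs :: (int ^ 'd) set))) ^ n"
proof (rule J.chernoff)
  have "(\<Sum>e\<in>nbrs. pmf (jump_pmf lam l) e * exp (- (lam * (l \<bullet> to_real e)))) = (\<Sum>e\<in>(nbrs :: (int ^ 'd) set). K_norm lam l)"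
    by (intro sum.cong refl) (simp add: pmf_jump_pmf exp_minus)
  then show "(\<Sum>e\<in>set_pmf (jump_pmf lam l). pmf (jump_pmf lam l) e * exp (- (lam * (l \<bullet> to_real e))))
     \<le> K_norm lam l * real (card (nbrs :: (int ^ 'd) set))"
    by (simp add: set_jump_pmf mult.commute)
qed (simp_all add: to_real_add inner_add_right distrib_left)

lemma pmf_symmetric: "pmf (jump_pmf 0 l) e = (if e \<in> nbrs then 1 / real (card (nbrs :: (int ^ 'd) set)) else 0)"
  for l :: "real ^ 'd::finite"
  by (simp add: pmf_jump_pmf K_norm_nbrs inverse_eq_divide)

lemma exp_cosh_bound:
  assumes "\<bar>x\<bar> \<le> (1::real)" shows "exp x + exp (- x) \<le> 2 * exp (x\<^sup>2)"
proof -
  have *: "exp y + exp (- y) \<le> 2 * exp (y\<^sup>2)" if y: "0 \<le> y" "y \<le> 1" for y :: real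
  proof -
    have 1: "exp y \<le> 1 + y + y\<^sup>2" using exp_bound[OF y] .
    \<comment> \<open>This product turns the quadratic lower bound for \<open>exp y\<close> into an
      upper bound for \<open>exp (- y)\<close>.\<close>
    have "1 \<le> (1 - y + y\<^sup>2) * (1 + y + y\<^sup>2 / 2)"
    proof -
      have "(1 - y + y\<^sup>2) * (1 + y + y\<^sup>2 / 2) = 1 + y\<^sup>2 / 2 + y ^ 3 / 2 + y ^ 4 / 2"
        by (simp add: power2_eq_square power3_eq_cube power4_eq_xxxx field_simps)
      then show ?thesis using y by simp
    qed
    also have "\<dots> \<le> (1 - y + y\<^sup>2) * exp y"
      using exp_lower_Taylor_quadratic[OF y(1)] y by (intro mult_left_mono) auto
    finally have "exp (- y) \<le> 1 - y + y\<^sup>2" by (simp add: exp_minus field_simps)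
    then have "exp y + exp (- y) \<le> 2 * (1 + y\<^sup>2)" using 1 by simp
    also have "\<dots> \<le> 2 * exp (y\<^sup>2)" by (intro mult_left_mono exp_ge_add_one_self) simp
    finally show ?thesis .
  qed
  show ?thesis
  proof (cases "0 \<le> x")
    case True then show ?thesis using * assms by simp
  next
    case False then show ?thesis using *[of "- x"] assms by simp
  qed
qed

lemma nbr_coord: "e \<in> nbrs \<Longrightarrow> \<bar>e $ i\<bar> \<le> 1"
proof -
  assume "e \<in> nbrs"
  then have "(\<Sum>i\<in>UNIV. \<bar>e $ i\<bar>) = 1" by (simp add: nbrs_def adj_def)
  moreover have "\<bar>e $ i\<bar> \<le> (\<Sum>i\<in>UNIV. \<bar>e $ i\<bar>)" by (rule member_le_sum) auto
  ultimately show ?thesis by simp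
qed

text \<open>Pairing \<open>e\<close> with \<open>- e\<close> replaces the exponential by a
  hyperbolic cosine, which has no first-order term.\<close>

lemma symmetric_chernoff:
  fixes l :: "real ^ 'd::finite"
  assumes \<theta>: "\<bar>\<theta>\<bar> \<le> 1"
  shows "measure (J.marks 0 l) {s. - (\<theta> * real_of_int (pos s n $ i)) \<le> c} \<le> exp c * exp (\<theta>\<^sup>2) ^ n"
proof (rule J.chernoff)
  let ?N = "nbrs :: (int ^ 'd) set"
  let ?u = "\<lambda>e :: int ^ 'd. \<theta> * real_of_int (e $ i)"
  have bd: "exp (?u e) + exp (- ?u e) \<le> 2 * exp (\<theta>\<^sup>2)" if "e \<in> ?N" for e
  proof -
    have e1: "\<bar>real_of_int (e $ i)\<bar> \<le> 1" using nbr_coord[OF that, of i] by linarith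
    have "\<bar>?u e\<bar> \<le> 1 * 1" unfolding abs_mult by (intro mult_mono \<theta> e1) auto
    then have "exp (?u e) + exp (- ?u e) \<le> 2 * exp ((?u e)\<^sup>2)" by (intro exp_cosh_bound) simp
    also have "(?u e)\<^sup>2 \<le> \<theta>\<^sup>2 * 1"
      unfolding power_mult_distrib using e1 by (intro mult_left_mono) (simp_all add: abs_square_le_1)
    finally show ?thesis by simp
  qed
  have pos: "0 < real (card ?N)" using finite_nbrs nbrs_nonempty by (simp add: card_gt_0_iff)
  have "2 * (\<Sum>e\<in>?N. exp (?u e)) = (\<Sum>e\<in>?N. exp (?u e)) + (\<Sum>e\<in>?N. exp (?u (- e)))"
    using sum_nbrs_uminus[of "\<lambda>e. exp (?u e)"] by simp
  also have "\<dots> = (\<Sum>e\<in>?N. exp (?u e) + exp (- ?u e))" by (simp add: sum.distrib)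
  also have "\<dots> \<le> (\<Sum>e\<in>?N. 2 * exp (\<theta>\<^sup>2))" by (intro sum_mono bd)
  also have "\<dots> = 2 * (real (card ?N) * exp (\<theta>\<^sup>2))" by simp
  finally have "(\<Sum>e\<in>?N. exp (?u e)) \<le> real (card ?N) * exp (\<theta>\<^sup>2)" by simp
  then show "(\<Sum>e\<in>set_pmf (jump_pmf 0 l). pmf (jump_pmf 0 l) e * exp (- (- ?u e))) \<le> exp (\<theta>\<^sup>2)"
    using pos by (simp add: set_jump_pmf pmf_symmetric sum_divide_distrib[symmetric] field_simps cong: sum.cong)
qed (simp_all add: distrib_left)

section \<open>Local bounds\<close>

lemma nbr_coord_unique:
  assumes e: "e \<in> nbrs" "e $ i \<noteq> 0"
  shows "e = axis i 1 \<or> e = axis i (- 1)"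
proof -
  have s: "(\<Sum>j\<in>UNIV. \<bar>e $ j\<bar>) = 1" using e by (simp add: nbrs_def adj_def)
  have i: "\<bar>e $ i\<bar> = 1" using nbr_coord[OF e(1), of i] e(2) by linarith
  have "(\<Sum>j\<in>UNIV. \<bar>e $ j\<bar>) = \<bar>e $ i\<bar> + (\<Sum>j\<in>UNIV - {i}. \<bar>e $ j\<bar>)"
    by (subst sum.remove[of _ i]) simp_all
  then have "(\<Sum>j\<in>UNIV - {i}. \<bar>e $ j\<bar>) = 0" using s i by simp
  then have "\<forall>j\<in>UNIV - {i}. \<bar>e $ j\<bar> = 0" by (subst (asm) sum_nonneg_eq_0_iff) auto
  then have z: "e $ j = 0" if "j \<noteq> i" for j using that by auto
  have "e = axis i (e $ i)" using z by (auto simp: axis_def vec_eq_iff)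
  moreover have "e $ i = 1 \<or> e $ i = - 1" using i by linarith
  ultimately show ?thesis by auto
qed

lemma axis_neq: "axis i (1::int) \<noteq> axis i (- 1)"
  by (simp add: axis_eq_axis)

lemma pos_start_prob: "measure (J.marks lam l) {s. R (pos s 0)} = (if R 0 then 1 else 0)"
  using J.marks.prob_space[of lam l] by simp

lemma local_bound_line:
  fixes l :: "real ^ 'd::finite"
  assumes d: "CARD('d) = 1"
  shows "measure (J.marks 0 l) {s. pos s n $ i = a} = srw n a"
proof (induction n arbitrary: a)
  case 0
  show ?case using pos_start_prob[of 0 l "\<lambda>x. x $ i = a"] by auto
next
  case (Suc n)
  have all: "j = i" for j :: 'd using d by (metis (full_types) UNIV_I card_1_singletonE singletonD)
  have N: "(nbrs :: (int ^ 'd) set) = {axis i 1, axis i (- 1)}"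
  proof (intro equalityI subsetI)
    fix e :: "int ^ 'd" assume e: "e \<in> nbrs"
    have "e $ i \<noteq> 0"
    proof
      assume "e $ i = 0"
      then have "e $ j = 0" for j using all[of j] by simp
      then show False using e by (simp add: nbrs_def adj_def)
    qed
    then show "e \<in> {axis i 1, axis i (- 1)}" using nbr_coord_unique[OF e] by auto
  qed (auto intro: axis_nbrs)
  have c: "card (nbrs :: (int ^ 'd) set) = 2" unfolding N using axis_neq[of i] by simp
  have "measure (J.marks 0 l) {s. pos s (Suc n) $ i = a}
      = (\<Sum>e\<in>{axis i 1, axis i (- 1)}. 1 / 2 * measure (J.marks 0 l) {s. (e + pos s n) $ i = a})"
  proof -
    have "measure (J.marks 0 l) {s. pos s (Suc n) $ i = a}
      = (\<Sum>e\<in>nbrs. 1 / 2 * measure (J.marks 0 l) {s. (e + pos s n) $ i = a})"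
      using J.pos_prob_Suc[of 0 l "\<lambda>x. x $ i = a" n]
      by (simp add: set_jump_pmf pmf_symmetric c cong: sum.cong)
    then show ?thesis by (simp only: N)
  qed
  also have "\<dots> = (measure (J.marks 0 l) {s. pos s n $ i = a - 1} + measure (J.marks 0 l) {s. pos s n $ i = a + 1}) / 2"
  proof -
    have "{s. (axis i 1 + pos s n) $ i = a} = {s :: nat \<Rightarrow> (int ^ 'd) \<times> real. pos s n $ i = a - 1}"
      "{s. (axis i (- 1) + pos s n) $ i = a} = {s :: nat \<Rightarrow> (int ^ 'd) \<times> real. pos s n $ i = a + 1}"
      by auto
    then show ?thesis using axis_neq[of i] by simp
  qed
  finally show ?case by (simp add: Suc.IH)
qed

text \<open>Only the four axis steps in directions \<open>i\<close> and \<open>j\<close> move this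
  pair of coordinates, so it performs a planar walk that moves with probability
  \<open>q = 4 / c\<close> and rests otherwise. This covers all dimensions from 2 on.\<close>

lemma local_bound_plane:
  fixes l :: "real ^ 'd::finite"
  assumes ij: "i \<noteq> j"
  shows "measure (J.marks 0 l) {s. pos s n $ i = a \<and> pos s n $ j = b} \<le> real (card (nbrs :: (int ^ 'd) set)) / 4 / (real n + 1)"
proof -
  let ?N = "nbrs :: (int ^ 'd) set"
  let ?F = "{axis i 1, axis i (- 1), axis j 1, axis j (- 1)} :: (int ^ 'd) set"
  define c where "c = real (card ?N)"
  define q where "q = 4 / c"
  define M where "M n a b = measure (J.marks 0 l) {s. pos s n $ i = a \<and> pos s n $ j = b}" for n a b
  have F: "?F \<subseteq> ?N" by (auto intro: axis_nbrs)
  have cF: "card ?F = 4" using ij by (simp add: axis_eq_axis)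
  have c4: "4 \<le> c" using card_mono[OF finite_nbrs F] cF unfolding c_def by simp
  have q: "0 < q" "q \<le> 1" using c4 by (simp_all add: q_def)
  have rest: "e $ i = 0 \<and> e $ j = 0" if "e \<in> ?N - ?F" for e
    using that nbr_coord_unique[of e i] nbr_coord_unique[of e j] by auto
  have M0: "M 0 a b = (if a = 0 \<and> b = 0 then 1 else 0)" for a b
    using pos_start_prob[of 0 l "\<lambda>x. x $ i = a \<and> x $ j = b"] unfolding M_def by auto
  have sh: "measure (J.marks 0 l) {s. (e + pos s n) $ i = a \<and> (e + pos s n) $ j = b} = M n (a - e $ i) (b - e $ j)" for n e a b
    unfolding M_def by (intro arg_cong[where f="measure _"]) auto
  have MS: "M (Suc n) a b = q / 4 * (M n (a - 1) b + M n (a + 1) b + M n a (b - 1) + M n a (b + 1)) + (1 - q) * M n a b" for n a b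
  proof -
    have "M (Suc n) a b = (\<Sum>e\<in>?N. 1 / c * M n (a - e $ i) (b - e $ j))"
      using J.pos_prob_Suc[of 0 l "\<lambda>x. x $ i = a \<and> x $ j = b" n] unfolding sh
      unfolding M_def[of "Suc n"] by (simp add: set_jump_pmf pmf_symmetric c_def cong: sum.cong)
    also have "\<dots> = (\<Sum>e\<in>?N - ?F. 1 / c * M n (a - e $ i) (b - e $ j)) + (\<Sum>e\<in>?F. 1 / c * M n (a - e $ i) (b - e $ j))"
      by (rule sum.subset_diff[OF F finite_nbrs])
    also have "(\<Sum>e\<in>?N - ?F. 1 / c * M n (a - e $ i) (b - e $ j)) = (\<Sum>e\<in>?N - ?F. 1 / c * M n a b)"
      by (intro sum.cong refl) (use rest in auto)
    also have "\<dots> = (1 - q) * M n a b"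
    proof -
      have "real (card (?N - ?F)) = c - 4"
        using card_Diff_subset[OF _ F] card_mono[OF finite_nbrs F] cF unfolding c_def by simp
      then have "(\<Sum>e\<in>?N - ?F. 1 / c * M n a b) = (c - 4) * (1 / c * M n a b)" by (simp only: sum_constant)
      also have "\<dots> = (1 - q) * M n a b" using c4 by (simp add: q_def field_simps)
      finally show ?thesis .
    qed
    also have "(\<Sum>e\<in>?F. 1 / c * M n (a - e $ i) (b - e $ j)) = q / 4 * (M n (a - 1) b + M n (a + 1) b + M n a (b - 1) + M n a (b + 1))"
    proof -
      have "sum f ?F = f (axis i 1) + f (axis i (- 1)) + f (axis j 1) + f (axis j (- 1))" for f :: "int ^ 'd \<Rightarrow> real"
        using ij by (simp add: axis_eq_axis)
      note this[of "\<lambda>e. 1 / c * M n (a - e $ i) (b - e $ j)"]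
      also have "1 / c * M n (a - axis i 1 $ i) (b - axis i 1 $ j) + 1 / c * M n (a - axis i (- 1) $ i) (b - axis i (- 1) $ j)
          + 1 / c * M n (a - axis j 1 $ i) (b - axis j 1 $ j) + 1 / c * M n (a - axis j (- 1) $ i) (b - axis j (- 1) $ j)
          = 1 / c * M n (a - 1) b + 1 / c * M n (a + 1) b + 1 / c * M n a (b - 1) + 1 / c * M n a (b + 1)"
        using ij by (simp add: axis_def)
      finally show ?thesis by (simp add: q_def algebra_simps add_divide_distrib)
    qed
    finally show ?thesis by simp
  qed
  have "M n a b \<le> 1 / ((real n + 1) * q)" by (rule thinned_product_bound[OF q M0 MS])
  then show ?thesis using c4 by (simp add: M_def q_def c_def field_simps)
qed

definition in_box_prob :: "real \<Rightarrow> real ^ 'd::finite \<Rightarrow> nat \<Rightarrow> nat \<Rightarrow> real" where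
  "in_box_prob lam l n r = measure (J.marks lam l) {s. pos s n \<in> sbox 0 r}"

lemma in_box_prob_le_1: "in_box_prob lam l n r \<le> 1"
  by (simp add: in_box_prob_def)

lemma card_centered_interval: "real (card {- int r..int r}) \<le> 2 * (real r + 1)"
  by simp

lemma in_box_prob_line:
  fixes l :: "real ^ 'd::finite"
  assumes d: "CARD('d) = 1"
  shows "in_box_prob 0 l n r \<le> 2 * (real r + 1) / sqrt (real n + 1)"
proof -
  fix i :: 'd
  have "in_box_prob 0 l n r \<le> measure (J.marks 0 l) (\<Union>a\<in>{- int r..int r}. {s. pos s n $ i = a})"
    unfolding in_box_prob_def
  proof (rule J.marks.finite_measure_mono)
    show "{s. pos s n \<in> sbox 0 r} \<subseteq> (\<Union>a\<in>{- int r..int r}. {s. pos s n $ i = a})"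
    proof
      fix s :: "nat \<Rightarrow> (int ^ 'd) \<times> real" assume "s \<in> {s. pos s n \<in> sbox 0 r}"
      then have "\<bar>pos s n $ i\<bar> \<le> int r" by (simp add: sbox_def)
      then show "s \<in> (\<Union>a\<in>{- int r..int r}. {s. pos s n $ i = a})" by (intro UN_I[of "pos s n $ i"]) auto
    qed
    show "(\<Union>a\<in>{- int r..int r}. {s. pos s n $ i = a}) \<in> sets (J.marks 0 l)"
      by (intro sets.finite_UN ballI J.pos_sets[of "\<lambda>x. x $ i = _"]) auto
  qed
  also have "\<dots> \<le> (\<Sum>a\<in>{- int r..int r}. measure (J.marks 0 l) {s. pos s n $ i = a})"
    by (intro J.marks.finite_measure_subadditive_finite) (auto intro!: J.pos_sets[of "\<lambda>x. x $ i = _"])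
  also have "\<dots> \<le> (\<Sum>a\<in>{- int r..int r}. 1 / sqrt (real n + 1))"
    by (intro sum_mono) (simp only: local_bound_line[OF d] srw_bound)
  also have "\<dots> = real (card {- int r..int r}) * (1 / sqrt (real n + 1))" by simp
  also have "\<dots> \<le> 2 * (real r + 1) * (1 / sqrt (real n + 1))"
    by (intro mult_right_mono card_centered_interval) simp
  finally show ?thesis by simp
qed

lemma in_box_prob_plane:
  fixes l :: "real ^ 'd::finite"
  assumes d: "CARD('d) \<ge> 2"
  shows "in_box_prob 0 l n r \<le> real (card (nbrs :: (int ^ 'd) set)) * (real r + 1)\<^sup>2 / (real n + 1)"
proof -
  obtain i j :: 'd where ij: "i \<noteq> j"
    using d by (metis (full_types) UNIV_I card_1_singleton_iff card_le_Suc0_iff_eq finite not_less_eq_eq numeral_2_eq_2)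
  let ?I = "{- int r..int r} \<times> {- int r..int r}"
  let ?E = "\<lambda>z. {s :: nat \<Rightarrow> (int ^ 'd) \<times> real. pos s n $ i = fst z \<and> pos s n $ j = snd z}"
  have E: "?E z \<in> sets (J.marks 0 l)" for z by (rule J.pos_sets[of "\<lambda>x. x $ i = fst z \<and> x $ j = snd z"])
  have "in_box_prob 0 l n r \<le> measure (J.marks 0 l) (\<Union>z\<in>?I. ?E z)"
    unfolding in_box_prob_def
  proof (rule J.marks.finite_measure_mono)
    show "{s. pos s n \<in> sbox 0 r} \<subseteq> (\<Union>z\<in>?I. ?E z)"
    proof
      fix s :: "nat \<Rightarrow> (int ^ 'd) \<times> real" assume "s \<in> {s. pos s n \<in> sbox 0 r}"
      then have "\<bar>pos s n $ i\<bar> \<le> int r" "\<bar>pos s n $ j\<bar> \<le> int r" by (simp_all add: sbox_def)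
      then show "s \<in> (\<Union>z\<in>?I. ?E z)" by (intro UN_I[of "(pos s n $ i, pos s n $ j)"]) auto
    qed
    show "(\<Union>z\<in>?I. ?E z) \<in> sets (J.marks 0 l)" using E by (intro sets.finite_UN) auto
  qed
  also have "\<dots> \<le> (\<Sum>z\<in>?I. measure (J.marks 0 l) (?E z))"
    using E by (intro J.marks.finite_measure_subadditive_finite) auto
  also have "\<dots> \<le> (\<Sum>z\<in>?I. real (card (nbrs :: (int ^ 'd) set)) / 4 / (real n + 1))"
    by (intro sum_mono local_bound_plane[OF ij])
  also have "\<dots> = (real (card {- int r..int r}) * real (card {- int r..int r})) * (real (card (nbrs :: (int ^ 'd) set)) / 4 / (real n + 1))"
    by (simp add: card_cartesian_product)
  also have "\<dots> \<le> (2 * (real r + 1) * (2 * (real r + 1))) * (real (card (nbrs :: (int ^ 'd) set)) / 4 / (real n + 1))"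
    by (intro mult_right_mono mult_mono card_centered_interval) simp_all
  finally show ?thesis by (simp add: power2_eq_square field_simps)
qed

text \<open>In the box the projection on \<open>l\<close> is at most \<open>CARD('d) * r\<close>,
  while the drift makes a small projection exponentially unlikely.\<close>

lemma in_box_prob_drift:
  fixes l :: "real ^ 'd::finite"
  assumes lam: "0 < lam" and l: "norm l = 1"
  shows "in_box_prob lam l n r \<le> exp (lam * real CARD('d) * real r) * (K_norm lam l * real (card (nbrs :: (int ^ 'd) set))) ^ n"
proof -
  have "l \<bullet> to_real x \<le> real CARD('d) * real r" if "x \<in> sbox 0 r" for x
  proof -
    have "l \<bullet> to_real x \<le> norm l * norm (to_real x)" by (rule norm_cauchy_schwarz)
    also have "norm (to_real x) \<le> (\<Sum>i\<in>UNIV. \<bar>to_real x $ i\<bar>)" by (rule norm_le_l1_cart)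
    also have "\<dots> \<le> (\<Sum>i\<in>(UNIV :: 'd set). real r)"
    proof (intro sum_mono)
      fix i
      have "\<bar>x $ i\<bar> \<le> int r" using that by (simp add: sbox_def)
      then show "\<bar>to_real x $ i\<bar> \<le> real r" by (simp add: to_real_def)
    qed
    finally show ?thesis using l by simp
  qed
  then have "{s. pos s n \<in> sbox 0 r} \<subseteq> {s. lam * (l \<bullet> to_real (pos s n)) \<le> lam * real CARD('d) * real r}"
    using lam by (auto simp: mult.assoc)
  then have "in_box_prob lam l n r \<le> measure (J.marks lam l) {s. lam * (l \<bullet> to_real (pos s n)) \<le> lam * real CARD('d) * real r}"
    unfolding in_box_prob_def
    by (rule J.marks.finite_measure_mono) (rule J.pos_sets[of "\<lambda>x. lam * (l \<bullet> to_real x) \<le> _"])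
  also note drift_chernoff
  finally show ?thesis .
qed

section \<open>Green sums\<close>

text \<open>The truncated Green function: the expected number of visits to the box before time
  \<open>n\<close>.\<close>

definition green :: "real \<Rightarrow> real ^ 'd::finite \<Rightarrow> nat \<Rightarrow> nat \<Rightarrow> real" where
  "green lam l n r = (\<Sum>i<n. in_box_prob lam l i r)"

text \<open>The clock estimates see the three cases only through \<open>green_bound\<close> and
  \<open>range_bound_as\<close>, so they are run once for all.\<close>

definition regime :: "real \<Rightarrow> real ^ 'd::finite \<Rightarrow> real \<Rightarrow> bool" where
  "regime lam l \<alpha> \<longleftrightarrow> (0 < lam \<and> norm l = 1 \<and> \<alpha> = 1) \<or> (lam = 0 \<and> CARD('d) \<ge> 2 \<and> \<alpha> = 1)
     \<or> (lam = 0 \<and> CARD('d) = 1 \<and> \<alpha> = 1 / 2)"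

lemma regime_cases:
  assumes "regime lam (l :: real ^ 'd::finite) \<alpha>"
  obtains "0 < lam" "norm l = 1" "\<alpha> = 1" | "lam = 0" "CARD('d) \<ge> 2" "\<alpha> = 1" | "lam = 0" "CARD('d) = 1" "\<alpha> = 1 / 2"
  using assms unfolding regime_def by blast

lemma sum_inverse_sqrt: "(\<Sum>i<n. 1 / sqrt (real i + 1)) \<le> 2 * sqrt (real n)"
proof (induction n)
  case (Suc n)
  let ?a = "sqrt (real n)" and ?b = "sqrt (real n + 1)"
  have b: "0 < ?b" "?a \<le> ?b" "0 \<le> ?a" by simp_all
  have "(?b - ?a) * (?b + ?a) = 1" by (simp add: algebra_simps)
  then have "1 \<le> (?b - ?a) * (2 * ?b)" using b by (metis add_mono mult_2 mult_left_mono order_refl diff_ge_0_iff_ge)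
  then have "1 / ?b \<le> 2 * (?b - ?a)" by (subst pos_divide_le_eq[OF b(1)]) (simp only: mult_ac)
  then show ?case using Suc by (simp add: add.commute)
qed simp

lemma sum_inverse_harm: "1 \<le> n \<Longrightarrow> (\<Sum>i<n. 1 / (real i + 1)) \<le> 1 + ln (real n)"
proof (induction n rule: dec_induct)
  case (step n)
  have n: "0 < real n" using step by simp
  have "1 / (real n + 1) \<le> ln (real n + 1) - ln (real n)"
  proof -
    have "ln (real n / (real n + 1)) \<le> real n / (real n + 1) - 1" using n by (intro ln_le_minus_one) simp
    moreover have "real n / (real n + 1) - 1 = - (1 / (real n + 1))" by (simp add: field_simps)
    moreover have "ln (real n / (real n + 1)) = ln (real n) - ln (real n + 1)" using n by (simp add: ln_div)
    ultimately show ?thesis by linarith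
  qed
  then show ?case using step by (simp add: add.commute)
qed simp

text \<open>Use \<open>f \<le> 1\<close> up to an index near \<open>L / ln (1 / \<rho>)\<close>,
  where \<open>exp L * \<rho> ^ i\<close> has dropped to 1, and a geometric series
  afterwards.\<close>

lemma sum_geometric_cutoff:
  fixes \<rho> L :: real
  assumes \<rho>: "0 < \<rho>" "\<rho> < 1" and L: "0 \<le> L" and f: "\<And>i. f i \<le> 1" "\<And>i. f i \<le> exp L * \<rho> ^ i"
  shows "(\<Sum>i<n. f i) \<le> L / ln (1 / \<rho>) + 1 + 1 / (1 - \<rho>)"
proof -
  have ln: "0 < ln (1 / \<rho>)" using \<rho> by simp
  define k where "k = nat \<lceil>L / ln (1 / \<rho>)\<rceil>"
  have k: "L / ln (1 / \<rho>) \<le> real k" "real k \<le> L / ln (1 / \<rho>) + 1"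
    using L ln unfolding k_def by (simp_all add: of_nat_ceiling)
  have "L \<le> real k * ln (1 / \<rho>)" using k(1) ln by (simp add: pos_divide_le_eq)
  then have "exp L \<le> exp (real k * ln (1 / \<rho>))" by simp
  also have "\<dots> = (1 / \<rho>) ^ k" using \<rho> by (simp add: exp_of_nat_mult)
  finally have eL: "exp L * \<rho> ^ k \<le> 1" using \<rho> by (simp add: power_divide field_simps)
  have s: "summable (\<lambda>i. \<rho> ^ (i :: nat))" using \<rho> by (intro summable_geometric) simp
  have fk: "f (i + k) \<le> \<rho> ^ i" for i
  proof -
    have "f (i + k) \<le> exp L * \<rho> ^ (i + k)" by (rule f)
    also have "\<dots> = (exp L * \<rho> ^ k) * \<rho> ^ i" by (simp add: power_add)
    also have "\<dots> \<le> 1 * \<rho> ^ i" using \<rho> by (intro mult_right_mono eL) simp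
    finally show ?thesis by simp
  qed
  have "(\<Sum>i<n. f i) \<le> real k + (\<Sum>i<n - k. \<rho> ^ i)"
  proof (cases "n \<le> k")
    case True
    have "(\<Sum>i<n. f i) \<le> (\<Sum>i<n. 1)" by (intro sum_mono f)
    then show ?thesis using True \<rho> by simp
  next
    case False
    then have "{..<n} = {..<k} \<union> {k..<n}" by auto
    moreover have "sum f ({..<k} \<union> {k..<n}) = (\<Sum>i<k. f i) + (\<Sum>i\<in>{k..<n}. f i)"
      by (rule sum.union_disjoint) auto
    ultimately have "(\<Sum>i<n. f i) = (\<Sum>i<k. f i) + (\<Sum>i\<in>{k..<n}. f i)" by (simp only:)
    also have "(\<Sum>i\<in>{k..<n}. f i) = (\<Sum>i<n - k. f (i + k))"
      using sum.shift_bounds_nat_ivl[of f 0 k "n - k"] False by (simp add: lessThan_atLeast0)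
    also have "\<dots> \<le> (\<Sum>i<n - k. \<rho> ^ i)" by (intro sum_mono fk)
    also have "(\<Sum>i<k. f i) \<le> (\<Sum>i<k. 1)" by (intro sum_mono f)
    finally show ?thesis by simp
  qed
  also have "(\<Sum>i<n - k. \<rho> ^ i) \<le> (\<Sum>i. \<rho> ^ i)" using \<rho> by (intro sum_le_suminf s) auto
  also have "\<dots> = 1 / (1 - \<rho>)" using \<rho> by (intro suminf_geometric) simp
  finally show ?thesis using k by simp
qed

lemma nbrs_card_pos: "0 < real (card (nbrs :: (int ^ 'd::finite) set))"
  using finite_nbrs nbrs_nonempty by (simp add: card_gt_0_iff)

text \<open>The common shape is wasteful in \<open>r\<close>, which will be logarithmic in
  \<open>n\<close>. The factor \<open>n powr \<delta>\<close> absorbs the harmonic logarithm of the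
  planar case.\<close>

lemma green_bound:
  fixes l :: "real ^ 'd::finite"
  assumes reg: "regime lam l \<alpha>" and \<delta>: "0 < \<delta>"
  shows "\<exists>C>0. \<forall>n\<ge>1. \<forall>r. green lam l n r \<le> C * (real r + 1)\<^sup>2 * real n powr (1 - \<alpha> + \<delta>)"
  using reg
proof (cases rule: regime_cases)
  case 1
  define \<rho> where "\<rho> = K_norm lam l * real (card (nbrs :: (int ^ 'd) set))"
  have \<rho>: "0 < \<rho>" "\<rho> < 1"
    using drift_contraction[OF 1(1,2)] K_norm_pos[of lam l] nbrs_card_pos[where 'd='d] by (simp_all add: \<rho>_def)
  have ln: "0 < ln (1 / \<rho>)" using \<rho> by simp
  define D where "D = lam * real CARD('d) / ln (1 / \<rho>)"
  define C where "C = D + 1 + 1 / (1 - \<rho>)"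
  have D: "0 \<le> D" using ln 1 by (simp add: D_def)
  have C: "0 < C" using D \<rho> by (simp add: C_def add_nonneg_pos)
  show ?thesis
  proof (intro exI[of _ C] conjI C allI impI)
    fix n r :: nat assume n: "1 \<le> n"
    have "green lam l n r \<le> lam * real CARD('d) * real r / ln (1 / \<rho>) + 1 + 1 / (1 - \<rho>)"
      unfolding green_def
    proof (rule sum_geometric_cutoff[OF \<rho>])
      show "0 \<le> lam * real CARD('d) * real r" using 1 by simp
      show "in_box_prob lam l i r \<le> 1" for i by (rule in_box_prob_le_1)
      show "in_box_prob lam l i r \<le> exp (lam * real CARD('d) * real r) * \<rho> ^ i" for i
        unfolding \<rho>_def by (rule in_box_prob_drift[OF 1(1,2)])
    qed
    also have "\<dots> = D * real r + 1 * 1 + 1 / (1 - \<rho>) * 1" by (simp add: D_def)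
    also have "\<dots> \<le> D * (real r + 1) + 1 * (real r + 1) + 1 / (1 - \<rho>) * (real r + 1)"
      using D \<rho> by (intro add_mono mult_left_mono) auto
    also have "\<dots> = C * (real r + 1)" by (simp add: C_def distrib_right)
    also have "\<dots> \<le> C * (real r + 1)\<^sup>2 * 1"
      using C by (simp add: power2_eq_square)
    also have "\<dots> \<le> C * (real r + 1)\<^sup>2 * real n powr (1 - \<alpha> + \<delta>)"
      using C n 1 \<delta> by (intro mult_left_mono ge_one_powr_ge_zero) auto
    finally show "green lam l n r \<le> C * (real r + 1)\<^sup>2 * real n powr (1 - \<alpha> + \<delta>)" .
  qed
next
  case 2
  define c where "c = real (card (nbrs :: (int ^ 'd) set))"
  have c: "0 < c" unfolding c_def by (rule nbrs_card_pos)
  define C where "C = c * (1 + 1 / \<delta>)"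
  have C: "0 < C" using c \<delta> by (simp add: C_def add_pos_pos)
  show ?thesis
  proof (intro exI[of _ C] conjI C allI impI)
    fix n r :: nat assume n: "1 \<le> n"
    have "green lam l n r \<le> (\<Sum>i<n. c * (real r + 1)\<^sup>2 * (1 / (real i + 1)))"
      unfolding green_def c_def using in_box_prob_plane[OF 2(2), of l _ r] 2(1) by (intro sum_mono) simp
    also have "\<dots> = c * (real r + 1)\<^sup>2 * (\<Sum>i<n. 1 / (real i + 1))" by (simp only: sum_distrib_left)
    also have "\<dots> \<le> c * (real r + 1)\<^sup>2 * ((1 + 1 / \<delta>) * real n powr \<delta>)"
    proof (intro mult_left_mono)
      have "1 \<le> real n powr \<delta>" using n \<delta> by (intro ge_one_powr_ge_zero) auto
      moreover have "ln (real n) \<le> real n powr \<delta> / \<delta>" using n \<delta> by (intro ln_powr_bound) auto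
      ultimately have "1 + ln (real n) \<le> (1 + 1 / \<delta>) * real n powr \<delta>" by (simp add: distrib_right)
      then show "(\<Sum>i<n. 1 / (real i + 1)) \<le> (1 + 1 / \<delta>) * real n powr \<delta>" using sum_inverse_harm[OF n] by linarith
    qed (use c in simp)
    finally show "green lam l n r \<le> C * (real r + 1)\<^sup>2 * real n powr (1 - \<alpha> + \<delta>)"
      using 2 by (simp add: C_def mult_ac)
  qed
next
  case 3
  show ?thesis
  proof (intro exI[of _ 4] conjI allI impI)
    fix n r :: nat assume n: "1 \<le> n"
    have "green lam l n r \<le> (\<Sum>i<n. 2 * (real r + 1) * (1 / sqrt (real i + 1)))"
      unfolding green_def using in_box_prob_line[OF 3(2), of l _ r] 3(1) by (intro sum_mono) simp
    also have "\<dots> = 2 * (real r + 1) * (\<Sum>i<n. 1 / sqrt (real i + 1))" by (simp only: sum_distrib_left)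
    also have "\<dots> \<le> 2 * (real r + 1) * (2 * sqrt (real n))"
      by (intro mult_left_mono sum_inverse_sqrt) simp
    also have "\<dots> = 4 * (real r + 1) * real n powr (1 / 2)" using n by (simp add: powr_half_sqrt)
    also have "\<dots> \<le> 4 * (real r + 1)\<^sup>2 * real n powr (1 - \<alpha> + \<delta>)"
      using 3 \<delta> n by (intro mult_mono powr_mono) (auto simp: power2_eq_square)
    finally show "green lam l n r \<le> 4 * (real r + 1)\<^sup>2 * real n powr (1 - \<alpha> + \<delta>)" .
  qed simp
qed

section \<open>Almost sure bounds for the embedded walk\<close>

lemma (in prob_space) borel_cantelli_eventually:
  assumes "\<And>n. {x \<in> space M. P n x} \<in> sets M" and "\<And>n. measure M {x \<in> space M. P n x} \<le> b n" and "summable b"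
  shows "AE x in M. \<forall>\<^sub>F n in sequentially. \<not> P n x"
proof -
  have "summable (\<lambda>n. measure M {x \<in> space M. P n x})"
    by (rule summable_comparison_test'[OF assms(3)]) (use assms(2) in simp)
  then have "AE x in M. \<forall>\<^sub>F n in sequentially. x \<in> space M - {x \<in> space M. P n x}"
    by (intro borel_cantelli_AE1 assms(1)) (simp_all add: emeasure_eq_measure)
  then show ?thesis by eventually_elim (auto elim: eventually_mono)
qed

lemma walk_drift_lower:
  fixes l :: "real ^ 'd::finite"
  assumes lam: "0 < lam" and l: "norm l = 1"
  shows "\<exists>c>0. AE s in J.marks lam l. \<forall>\<^sub>F n in sequentially. c * real n \<le> norm (to_real (pos s n))"
proof -
  define \<rho> where "\<rho> = K_norm lam l * real (card (nbrs :: (int ^ 'd) set))"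
  have \<rho>: "0 < \<rho>" "\<rho> < 1"
    using drift_contraction[OF lam l] K_norm_pos[of lam l] nbrs_card_pos[where 'd='d] by (simp_all add: \<rho>_def)
  \<comment> \<open>Half the exponential rate: \<open>exp c * \<rho>\<close> is the square root of
    \<open>\<rho>\<close>, so the tail bounds remain summable.\<close>
  define c where "c = - ln \<rho> / 2"
  have c: "0 < c" using \<rho> by (simp add: c_def)
  have "exp c * \<rho> = exp (c + ln \<rho>)" using \<rho> by (simp add: exp_add)
  also have "\<dots> < 1" using \<rho> by (simp add: c_def)
  finally have ec: "exp c * \<rho> < 1" .
  have "AE s in J.marks lam l. \<forall>\<^sub>F n in sequentially. \<not> lam * (l \<bullet> to_real (pos s n)) \<le> c * real n"
  proof (rule J.marks.borel_cantelli_eventually)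
    show "{s \<in> space (J.marks lam l). lam * (l \<bullet> to_real (pos s n)) \<le> c * real n} \<in> sets (J.marks lam l)" for n
      using J.pos_sets[of "\<lambda>x. lam * (l \<bullet> to_real x) \<le> c * real n" n lam l] by simp
    show "measure (J.marks lam l) {s \<in> space (J.marks lam l). lam * (l \<bullet> to_real (pos s n)) \<le> c * real n} \<le> (exp c * \<rho>) ^ n" for n
      using drift_chernoff[of lam l n "c * real n"]
      by (simp add: \<rho>_def power_mult_distrib exp_of_nat_mult[symmetric] mult.commute)
    show "summable (\<lambda>n. (exp c * \<rho>) ^ n)" using ec \<rho> by (intro summable_geometric) simp
  qed
  then have "AE s in J.marks lam l. \<forall>\<^sub>F n in sequentially. c / lam * real n \<le> norm (to_real (pos s n))"
  proof eventually_elim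
    case (elim s)
    then show ?case
    proof eventually_elim
      case (elim n)
      have "c * real n < lam * (l \<bullet> to_real (pos s n))" using elim by simp
      also have "l \<bullet> to_real (pos s n) \<le> norm l * norm (to_real (pos s n))" by (rule norm_cauchy_schwarz)
      finally have "c * real n \<le> lam * norm (to_real (pos s n))" using lam l by simp
      then show ?case using lam by (simp add: field_simps)
    qed
  qed
  then show ?thesis using c lam by (intro exI[of _ "c / lam"]) simp
qed

lemma AE_steps: "AE s in J.marks lam l. \<forall>k. fst (s k) \<in> nbrs"
proof -
  have "AE z in J.mark lam l. fst z \<in> nbrs"
  proof -
    interpret pair_prob_space "measure_pmf (jump_pmf lam l)" expo ..
    have "AE z in measure_pmf (jump_pmf lam l) \<Otimes>\<^sub>M expo. fst z \<in> nbrs"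
      by (rule AE_pair_measure) (auto simp: AE_measure_pmf_iff set_jump_pmf)
    then show ?thesis unfolding J.mark_def .
  qed
  then have "AE s in J.marks lam l. fst (s k) \<in> nbrs" for k
    unfolding J.marks_def by (intro AE_PiM_component[where i=k]) (simp_all add: J.mark.prob_space_axioms)
  then show ?thesis by (subst AE_all_countable) simp
qed

lemma norm_to_real_le: "norm (to_real x) \<le> (\<Sum>i\<in>UNIV. \<bar>real_of_int (x $ i)\<bar>)"
  using norm_le_l1_cart[of "to_real x"] by (simp add: to_real_def)

lemma walk_trivial_upper:
  "AE s in J.marks lam l. \<forall>n. norm (to_real (pos s n)) \<le> real n"
  using AE_steps
proof eventually_elim
  case (elim s)
  have "norm (to_real (pos s n)) \<le> real n" for n
  proof (induction n)
    case (Suc n)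
    have "norm (to_real (fst (s n))) \<le> 1"
    proof -
      have "(\<Sum>i\<in>UNIV. \<bar>fst (s n) $ i\<bar>) = 1" using elim[rule_format, of n] by (simp add: nbrs_def adj_def)
      then have "real_of_int (\<Sum>i\<in>UNIV. \<bar>fst (s n) $ i\<bar>) = 1" by simp
      then show ?thesis using norm_to_real_le[of "fst (s n)"] by simp
    qed
    then have "norm (to_real (pos s n) + to_real (fst (s n))) \<le> real n + 1"
      by (intro order_trans[OF norm_triangle_ineq] add_mono Suc)
    then show ?case by (simp add: pos_def to_real_add add.commute)
  qed simp
  then show ?case by blast
qed

lemma walk_diffusive_upper:
  fixes l :: "real ^ 'd::finite"
  assumes \<delta>: "0 < \<delta>"
  shows "AE s in J.marks 0 l. \<forall>\<^sub>F n in sequentially. \<forall>i. \<bar>real_of_int (pos s n $ i)\<bar> \<le> real n powr (1 / 2 + \<delta>)"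
proof -
  define b where "b n = exp 1 * exp (- (real n powr \<delta>))" for n
  have sb: "summable b"
  proof (rule summable_comparison_test_ev)
    have "\<forall>\<^sub>F n in sequentially. b n \<le> real n powr (- 2)"
      unfolding b_def using \<delta> by real_asymp
    then show "\<forall>\<^sub>F n in sequentially. norm (b n) \<le> real n powr (- 2)"
      by eventually_elim (simp add: b_def)
    show "summable (\<lambda>n. real n powr (- 2))" by (simp add: summable_real_powr_iff)
  qed
  have one: "AE s in J.marks 0 l. \<forall>\<^sub>F n in sequentially. \<not> (0 < n \<and> \<sigma> * real_of_int (pos s n $ i) \<ge> real n powr (1 / 2 + \<delta>))"
    if \<sigma>: "\<sigma> = 1 \<or> \<sigma> = - 1" for i and \<sigma> :: real
  proof (rule J.marks.borel_cantelli_eventually[OF _ _ sb])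
    show "{s \<in> space (J.marks 0 l). 0 < n \<and> \<sigma> * real_of_int (pos s n $ i) \<ge> real n powr (1 / 2 + \<delta>)} \<in> sets (J.marks 0 l)" for n
      using J.pos_sets[of "\<lambda>x. 0 < n \<and> \<sigma> * real_of_int (x $ i) \<ge> real n powr (1 / 2 + \<delta>)" n 0 l] by simp
    show "measure (J.marks 0 l) {s \<in> space (J.marks 0 l). 0 < n \<and> \<sigma> * real_of_int (pos s n $ i) \<ge> real n powr (1 / 2 + \<delta>)} \<le> b n" for n
    proof (cases "n = 0")
      case False
      then have n: "1 \<le> real n" "0 < real n" by simp_all
      \<comment> \<open>With \<open>\<theta>^2 = 1 / n\<close> the factor
        \<open>exp (\<theta>^2) ^ n\<close> is the constant \<open>exp 1\<close>, while the
        deviation contributes \<open>exp (- (n powr \<delta>))\<close>.\<close>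
      define \<theta> where "\<theta> = \<sigma> * real n powr (- (1 / 2))"
      have pw: "real n powr (- (1 / 2)) \<le> 1" using powr_mono[of "- (1 / 2)" 0 "real n"] n by simp
      have \<theta>1: "\<bar>\<theta>\<bar> \<le> 1" using \<sigma> pw by (auto simp: \<theta>_def)
      have "(real n powr (- (1 / 2)))\<^sup>2 = real n powr (- 1)"
        by (simp add: power2_eq_square powr_add[symmetric])
      then have \<theta>2: "\<theta>\<^sup>2 = 1 / real n" using \<sigma> n by (auto simp: \<theta>_def power_mult_distrib powr_minus field_simps)
      have "{s \<in> space (J.marks 0 l). 0 < n \<and> \<sigma> * real_of_int (pos s n $ i) \<ge> real n powr (1 / 2 + \<delta>)}
        \<subseteq> {s. - (\<theta> * real_of_int (pos s n $ i)) \<le> - (real n powr \<delta>)}"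
      proof
        fix s assume "s \<in> {s \<in> space (J.marks 0 l). 0 < n \<and> \<sigma> * real_of_int (pos s n $ i) \<ge> real n powr (1 / 2 + \<delta>)}"
        then have "real n powr (1 / 2 + \<delta>) \<le> \<sigma> * real_of_int (pos s n $ i)" by simp
        then have "real n powr (- (1 / 2)) * real n powr (1 / 2 + \<delta>) \<le> real n powr (- (1 / 2)) * (\<sigma> * real_of_int (pos s n $ i))"
          by (rule mult_left_mono) (rule powr_ge_zero)
        also have "real n powr (- (1 / 2)) * real n powr (1 / 2 + \<delta>) = real n powr \<delta>"
          by (simp add: powr_add[symmetric])
        finally show "s \<in> {s. - (\<theta> * real_of_int (pos s n $ i)) \<le> - (real n powr \<delta>)}"
          by (simp add: \<theta>_def mult_ac)
      qed
      then have "measure (J.marks 0 l) {s \<in> space (J.marks 0 l). 0 < n \<and> \<sigma> * real_of_int (pos s n $ i) \<ge> real n powr (1 / 2 + \<delta>)}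
        \<le> measure (J.marks 0 l) {s. - (\<theta> * real_of_int (pos s n $ i)) \<le> - (real n powr \<delta>)}"
        by (rule J.marks.finite_measure_mono) (rule J.pos_sets[of "\<lambda>x. - (\<theta> * real_of_int (x $ i)) \<le> _"])
      also have "\<dots> \<le> exp (- (real n powr \<delta>)) * exp (\<theta>\<^sup>2) ^ n" by (rule symmetric_chernoff[OF \<theta>1])
      also have "exp (\<theta>\<^sup>2) ^ n = exp 1" using n unfolding \<theta>2 by (simp add: exp_of_nat_mult[symmetric])
      finally show ?thesis by (simp add: b_def mult.commute)
    qed (simp add: b_def)
  qed
  have "AE s in J.marks 0 l. \<forall>i\<in>UNIV. (\<forall>\<^sub>F n in sequentially. \<not> (0 < n \<and> 1 * real_of_int (pos s n $ i) \<ge> real n powr (1 / 2 + \<delta>)))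
      \<and> (\<forall>\<^sub>F n in sequentially. \<not> (0 < n \<and> - 1 * real_of_int (pos s n $ i) \<ge> real n powr (1 / 2 + \<delta>)))"
    by (intro AE_ball_countable' AE_conjI one) (auto intro: countable_finite)
  then show ?thesis
  proof eventually_elim
    case (elim s)
    then have "\<forall>\<^sub>F n in sequentially. \<forall>i\<in>UNIV. \<not> (0 < n \<and> 1 * real_of_int (pos s n $ i) \<ge> real n powr (1 / 2 + \<delta>))
       \<and> \<not> (0 < n \<and> - 1 * real_of_int (pos s n $ i) \<ge> real n powr (1 / 2 + \<delta>))"
      by (intro eventually_ball_finite) (auto intro: eventually_conj)
    then show ?case using eventually_gt_at_top[of 0]
      by eventually_elim (auto simp: not_le abs_le_iff intro: less_imp_le)
  qed
qed

lemma summable_dyadic_powr: "0 < \<eta> \<Longrightarrow> summable (\<lambda>k. C * real (2 ^ k) powr (- \<eta>))"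
proof -
  assume "0 < \<eta>"
  have "real (2 ^ k) powr (- \<eta>) = (2 powr (- \<eta>)) ^ k" for k
    by (simp add: powr_realpow[symmetric] powr_powr mult.commute)
  moreover have "2 powr (- \<eta>) < (1::real)" using \<open>0 < \<eta>\<close> by (simp add: powr_minus_divide)
  ultimately show ?thesis by (auto intro!: summable_mult summable_geometric)
qed

text \<open>The local bounds give a box of radius \<open>n powr (1 / 2 - \<delta>)\<close>
  probability at most of order \<open>n powr (- \<delta>)\<close>, which is summable along
  \<open>n = 2 ^ k\<close>; for a limsup this is enough.\<close>

lemma walk_diffusive_lower:
  fixes l :: "real ^ 'd::finite"
  assumes \<delta>: "0 < \<delta>" "\<delta> < 1 / 2"
  shows "AE s in J.marks 0 l. \<forall>\<^sub>F k in sequentially. real (2 ^ k) powr (1 / 2 - \<delta>) \<le> norm (to_real (pos s (2 ^ k)))"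
proof -
  define r where "r k = nat \<lfloor>real (2 ^ k) powr (1 / 2 - \<delta>)\<rfloor>" for k :: nat
  define c where "c = 4 + 4 * real (card (nbrs :: (int ^ 'd) set))"
  have bound: "in_box_prob 0 l (2 ^ k) (r k) \<le> c * real (2 ^ k) powr (- \<delta>)" for k
  proof -
    define n where "n = real (2 ^ k)"
    have n: "1 \<le> n" unfolding n_def by simp
    have "real (r k) \<le> n powr (1 / 2 - \<delta>)" unfolding r_def n_def by simp
    moreover have "1 \<le> n powr (1 / 2 - \<delta>)" using n \<delta> by (intro ge_one_powr_ge_zero) auto
    ultimately have r: "real (r k) + 1 \<le> 2 * n powr (1 / 2 - \<delta>)" by simp
    consider "CARD('d) = 1" | "CARD('d) \<ge> 2"
      by (metis One_nat_def Suc_leI finite_UNIV_card_ge_0 finite le_neq_implies_less numeral_2_eq_2)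
    then show ?thesis
    proof cases
      case 1
      have "in_box_prob 0 l (2 ^ k) (r k) \<le> 2 * (real (r k) + 1) / sqrt (n + 1)"
        using in_box_prob_line[OF 1, of l "2 ^ k" "r k"] by (simp add: n_def)
      also have "\<dots> \<le> 2 * (2 * n powr (1 / 2 - \<delta>)) / (n powr (1 / 2))"
        using n r by (intro frac_le mult_left_mono) (auto simp: powr_half_sqrt)
      also have "\<dots> = 4 * (n powr (1 / 2 - \<delta>) / n powr (1 / 2))" by simp
      also have "\<dots> = 4 * n powr (- \<delta>)" by (simp add: powr_diff[symmetric])
      also have "\<dots> \<le> c * n powr (- \<delta>)" by (intro mult_right_mono) (simp_all add: c_def)
      finally show ?thesis by (simp add: n_def)
    next
      case 2
      let ?c = "real (card (nbrs :: (int ^ 'd) set))"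
      have "in_box_prob 0 l (2 ^ k) (r k) \<le> ?c * (real (r k) + 1)\<^sup>2 / (n + 1)"
        using in_box_prob_plane[OF 2, of l "2 ^ k" "r k"] by (simp add: n_def)
      also have "\<dots> \<le> ?c * (2 * n powr (1 / 2 - \<delta>))\<^sup>2 / n"
        using n r by (intro frac_le mult_left_mono power_mono) auto
      also have "(2 * n powr (1 / 2 - \<delta>))\<^sup>2 = 4 * n powr (1 - 2 * \<delta>)"
        by (simp add: power_mult_distrib power2_eq_square powr_add[symmetric])
      also have "?c * (4 * n powr (1 - 2 * \<delta>)) / n = 4 * ?c * n powr (- (2 * \<delta>))"
        using n by (simp add: powr_diff powr_minus field_simps)
      also have "\<dots> \<le> c * n powr (- \<delta>)"
        using n \<delta> by (intro mult_mono powr_mono) (simp_all add: c_def)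
      finally show ?thesis by (simp add: n_def)
    qed
  qed
  have "AE s in J.marks 0 l. \<forall>\<^sub>F k in sequentially. \<not> pos s (2 ^ k) \<in> sbox 0 (r k)"
  proof (rule J.marks.borel_cantelli_eventually)
    show "{s \<in> space (J.marks 0 l). pos s (2 ^ k) \<in> sbox 0 (r k)} \<in> sets (J.marks 0 l)" for k
      using J.pos_sets[of "\<lambda>x. x \<in> sbox 0 (r k)" "2 ^ k" 0 l] by simp
    show "measure (J.marks 0 l) {s \<in> space (J.marks 0 l). pos s (2 ^ k) \<in> sbox 0 (r k)} \<le> c * real (2 ^ k) powr (- \<delta>)" for k
      using bound[of k] by (simp add: in_box_prob_def)
    show "summable (\<lambda>k. c * real (2 ^ k) powr (- \<delta>))" by (rule summable_dyadic_powr[OF \<delta>(1)])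
  qed
  then show ?thesis
  proof eventually_elim
    case (elim s)
    then show ?case
    proof eventually_elim
      case (elim k)
      then obtain i where i: "int (r k) < \<bar>pos s (2 ^ k) $ i\<bar>" by (auto simp: sbox_def not_le)
      have "real (2 ^ k) powr (1 / 2 - \<delta>) \<le> real (r k) + 1" unfolding r_def by linarith
      also have "\<dots> \<le> \<bar>to_real (pos s (2 ^ k)) $ i\<bar>" using i by (simp add: to_real_def)
      also have "\<dots> \<le> norm (to_real (pos s (2 ^ k)))" by (rule component_le_norm_cart)
      finally show ?case .
    qed
  qed
qed

section \<open>Upper bound for the clock\<close>

abbreviation joint :: "real \<Rightarrow> real \<Rightarrow> real ^ 'd::finite \<Rightarrow> ('d env \<times> (nat \<Rightarrow> (int ^ 'd) \<times> real)) measure" where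
  "joint p lam l \<equiv> perc p \<Otimes>\<^sub>M J.marks lam l"

lemma pair_prob_joint: "pair_prob_space (perc p) (J.marks lam l)"
  by (intro pair_prob_space.intro pair_sigma_finite.intro prob_space_imp_sigma_finite prob_space_perc J.marks.prob_space_axioms)

lemma prob_space_joint: "prob_space (joint p lam l)"
proof -
  interpret pair_prob_space "perc p" "J.marks lam l" by (rule pair_prob_joint)
  show ?thesis by (rule prob_space_axioms)
qed

lemma space_joint [simp]: "space (joint p lam l) = UNIV"
  by (simp add: space_pair_measure)

lemma pos_joint_measurable: "(\<lambda>z. pos (snd z) k) \<in> joint p lam l \<rightarrow>\<^sub>M count_space UNIV"
  by (rule measurable_compose[OF measurable_snd J.pos_measurable])

text \<open>The random site takes countably many values, so a measurable field may be evaluated at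
  it.\<close>

lemma at_pos_joint_measurable:
  assumes "\<And>x. (\<lambda>\<omega>. f \<omega> x) \<in> perc p \<rightarrow>\<^sub>M N"
  shows "(\<lambda>z. f (fst z) (pos (snd z) k)) \<in> joint p lam l \<rightarrow>\<^sub>M N"
  by (rule measurable_compose_countable'[OF _ pos_joint_measurable countable_lattice])
    (rule measurable_compose[OF measurable_fst assms])

lemma hold_joint_measurable: "(\<lambda>z. snd (snd z k)) \<in> borel_measurable (joint p lam l)"
  by (rule measurable_compose[OF measurable_snd J.hold_measurable])

lemma clk_joint_measurable: "(\<lambda>z. clk (trap \<beta> (fst z)) 0 (snd z) n) \<in> borel_measurable (joint p lam l)"
  unfolding clk_def add_0
  by (intro borel_measurable_sum borel_measurable_times hold_joint_measurable at_pos_joint_measurable trap_measurable)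

text \<open>Fubini with the marks fixed first: given the marks, the visited sites are deterministic
  and only the environment is random.\<close>

lemma joint_emeasure_le:
  assumes A: "{z. P (fst z) (snd z)} \<in> sets (joint p lam l)"
    and f: "AE s in J.marks lam l. emeasure (perc p) {\<omega>. P \<omega> s} \<le> f s"
  shows "emeasure (joint p lam l) {z. P (fst z) (snd z)} \<le> (\<integral>\<^sup>+s. f s \<partial>J.marks lam l)"
proof -
  interpret pair_prob_space "perc p" "J.marks lam l" by (rule pair_prob_joint)
  have "emeasure (joint p lam l) {z. P (fst z) (snd z)} = (\<integral>\<^sup>+s. emeasure (perc p) {\<omega>. P \<omega> s} \<partial>J.marks lam l)"
    by (subst emeasure_pair_measure_alt2[OF A]) (simp add: vimage_def)
  also have "\<dots> \<le> (\<integral>\<^sup>+s. f s \<partial>J.marks lam l)" by (rule nn_integral_mono_AE[OF f])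
  finally show ?thesis .
qed

lemma powr_subadditive:
  fixes u v a :: real
  assumes "0 \<le> u" "0 \<le> v" "0 < a" "a \<le> 1"
  shows "(u + v) powr a \<le> u powr a + v powr a"
proof (cases "u = 0 \<or> v = 0")
  case False
  then have uv: "0 < u" "0 < v" using assms by auto
  have e: "x powr a = x * x powr (a - 1)" if "0 < x" for x :: real
    using that by (simp add: powr_diff)
  have "(u + v) powr a = u * (u + v) powr (a - 1) + v * (u + v) powr (a - 1)"
    using uv by (simp add: e distrib_right)
  also have "\<dots> \<le> u * u powr (a - 1) + v * v powr (a - 1)"
    using uv assms by (intro add_mono mult_left_mono powr_mono2') auto
  finally show ?thesis using uv by (simp add: e)
qed (use assms in auto)

lemma powr_sum_subadditive:
  fixes y :: "'i \<Rightarrow> real"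
  assumes "finite A" "\<And>x. x \<in> A \<Longrightarrow> 0 \<le> y x" "0 < a" "a \<le> 1"
  shows "(\<Sum>x\<in>A. y x) powr a \<le> (\<Sum>x\<in>A. y x powr a)"
  using assms
proof (induction A rule: finite_induct)
  case (insert x A)
  have "(y x + (\<Sum>x\<in>A. y x)) powr a \<le> y x powr a + (\<Sum>x\<in>A. y x) powr a"
    using insert.prems by (intro powr_subadditive sum_nonneg) auto
  then show ?case using insert by (simp add: order_trans)
qed simp

text \<open>The majorant is affine in \<open>t\<close> because occupation times, summed over sites,
  give the total of the holds whatever the path. The scale \<open>c\<close> will be the typical
  number of visits to a site.\<close>

lemma powr_le_affine:
  fixes t c a :: real
  assumes "0 \<le> t" "0 < c" "0 < a" "a \<le> 1"
  shows "t powr a \<le> c powr a + c powr (a - 1) * t"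
proof (cases "t \<le> c")
  case True
  then have "t powr a \<le> c powr a" using assms by (intro powr_mono2) auto
  moreover have "0 \<le> c powr (a - 1) * t" using assms by simp
  ultimately show ?thesis by linarith
next
  case False
  then have t: "0 < t" using assms by simp
  then have "t powr a = t powr (a - 1) * t" by (simp add: powr_diff)
  also have "\<dots> \<le> c powr (a - 1) * t"
    using False assms by (intro mult_right_mono powr_mono2') auto
  finally show ?thesis by (simp add: add_increasing)
qed

text \<open>Grouping the clock by visited sites: at a fixed site the holding times share one trap,
  so fractional moments only see the number of distinct sites.\<close>

lemma clk_powr_bound:
  assumes V: "\<And>x. 0 \<le> V x" and s: "\<And>k. 0 \<le> snd (s k)" and c: "0 < c" and a: "0 < a" "a \<le> 1"
  shows "clk V 0 s n powr a \<le>
    (\<Sum>x\<in>pos s ` {..<n}. V x powr a * (c powr a + c powr (a - 1) * (\<Sum>k\<in>{k\<in>{..<n}. pos s k = x}. snd (s k))))"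
proof -
  let ?D = "pos s ` {..<n}" and ?\<tau> = "\<lambda>x. \<Sum>k\<in>{k\<in>{..<n}. pos s k = x}. snd (s k)"
  have \<tau>: "0 \<le> ?\<tau> x" for x by (intro sum_nonneg s)
  have "clk V 0 s n = (\<Sum>x\<in>?D. \<Sum>k\<in>{k\<in>{..<n}. pos s k = x}. snd (s k) * V (pos s k))"
    unfolding clk_def add_0 by (rule sum.image_gen) simp
  also have "\<dots> = (\<Sum>x\<in>?D. V x * ?\<tau> x)"
    by (intro sum.cong refl) (simp add: sum_distrib_left mult.commute)
  finally have "clk V 0 s n powr a = (\<Sum>x\<in>?D. V x * ?\<tau> x) powr a" by simp
  also have "\<dots> \<le> (\<Sum>x\<in>?D. (V x * ?\<tau> x) powr a)"
    by (intro powr_sum_subadditive a mult_nonneg_nonneg V \<tau>) simp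
  also have "\<dots> \<le> (\<Sum>x\<in>?D. V x powr a * (c powr a + c powr (a - 1) * ?\<tau> x))"
  proof (intro sum_mono)
    fix x
    have "(V x * ?\<tau> x) powr a = V x powr a * ?\<tau> x powr a" using V \<tau> by (simp add: powr_mult)
    also have "\<dots> \<le> V x powr a * (c powr a + c powr (a - 1) * ?\<tau> x)"
      by (intro mult_left_mono powr_le_affine \<tau> c a) simp
    finally show "(V x * ?\<tau> x) powr a \<le> \<dots>" .
  qed
  finally show ?thesis .
qed

lemma trap_nonneg: "0 \<le> trap \<beta> \<omega> x"
  by (simp add: trap_def split: enat.split)

text \<open>Markov's inequality for the power \<open>a\<close> with the marks fixed; averaging over
  the environment leaves only the number of distinct sites and the sum of the holds.\<close>

lemma clk_tail_section:
  fixes s :: "nat \<Rightarrow> (int ^ 'd::finite) \<times> real"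
  assumes mom: "\<And>x :: int ^ 'd. (\<integral>\<^sup>+\<omega>. ennreal (trap \<beta> \<omega> x powr a) \<partial>perc p) \<le> ennreal C"
    and C: "0 \<le> C" and s: "\<And>k. 0 \<le> snd (s k)" and c: "0 < c" and a: "0 < a" "a \<le> 1" and z: "0 < z"
  shows "emeasure (perc p) {\<omega>. z < clk (trap \<beta> \<omega>) 0 s n}
    \<le> ennreal (z powr (- a) * (C * (real (card (pos s ` {..<n})) * c powr a + c powr (a - 1) * (\<Sum>k<n. snd (s k)))))"
proof -
  let ?D = "pos s ` {..<n}" and ?\<tau> = "\<lambda>x :: int ^ 'd. \<Sum>k\<in>{k\<in>{..<n}. pos s k = x}. snd (s k)"
  let ?w = "\<lambda>x. c powr a + c powr (a - 1) * ?\<tau> x"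
  have \<tau>: "0 \<le> ?\<tau> x" for x by (intro sum_nonneg s)
  have w: "0 \<le> ?w x" for x using \<tau>[of x] by simp
  have [measurable]: "(\<lambda>\<omega>. clk (trap \<beta> \<omega>) 0 s n) \<in> borel_measurable (perc p)"
    unfolding clk_def by (intro borel_measurable_sum borel_measurable_times trap_measurable borel_measurable_const)
  have "emeasure (perc p) {\<omega>. z < clk (trap \<beta> \<omega>) 0 s n}
    = (\<integral>\<^sup>+\<omega>. indicator {\<omega>. z < clk (trap \<beta> \<omega>) 0 s n} \<omega> \<partial>perc p)"
  proof (rule nn_integral_indicator[symmetric])
    have "{\<omega> \<in> space (perc p). z < clk (trap \<beta> \<omega>) 0 s n} \<in> sets (perc p)" by measurable
    then show "{\<omega>. z < clk (trap \<beta> \<omega>) 0 s n} \<in> sets (perc p)" by simp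
  qed
  also have "\<dots> \<le> (\<integral>\<^sup>+\<omega>. (\<Sum>x\<in>?D. ennreal (z powr (- a) * ?w x) * ennreal (trap \<beta> \<omega> x powr a)) \<partial>perc p)"
  proof (rule nn_integral_mono)
    fix \<omega>
    show "indicator {\<omega>. z < clk (trap \<beta> \<omega>) 0 s n} \<omega> \<le> (\<Sum>x\<in>?D. ennreal (z powr (- a) * ?w x) * ennreal (trap \<beta> \<omega> x powr a))"
    proof (cases "z < clk (trap \<beta> \<omega>) 0 s n")
      case True
      have "1 = z powr (- a) * z powr a" using z by (simp add: powr_minus)
      also have "\<dots> \<le> z powr (- a) * clk (trap \<beta> \<omega>) 0 s n powr a"
        using True z a by (intro mult_left_mono powr_mono2) auto
      also have "\<dots> \<le> z powr (- a) * (\<Sum>x\<in>?D. trap \<beta> \<omega> x powr a * ?w x)"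
        by (intro mult_left_mono clk_powr_bound trap_nonneg s c a) simp
      also have "\<dots> = (\<Sum>x\<in>?D. (z powr (- a) * ?w x) * trap \<beta> \<omega> x powr a)"
        by (simp add: sum_distrib_left mult_ac)
      finally have r: "1 \<le> (\<Sum>x\<in>?D. (z powr (- a) * ?w x) * trap \<beta> \<omega> x powr a)" .
      have "1 \<le> ennreal (\<Sum>x\<in>?D. (z powr (- a) * ?w x) * trap \<beta> \<omega> x powr a)"
        using ennreal_leI[OF r] by (simp only: ennreal_1)
      also have "\<dots> = (\<Sum>x\<in>?D. ennreal (z powr (- a) * ?w x) * ennreal (trap \<beta> \<omega> x powr a))"
        using w by (simp add: sum_ennreal[symmetric] ennreal_mult del: sum_ennreal)
      finally show ?thesis using True by simp
    qed simp
  qed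
  also have "\<dots> = (\<Sum>x\<in>?D. ennreal (z powr (- a) * ?w x) * (\<integral>\<^sup>+\<omega>. ennreal (trap \<beta> \<omega> x powr a) \<partial>perc p))"
    by (subst nn_integral_sum) (auto intro!: sum.cong nn_integral_cmult)
  also have "\<dots> \<le> (\<Sum>x\<in>?D. ennreal (z powr (- a) * ?w x) * ennreal C)"
    by (intro sum_mono mult_left_mono mom) simp
  also have "\<dots> = ennreal (\<Sum>x\<in>?D. z powr (- a) * ?w x * C)"
    using w C by (simp add: sum_ennreal[symmetric] ennreal_mult del: sum_ennreal)
  also have "(\<Sum>x\<in>?D. z powr (- a) * ?w x * C) = z powr (- a) * (C * (\<Sum>x\<in>?D. ?w x))"
    by (simp add: sum_distrib_left mult_ac)
  also have "(\<Sum>x\<in>?D. ?w x) = real (card ?D) * c powr a + c powr (a - 1) * (\<Sum>x\<in>?D. ?\<tau> x)"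
    by (simp add: sum.distrib sum_distrib_left)
  also have "(\<Sum>x\<in>?D. ?\<tau> x) = (\<Sum>k<n. snd (s k))"
    by (rule sum.image_gen[symmetric]) simp
  finally show ?thesis .
qed

lemma nn_integral_expo_mean: "(\<integral>\<^sup>+h. ennreal h \<partial>expo) = 1"
proof -
  have "(\<integral>\<^sup>+h. ennreal h \<partial>expo) = (\<integral>\<^sup>+h. ennreal (erlang_density 0 1 h * h ^ 1) \<partial>lborel)"
    by (subst nn_integral_density)
      (auto intro!: nn_integral_cong simp: ennreal_mult' erlang_density_nonneg)
  also have "\<dots> = 1" by (subst nn_integral_erlang_ith_moment) simp_all
  finally show ?thesis .
qed

context step_law
begin

lemma nn_integral_hold: "(\<integral>\<^sup>+s. ennreal (snd (s k)) \<partial>marks) = 1"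
proof -
  interpret pair_prob_space "measure_pmf \<pi>" expo ..
  have "distr marks mark (\<lambda>s. s k) = mark"
    unfolding marks_def by (rule mseq.PiM_component) simp
  then have "(\<integral>\<^sup>+s. ennreal (snd (s k)) \<partial>marks) = (\<integral>\<^sup>+z. ennreal (snd z) \<partial>mark)"
    using nn_integral_distr[OF coordinate_measurable[of k], of "\<lambda>z. ennreal (snd z)"] by simp
  also have "\<dots> = (\<integral>\<^sup>+h. \<integral>\<^sup>+e. ennreal h \<partial>measure_pmf \<pi> \<partial>expo)"
    unfolding mark_def by (subst nn_integral_snd[symmetric]) simp_all
  also have "\<dots> = 1"
    by (simp add: nn_integral_expo_mean measure_pmf.emeasure_space_1[simplified])
  finally show ?thesis .
qed

end

lemma card_range_sets:
  fixes l :: "real ^ 'd::finite"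
  shows "{s. real (card (pos s ` {..<n})) \<le> R} \<in> sets (J.marks lam l)"
proof -
  \<comment> \<open>The range is counted by first visits, which makes it a finite sum of measurable
    indicators.\<close>
  let ?f = "\<lambda>s. (\<Sum>j<n. if \<exists>k<j. pos s k = pos s j then 0 else 1 :: real)"
  have "real (card (pos s ` {..<n})) = ?f s" for s :: "nat \<Rightarrow> (int ^ 'd) \<times> real"
  proof (induction n)
    case (Suc n)
    have "pos s ` {..<Suc n} = insert (pos s n) (pos s ` {..<n})" by (simp add: lessThan_Suc)
    moreover have "pos s n \<in> pos s ` {..<n} \<longleftrightarrow> (\<exists>k<n. pos s k = pos s n)" by (metis (no_types, lifting) image_iff lessThan_iff)
    ultimately show ?case using Suc by (simp add: card_insert_if)
  qed simp
  moreover have "?f \<in> borel_measurable (J.marks lam l)"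
  proof (intro borel_measurable_sum measurable_If borel_measurable_const)
    fix j
    have "{s \<in> space (J.marks lam l). pos s k = pos s j} \<in> sets (J.marks lam l)" for k
    proof -
      have "(\<lambda>s. (\<lambda>x s. pos s k = x) (pos s j) s) \<in> J.marks lam l \<rightarrow>\<^sub>M count_space UNIV"
        by (rule measurable_compose_countable'[OF _ J.pos_measurable countable_lattice])
          (rule J.pos_pred_measurable[of "\<lambda>y. y = _"])
      then show ?thesis by (simp add: pred_def)
    qed
    then have "{s \<in> space (J.marks lam l). \<exists>k\<in>{..<j}. pos s k = pos s j} \<in> sets (J.marks lam l)"
      by (intro sets.sets_Collect_finite_Ex) auto
    then show "{s \<in> space (J.marks lam l). \<exists>k<j. pos s k = pos s j} \<in> sets (J.marks lam l)"
      by (simp add: Bex_def)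
  qed
  ultimately have "{s \<in> space (J.marks lam l). real (card (pos s ` {..<n})) \<le> R} \<in> sets (J.marks lam l)"
    by (simp only:) measurable
  then show ?thesis by simp
qed

text \<open>The range bound is made part of the event, so that an almost sure bound on the range can
  be combined with it later.\<close>

lemma clock_upper_prob:
  fixes l :: "real ^ 'd::finite"
  assumes mom: "\<And>x :: int ^ 'd. (\<integral>\<^sup>+\<omega>. ennreal (trap \<beta> \<omega> x powr a) \<partial>perc p) \<le> ennreal C"
    and C: "0 \<le> C" and c: "0 < c" and a: "0 < a" "a \<le> 1" and z: "0 < z" and R: "0 \<le> R"
  shows "measure (joint p lam l) {y. real (card (pos (snd y) ` {..<n})) \<le> R \<and> z < clk (trap \<beta> (fst y)) 0 (snd y) n}
     \<le> z powr (- a) * (C * (R * c powr a + c powr (a - 1) * real n))"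
    and "{y. real (card (pos (snd y) ` {..<n})) \<le> R \<and> z < clk (trap \<beta> (fst y)) 0 (snd y) n} \<in> sets (joint p lam l)"
proof -
  let ?P = "\<lambda>\<omega> s. real (card (pos s ` {..<n})) \<le> R \<and> z < clk (trap \<beta> \<omega>) 0 s n"
  interpret jp: prob_space "joint p lam l" by (rule prob_space_joint)
  have m1: "{y \<in> space (joint p lam l). z < clk (trap \<beta> (fst y)) 0 (snd y) n} \<in> sets (joint p lam l)"
    using clk_joint_measurable[of \<beta> n p lam l] by measurable
  have "snd -` {s. real (card (pos s ` {..<n})) \<le> R} \<inter> space (joint p lam l) \<in> sets (joint p lam l)"
    by (rule measurable_sets[OF measurable_snd card_range_sets])
  from sets.Int[OF this m1]
  show A: "{y. ?P (fst y) (snd y)} \<in> sets (joint p lam l)"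
    by (simp add: vimage_def Int_def)
  have "emeasure (joint p lam l) {y. ?P (fst y) (snd y)}
    \<le> (\<integral>\<^sup>+s. ennreal (z powr (- a) * C * (R * c powr a)) + ennreal (z powr (- a) * C * c powr (a - 1)) * (\<Sum>k<n. ennreal (snd (s k))) \<partial>J.marks lam l)"
  proof (rule joint_emeasure_le[OF A])
    show "AE s in J.marks lam l. emeasure (perc p) {\<omega>. ?P \<omega> s} \<le>
      ennreal (z powr (- a) * C * (R * c powr a)) + ennreal (z powr (- a) * C * c powr (a - 1)) * (\<Sum>k<n. ennreal (snd (s k)))"
      using J.AE_holds_pos
    proof eventually_elim
      case (elim s)
      then have s: "0 \<le> snd (s k)" for k by (simp add: less_imp_le)
      have sn: "0 \<le> (\<Sum>k<n. snd (s k))" by (intro sum_nonneg s)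
      show ?case
      proof (cases "real (card (pos s ` {..<n})) \<le> R")
        case True
        have "emeasure (perc p) {\<omega>. z < clk (trap \<beta> \<omega>) 0 s n}
          \<le> ennreal (z powr (- a) * (C * (real (card (pos s ` {..<n})) * c powr a + c powr (a - 1) * (\<Sum>k<n. snd (s k)))))"
          by (rule clk_tail_section[OF mom C s c a z])
        also have "\<dots> \<le> ennreal (z powr (- a) * (C * (R * c powr a + c powr (a - 1) * (\<Sum>k<n. snd (s k)))))"
          using True C by (intro ennreal_leI mult_left_mono add_mono mult_right_mono) auto
        also have "\<dots> = ennreal (z powr (- a) * C * (R * c powr a) + z powr (- a) * C * c powr (a - 1) * (\<Sum>k<n. snd (s k)))"
          by (simp add: distrib_left mult.assoc)
        also have "\<dots> = ennreal (z powr (- a) * C * (R * c powr a)) + ennreal (z powr (- a) * C * c powr (a - 1)) * (\<Sum>k<n. ennreal (snd (s k)))"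
          using C R sn s by (simp add: ennreal_plus ennreal_mult)
        finally show ?thesis using True by simp
      qed simp
    qed
  qed
  also have "\<dots> = ennreal (z powr (- a) * C * (R * c powr a)) + ennreal (z powr (- a) * C * c powr (a - 1)) * ennreal (real n)"
  proof -
    have hm: "(\<lambda>s. ennreal (snd (s k))) \<in> borel_measurable (J.marks lam l)" for k
      using J.hold_measurable[of k lam l] by measurable
    have sm: "(\<lambda>s. \<Sum>k<n. ennreal (snd (s k))) \<in> borel_measurable (J.marks lam l)"
      by (intro borel_measurable_sum hm)
    have "(\<integral>\<^sup>+s. (\<Sum>k<n. ennreal (snd (s k))) \<partial>J.marks lam l) = (\<Sum>k<n. (\<integral>\<^sup>+s. ennreal (snd (s k)) \<partial>J.marks lam l))"
      by (rule nn_integral_sum) (rule hm)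
    also have "\<dots> = ennreal (real n)" by (simp add: J.nn_integral_hold ennreal_of_nat_eq_real_of_nat)
    finally show ?thesis
      by (subst nn_integral_add) (auto intro!: sm borel_measurable_times simp: nn_integral_cmult[OF sm] J.marks.emeasure_space_1[simplified])
  qed
  also have "\<dots> = ennreal (z powr (- a) * (C * (R * c powr a + c powr (a - 1) * real n)))"
    using C R by (simp add: ennreal_mult[symmetric] ennreal_plus[symmetric] distrib_left mult.assoc del: ennreal_plus)
  finally show "measure (joint p lam l) {y. ?P (fst y) (snd y)} \<le> z powr (- a) * (C * (R * c powr a + c powr (a - 1) * real n))"
    using C R by (simp add: jp.emeasure_eq_measure)
qed

section \<open>Lower bound for the clock\<close>

text \<open>Holds above 1 reduce the clock to a count: each such visit to a cluster of at least
  \<open>m\<close> sites contributes at least \<open>exp (\<beta> * m)\<close>.\<close>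

definition long_holds :: "(nat \<Rightarrow> (int ^ 'd::finite) \<times> real) \<Rightarrow> nat \<Rightarrow> nat set" where
  "long_holds s n = {k\<in>{..<n}. 1 < snd (s k)}"

lemma finite_long_holds [simp]: "finite (long_holds s n)"
  by (simp add: long_holds_def)

lemma card_long_holds: "real (card (long_holds s n)) = (\<Sum>k<n. if 1 < snd (s k) then 1 else 0)"
proof -
  have "(\<Sum>k<n. if 1 < snd (s k) then 1 else 0 :: real) = (\<Sum>k\<in>long_holds s n. 1)"
    unfolding long_holds_def by (subst sum.inter_filter[symmetric]) simp_all
  then show ?thesis by simp
qed

lemma card_long_holds_case_nat:
  "real (card (long_holds (case_nat z s) (Suc n))) = (if 1 < snd z then 1 else 0) + real (card (long_holds s n))"
  unfolding card_long_holds by (subst sum.lessThan_Suc_shift) simp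

text \<open>The Laplace transform at 1 of the indicator that an exponential variable exceeds 1.\<close>

definition hold_ratio :: real where "hold_ratio = 1 - (1 - exp (- 1)) * exp (- 1)"

lemma hold_ratio: "0 < hold_ratio" "hold_ratio < 1"
proof -
  have e: "0 < exp (- 1 :: real)" "exp (- 1 :: real) < 1" by simp_all
  then have "(1 - exp (- 1 :: real)) * exp (- 1) < 1 * 1" by (intro mult_strict_mono) auto
  then show "0 < hold_ratio" by (simp add: hold_ratio_def)
  have "0 < (1 - exp (- 1 :: real)) * exp (- 1)" using e by (intro mult_pos_pos) auto
  then show "hold_ratio < 1" by (simp add: hold_ratio_def)
qed

lemma hold_ratio_integral: "(\<integral>h. exp (- (if 1 < h then 1 else 0)) \<partial>expo) = hold_ratio"
proof -
  have u: "measure expo UNIV = 1"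
    using prob_space.prob_space[OF prob_space_expo] by simp
  have 1: "(\<integral>h. indicator {1<..} h \<partial>expo) = exp (- 1 :: real)"
    using expo_memoryless[of "\<lambda>_. 1" 1] u by simp
  have i: "integrable expo (\<lambda>h. indicator {1<..} h :: real)"
    by (rule finite_measure.integrable_const_bound[OF prob_space.finite_measure[OF prob_space_expo], where B=1])
      (simp_all add: indicator_def)
  have "(\<integral>h. exp (- (if 1 < h then 1 else 0)) \<partial>expo) = (\<integral>h. 1 - (1 - exp (- 1)) * indicator {1<..} h \<partial>expo :: real)"
    by (intro Bochner_Integration.integral_cong refl) (auto simp: indicator_def)
  also have "\<dots> = (\<integral>h. 1 \<partial>expo) - (\<integral>h. (1 - exp (- 1)) * indicator {1<..} h \<partial>expo)"
  proof (rule Bochner_Integration.integral_diff)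
    show "integrable expo (\<lambda>h. 1 :: real)"
      by (rule finite_measure.integrable_const[OF prob_space.finite_measure[OF prob_space_expo]])
    show "integrable expo (\<lambda>h. (1 - exp (- 1)) * indicator {1<..} h :: real)"
      by (rule integrable_mult_right) (rule i)
  qed
  also have "\<dots> = 1 - (1 - exp (- 1)) * (\<integral>h. indicator {1<..} h \<partial>expo)"
    using u by simp
  finally show ?thesis unfolding 1 hold_ratio_def .
qed

context step_law
begin

lemma card_long_holds_measurable [measurable]: "(\<lambda>s. real (card (long_holds s n))) \<in> borel_measurable marks"
  unfolding card_long_holds by measurable

lemma long_holds_chernoff: "measure marks {s. real (card (long_holds s n)) \<le> c} \<le> exp c * hold_ratio ^ n"
proof (induction n arbitrary: c)
  case 0
  then show ?case using marks.prob_le_1 by (cases "0 \<le> c") (auto simp: long_holds_def intro: order_trans)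
next
  case (Suc n)
  have P: "Measurable.pred marks (\<lambda>s. real (card (long_holds s n)) \<le> c)" for n c by measurable
  let ?d = "\<lambda>h :: real. (if 1 < h then 1 else 0) :: real"
  have "measure marks {s. real (card (long_holds s (Suc n))) \<le> c}
    = (\<integral>h. (\<Sum>e\<in>set_pmf \<pi>. pmf \<pi> e * measure marks {s. real (card (long_holds (case_nat (e, h) s) (Suc n))) \<le> c}) \<partial>expo)"
    by (rule marks_prob_split[OF P])
  also have "\<dots> = (\<integral>h. (\<Sum>e\<in>set_pmf \<pi>. pmf \<pi> e * measure marks {s. real (card (long_holds s n)) \<le> c - ?d h}) \<partial>expo)"
    by (simp only: card_long_holds_case_nat snd_conv le_diff_eq add.commute)
  also have "\<dots> = (\<integral>h. measure marks {s. real (card (long_holds s n)) \<le> c - ?d h} \<partial>expo)"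
    by (simp only: sum_distrib_right[symmetric] sum_pmf_set mult_1)
  also have "\<dots> \<le> (\<integral>h. exp c * hold_ratio ^ n * exp (- ?d h) \<partial>expo)"
  proof (rule integral_mono)
    have m: "(\<lambda>h. measure marks {s. real (card (long_holds s n)) \<le> c - ?d h}) \<in> borel_measurable borel"
    proof -
      have "(\<lambda>h. measure marks {s. real (card (long_holds s n)) \<le> c - ?d h})
        = (\<lambda>h. if 1 < h then measure marks {s. real (card (long_holds s n)) \<le> c - 1} else measure marks {s. real (card (long_holds s n)) \<le> c - 0})"
        by auto
      then show ?thesis by (simp only:) measurable
    qed
    show "integrable expo (\<lambda>h. measure marks {s. real (card (long_holds s n)) \<le> c - ?d h})"
    proof (rule expo.integrable_const_bound[where B=1])
      have "sets expo = sets borel" by simp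
      from measurable_cong_sets[OF this refl]
      show "(\<lambda>h. measure marks {s. real (card (long_holds s n)) \<le> c - ?d h}) \<in> borel_measurable expo"
        using m by blast
      show "AE h in expo. norm (measure marks {s. real (card (long_holds s n)) \<le> c - ?d h}) \<le> 1"
        by (rule AE_I2) (simp only: real_norm_def abs_of_nonneg[OF measure_nonneg] marks.prob_le_1)
    qed
    show "integrable expo (\<lambda>h. exp c * hold_ratio ^ n * exp (- ?d h))"
      by (intro integrable_mult_right expo.integrable_const_bound[where B=1]) auto
    show "measure marks {s. real (card (long_holds s n)) \<le> c - ?d h} \<le> exp c * hold_ratio ^ n * exp (- ?d h)" for h
      using Suc.IH[of "c - ?d h"] by (simp add: exp_diff exp_minus field_simps split: if_splits)
  qed
  also have "\<dots> = exp c * hold_ratio ^ n * (\<integral>h. exp (- ?d h) \<partial>expo)" by simp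
  finally show ?case unfolding hold_ratio_integral by (simp add: mult_ac)
qed

end

text \<open>Half the exponential rate: \<open>exp hold_frac * hold_ratio\<close> is the square root
  of \<open>hold_ratio\<close>, hence below 1.\<close>

definition hold_frac :: real where "hold_frac = - ln hold_ratio / 2"

lemma hold_frac_pos: "0 < hold_frac"
  using hold_ratio by (simp add: hold_frac_def)

lemma AE_many_long_holds:
  "AE s in J.marks lam l. \<forall>\<^sub>F n in sequentially. hold_frac * real n < real (card (long_holds s n))"
proof -
  have "exp hold_frac * hold_ratio = exp (hold_frac + ln hold_ratio)" using hold_ratio by (simp add: exp_add)
  also have "\<dots> < 1" using hold_ratio by (simp add: hold_frac_def)
  finally have r: "exp hold_frac * hold_ratio < 1" .
  have "AE s in J.marks lam l. \<forall>\<^sub>F n in sequentially. \<not> real (card (long_holds s n)) \<le> hold_frac * real n"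
  proof (rule J.marks.borel_cantelli_eventually)
    show "{s \<in> space (J.marks lam l). real (card (long_holds s n)) \<le> hold_frac * real n} \<in> sets (J.marks lam l)" for n
      by measurable
    show "measure (J.marks lam l) {s \<in> space (J.marks lam l). real (card (long_holds s n)) \<le> hold_frac * real n} \<le> (exp hold_frac * hold_ratio) ^ n" for n
      using J.long_holds_chernoff[of lam l n "hold_frac * real n"]
      by (simp add: power_mult_distrib exp_of_nat_mult[symmetric] mult.commute)
    show "summable (\<lambda>n. (exp hold_frac * hold_ratio) ^ n)" using r hold_ratio by (intro summable_geometric) simp
  qed
  then show ?thesis by (simp add: not_le)
qed

definition close_pairs :: "(nat \<Rightarrow> int ^ 'd::finite) \<Rightarrow> nat \<Rightarrow> nat \<Rightarrow> (nat \<times> nat) set" where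
  "close_pairs X n r = {(j, k) \<in> {..<n} \<times> {..<n}. X j - X k \<in> sbox 0 r}"

lemma finite_close_pairs [simp]: "finite (close_pairs X n r)"
  by (rule finite_subset[of _ "{..<n} \<times> {..<n}"]) (auto simp: close_pairs_def)

lemma sbox_disjoint:
  assumes "x - y \<notin> sbox 0 (2 * m)" shows "sbox x m \<inter> sbox y m = {}"
proof (rule ccontr)
  assume "sbox x m \<inter> sbox y m \<noteq> {}"
  then obtain z where z: "z \<in> sbox x m" "z \<in> sbox y m" by blast
  have "\<bar>(x - y) $ i\<bar> \<le> int (2 * m)" for i
  proof -
    have "\<bar>z $ i - x $ i\<bar> \<le> int m" "\<bar>z $ i - y $ i\<bar> \<le> int m" using z by (simp_all add: sbox_def)
    then show ?thesis by simp
  qed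
  then show False using assms by (simp add: sbox_def)
qed

text \<open>Chebyshev's inequality: the events that the clusters at two sites are large are independent
  unless the sites are within distance \<open>2 m\<close>.\<close>

lemma big_count_deviation:
  fixes X :: "nat \<Rightarrow> int ^ 'd::finite"
  assumes K: "K \<subseteq> {..<n}" and p: "0 < big_prob TYPE('d) p m" and N: "0 < card K"
  shows "measure (perc p) {\<omega>. real (card {k\<in>K. big \<omega> (X k) m}) \<le> real (card K) * big_prob TYPE('d) p m / 2}
     \<le> 4 * real (card (close_pairs X n (2 * m))) / (big_prob TYPE('d) p m * (real (card K))\<^sup>2)"
proof -
  interpret E: prob_space "perc p :: 'd env measure" by (rule prob_space_perc)
  let ?q = "big_prob TYPE('d) p m" and ?N = "real (card K)"
  have EU: "E.prob UNIV = 1" using E.prob_space by simp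
  have fK: "finite K" using K finite_subset by blast
  define I where "I k \<omega> = (indicator {\<omega>. big \<omega> (X k) m} \<omega> :: real)" for k \<omega>
  define W where "W \<omega> = (\<Sum>k\<in>K. I k \<omega>)" for \<omega>
  have Wc: "W \<omega> = real (card {k\<in>K. big \<omega> (X k) m})" for \<omega>
  proof -
    have "W \<omega> = (\<Sum>k\<in>K. if big \<omega> (X k) m then 1 else 0)" by (simp add: W_def I_def indicator_def of_bool_def)
    also have "\<dots> = (\<Sum>k\<in>{k\<in>K. big \<omega> (X k) m}. 1)" by (rule sum.inter_filter[symmetric]) (rule fK)
    finally show ?thesis by simp
  qed
  have [measurable]: "I k \<in> borel_measurable (perc p)" for k
    unfolding I_def by (intro borel_measurable_indicator big_measurable)
  have [measurable]: "W \<in> borel_measurable (perc p)" unfolding W_def by measurable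
  have Ib: "0 \<le> I k \<omega>" "I k \<omega> \<le> 1" for k \<omega> by (simp_all add: I_def indicator_def)
  have iI: "integrable (perc p) (I k)" for k
    by (rule E.integrable_const_bound[where B=1]) (auto simp: Ib)
  have EI: "E.expectation (I k) = ?q" for k
    unfolding I_def by (simp add: big_measurable prob_big)
  have EW: "E.expectation W = ?N * ?q"
    unfolding W_def by (subst Bochner_Integration.integral_sum) (simp_all add: iI EI)
  have iII: "integrable (perc p) (\<lambda>\<omega>. (I j \<omega> - ?q) * (I k \<omega> - ?q))" for j k
  proof (rule E.integrable_const_bound[where B=1])
    have "\<bar>I j \<omega> - ?q\<bar> \<le> 1" for j \<omega> using Ib[of j \<omega>] big_prob_01[of p m, where 'd='d] by linarith
    then show "AE \<omega> in perc p. norm ((I j \<omega> - ?q) * (I k \<omega> - ?q)) \<le> 1"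
      by (simp add: abs_mult mult_le_one)
  qed measurable
  \<comment> \<open>Far pairs are uncorrelated; for close pairs the joint event is at most as likely
    as one of the two.\<close>
  have cov: "E.expectation (\<lambda>\<omega>. (I j \<omega> - ?q) * (I k \<omega> - ?q)) \<le> (if X j - X k \<in> sbox 0 (2 * m) then ?q else 0)" for j k
  proof -
    have iIJ: "integrable (perc p) (\<lambda>\<omega>. I j \<omega> * I k \<omega>)"
      by (rule E.integrable_const_bound[where B=1]) (auto simp: abs_mult Ib intro!: mult_le_one)
    have "I j \<omega> * I k \<omega> = indicator {\<omega>. big \<omega> (X j) m \<and> big \<omega> (X k) m} \<omega>" for \<omega>
      by (simp add: I_def indicator_def)
    moreover have s2: "{\<omega>. big \<omega> (X j) m \<and> big \<omega> (X k) m} \<in> sets (perc p)"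
      using sets.Int[OF big_measurable[of m "X j" p] big_measurable[of m "X k" p]] by (simp add: Int_def)
    ultimately have EJ: "E.expectation (\<lambda>\<omega>. I j \<omega> * I k \<omega>) = E.prob {\<omega>. big \<omega> (X j) m \<and> big \<omega> (X k) m}"
      by simp
    have "(\<lambda>\<omega>. (I j \<omega> - ?q) * (I k \<omega> - ?q)) = (\<lambda>\<omega>. I j \<omega> * I k \<omega> - ?q * I j \<omega> - ?q * I k \<omega> + ?q\<^sup>2)"
      by (simp add: fun_eq_iff algebra_simps power2_eq_square)
    then have "E.expectation (\<lambda>\<omega>. (I j \<omega> - ?q) * (I k \<omega> - ?q))
      = E.prob {\<omega>. big \<omega> (X j) m \<and> big \<omega> (X k) m} - ?q\<^sup>2"
      by (simp add: iI iIJ EI EJ EU power2_eq_square)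
    moreover have "E.prob {\<omega>. big \<omega> (X j) m \<and> big \<omega> (X k) m} \<le> ?q"
      using E.finite_measure_mono[of "{\<omega>. big \<omega> (X j) m \<and> big \<omega> (X k) m}" "{\<omega>. big \<omega> (X j) m}"]
      by (auto simp: big_measurable prob_big)
    moreover have "E.prob {\<omega>. big \<omega> (X j) m \<and> big \<omega> (X k) m} = ?q\<^sup>2" if "X j - X k \<notin> sbox 0 (2 * m)"
      using big_indep[OF sbox_disjoint[OF that], of p] by (simp add: prob_big power2_eq_square)
    moreover have "0 \<le> ?q\<^sup>2" by (rule zero_le_power2)
    ultimately show ?thesis by (cases "X j - X k \<in> sbox 0 (2 * m)"; simp only: if_True if_False; linarith)
  qed
  have sq: "(W \<omega> - ?N * ?q)\<^sup>2 = (\<Sum>j\<in>K. \<Sum>k\<in>K. (I j \<omega> - ?q) * (I k \<omega> - ?q))" for \<omega>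
  proof -
    have "W \<omega> - ?N * ?q = (\<Sum>k\<in>K. I k \<omega> - ?q)" by (simp add: W_def sum_subtractf)
    then show ?thesis by (simp only: power2_eq_square sum_product)
  qed
  have "E.variance W = (\<Sum>j\<in>K. \<Sum>k\<in>K. E.expectation (\<lambda>\<omega>. (I j \<omega> - ?q) * (I k \<omega> - ?q)))"
    unfolding EW sq by (simp add: iII)
  also have "\<dots> \<le> (\<Sum>j\<in>K. \<Sum>k\<in>K. if X j - X k \<in> sbox 0 (2 * m) then ?q else 0)"
    by (intro sum_mono cov)
  \<comment> \<open>Enlarging \<open>K\<close> to all times makes the bound a function of the
    positions alone, independent of which holds are long.\<close>
  also have "\<dots> \<le> (\<Sum>j<n. \<Sum>k<n. if X j - X k \<in> sbox 0 (2 * m) then ?q else 0)"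
  proof -
    have "(\<Sum>j\<in>K. \<Sum>k\<in>K. if X j - X k \<in> sbox 0 (2 * m) then ?q else 0)
      \<le> (\<Sum>j\<in>K. \<Sum>k<n. if X j - X k \<in> sbox 0 (2 * m) then ?q else 0)"
      by (intro sum_mono sum_mono2) (use K p in auto)
    also have "\<dots> \<le> (\<Sum>j<n. \<Sum>k<n. if X j - X k \<in> sbox 0 (2 * m) then ?q else 0)"
      by (intro sum_mono2 sum_nonneg) (use K p in auto)
    finally show ?thesis .
  qed
  also have "\<dots> = (\<Sum>z\<in>{..<n} \<times> {..<n}. if X (fst z) - X (snd z) \<in> sbox 0 (2 * m) then ?q else 0)"
    by (simp add: sum.cartesian_product split_beta')
  also have "\<dots> = (\<Sum>z\<in>close_pairs X n (2 * m). ?q)"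
  proof -
    have "close_pairs X n (2 * m) = {z\<in>{..<n} \<times> {..<n}. X (fst z) - X (snd z) \<in> sbox 0 (2 * m)}"
      by (auto simp: close_pairs_def)
    then show ?thesis by (simp only: sum.inter_filter finite_cartesian_product finite_lessThan)
  qed
  finally have var: "E.variance W \<le> real (card (close_pairs X n (2 * m))) * ?q" by simp
  have iW2: "integrable (perc p) (\<lambda>\<omega>. (W \<omega>)\<^sup>2)"
  proof (rule E.integrable_const_bound[where B="?N\<^sup>2"])
    have "0 \<le> W \<omega> \<and> W \<omega> \<le> ?N" for \<omega>
      unfolding W_def using sum_mono[of K "\<lambda>k. I k \<omega>" "\<lambda>_. 1"] Ib by (auto intro: sum_nonneg)
    then show "AE \<omega> in perc p. norm ((W \<omega>)\<^sup>2) \<le> ?N\<^sup>2" by (auto intro!: power_mono)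
  qed measurable
  have pos: "0 < ?N * ?q / 2" using N p by simp
  have "{\<omega>. real (card {k\<in>K. big \<omega> (X k) m}) \<le> ?N * ?q / 2} \<subseteq> {\<omega>\<in>space (perc p). ?N * ?q / 2 \<le> \<bar>W \<omega> - E.expectation W\<bar>}"
    unfolding EW Wc by auto
  then have "E.prob {\<omega>. real (card {k\<in>K. big \<omega> (X k) m}) \<le> ?N * ?q / 2} \<le> E.prob {\<omega>\<in>space (perc p). ?N * ?q / 2 \<le> \<bar>W \<omega> - E.expectation W\<bar>}"
    by (rule E.finite_measure_mono) measurable
  also have "\<dots> \<le> E.variance W / (?N * ?q / 2)\<^sup>2"
    by (rule E.Chebyshev_inequality[OF _ iW2 pos]) measurable
  also have "\<dots> \<le> real (card (close_pairs X n (2 * m))) * ?q / (?N * ?q / 2)\<^sup>2"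
    by (rule divide_right_mono[OF var]) simp
  also have "\<dots> = 4 * real (card (close_pairs X n (2 * m))) / (?q * ?N\<^sup>2)"
    using p N by (simp add: power2_eq_square field_simps)
  finally show ?thesis .
qed

lemma difference_in_box_prob:
  "measure (J.marks lam l) {s. pos s j - pos s k \<in> sbox 0 r} = in_box_prob lam l (if k \<le> j then j - k else k - j) r"
proof -
  have 1: "measure (J.marks lam l) {s. pos s j - pos s k \<in> sbox 0 r} = in_box_prob lam l (j - k) r" if "k \<le> j" for j k
    using J.increment_prob[of lam l "\<lambda>x. x \<in> sbox 0 r" "j - k" k] that by (simp add: in_box_prob_def)
  have sym: "x - y \<in> sbox 0 r \<longleftrightarrow> y - x \<in> sbox 0 r" for x y :: "int ^ 'a"
    by (simp add: sbox_def abs_minus_commute)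
  show ?thesis
  proof (cases "k \<le> j")
    case True then show ?thesis by (simp add: 1)
  next
    case False
    have "{s :: nat \<Rightarrow> (int ^ 'a) \<times> real. pos s j - pos s k \<in> sbox 0 r} = {s. pos s k - pos s j \<in> sbox 0 r}"
      using sym by blast
    then show ?thesis using False 1[of j k] by simp
  qed
qed

text \<open>Each distance from \<open>j\<close> occurs at most twice, once on either side.\<close>

lemma sum_distance_le:
  fixes b :: "nat \<Rightarrow> real"
  assumes b: "\<And>i. 0 \<le> b i" and j: "j < n"
  shows "(\<Sum>k<n. b (if k \<le> j then j - k else k - j)) \<le> 2 * (\<Sum>i<n. b i)"
proof -
  have "(\<Sum>k<n. b (if k \<le> j then j - k else k - j)) = (\<Sum>k\<in>{..j} \<union> {j<..<n}. b (if k \<le> j then j - k else k - j))"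
    using j by (intro sum.cong) auto
  also have "\<dots> = (\<Sum>k\<in>{..j}. b (if k \<le> j then j - k else k - j)) + (\<Sum>k\<in>{j<..<n}. b (if k \<le> j then j - k else k - j))"
    by (rule sum.union_disjoint) auto
  also have "(\<Sum>k\<in>{..j}. b (if k \<le> j then j - k else k - j)) = (\<Sum>i\<in>{..j}. b i)"
    by (rule sum.reindex_bij_witness[where i="\<lambda>i. j - i" and j="\<lambda>k. j - k"]) auto
  also have "(\<Sum>k\<in>{j<..<n}. b (if k \<le> j then j - k else k - j)) = (\<Sum>i\<in>{0<..<n - j}. b i)"
    by (rule sum.reindex_bij_witness[where i="\<lambda>i. i + j" and j="\<lambda>k. k - j"]) auto
  also have "(\<Sum>i\<in>{..j}. b i) \<le> (\<Sum>i<n. b i)" using j b by (intro sum_mono2) auto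
  also have "(\<Sum>i\<in>{0<..<n - j}. b i) \<le> (\<Sum>i<n. b i)" using b by (intro sum_mono2) auto
  finally show ?thesis by simp
qed

lemma difference_sets: "{s. pos s j - pos s k \<in> B} \<in> sets (J.marks lam l)"
proof -
  have "(\<lambda>s. (\<lambda>x s. pos s j - x \<in> B) (pos s k) s) \<in> J.marks lam l \<rightarrow>\<^sub>M count_space UNIV"
    by (rule measurable_compose_countable'[OF _ J.pos_measurable countable_lattice])
      (rule J.pos_pred_measurable[of "\<lambda>y. y - _ \<in> B"])
  then show ?thesis by (simp add: pred_def)
qed

lemma card_close_pairs: "real (card (close_pairs X n r)) = (\<Sum>j<n. \<Sum>k<n. if X j - X k \<in> sbox 0 r then 1 else 0)"
proof -
  have e: "close_pairs X n r = {z\<in>{..<n} \<times> {..<n}. X (fst z) - X (snd z) \<in> sbox 0 r}"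
    by (auto simp: close_pairs_def)
  have "real (card (close_pairs X n r)) = (\<Sum>z\<in>close_pairs X n r. 1)" by simp
  also have "\<dots> = (\<Sum>z\<in>{..<n} \<times> {..<n}. if X (fst z) - X (snd z) \<in> sbox 0 r then 1 else 0)"
    unfolding e by (rule sum.inter_filter) simp
  also have "\<dots> = (\<Sum>j<n. \<Sum>k<n. if X j - X k \<in> sbox 0 r then 1 else 0)"
    by (simp add: sum.cartesian_product split_beta')
  finally show ?thesis .
qed

lemma close_pairs_expectation:
  fixes l :: "real ^ 'd::finite"
  shows "(\<integral>\<^sup>+s. ennreal (real (card (close_pairs (pos s) n r))) \<partial>J.marks lam l) \<le> ennreal (2 * real n * green lam l n r)"
proof -
  let ?D = "\<lambda>j k. {s :: nat \<Rightarrow> (int ^ 'd) \<times> real. pos s j - pos s k \<in> sbox 0 r}"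
  let ?b = "\<lambda>i. in_box_prob lam l i r"
  have b0: "0 \<le> ?b i" for i by (simp add: in_box_prob_def)
  have "ennreal (real (card (close_pairs (pos s) n r))) = (\<Sum>j<n. \<Sum>k<n. indicator (?D j k) s)" for s :: "nat \<Rightarrow> (int ^ 'd) \<times> real"
  proof -
    have "real (card (close_pairs (pos s) n r)) = (\<Sum>j<n. \<Sum>k<n. indicator (?D j k) s)"
      unfolding card_close_pairs by (intro sum.cong refl) simp
    then show ?thesis by (simp add: sum_ennreal[symmetric] ennreal_indicator sum_nonneg del: sum_ennreal)
  qed
  then have "(\<integral>\<^sup>+s. ennreal (real (card (close_pairs (pos s) n r))) \<partial>J.marks lam l)
    = (\<integral>\<^sup>+s. (\<Sum>j<n. \<Sum>k<n. indicator (?D j k) s) \<partial>J.marks lam l)" by simp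
  also have "\<dots> = (\<Sum>j<n. \<Sum>k<n. emeasure (J.marks lam l) (?D j k))"
    by (simp add: nn_integral_sum difference_sets)
  also have "\<dots> = (\<Sum>j<n. \<Sum>k<n. ennreal (?b (if k \<le> j then j - k else k - j)))"
    by (simp only: J.marks.emeasure_eq_measure difference_in_box_prob)
  also have "\<dots> = ennreal (\<Sum>j<n. \<Sum>k<n. ?b (if k \<le> j then j - k else k - j))"
    using b0 by (simp add: sum_ennreal[symmetric] sum_nonneg del: sum_ennreal)
  also have "\<dots> \<le> ennreal (\<Sum>j<n. 2 * green lam l n r)"
    unfolding green_def by (intro ennreal_leI sum_mono sum_distance_le b0) simp
  also have "(\<Sum>j<n. 2 * green lam l n r) = 2 * real n * green lam l n r" by simp
  finally show ?thesis .
qed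

lemma green_nonneg: "0 \<le> green lam l n r"
  by (simp add: green_def in_box_prob_def sum_nonneg)

definition big_visits :: "'d::finite env \<Rightarrow> (nat \<Rightarrow> (int ^ 'd) \<times> real) \<Rightarrow> nat \<Rightarrow> nat \<Rightarrow> nat set" where
  "big_visits \<omega> s n m = {k\<in>long_holds s n. big \<omega> (pos s k) m}"

lemma big_visits_measurable: "(\<lambda>z. real (card (big_visits (fst z) (snd z) n m))) \<in> borel_measurable (joint p lam l)"
proof -
  have "real (card (big_visits \<omega> s n m)) = (\<Sum>k<n. if 1 < snd (s k) \<and> big \<omega> (pos s k) m then 1 else 0)"
    for \<omega> :: "'a env" and s
  proof -
    have e: "big_visits \<omega> s n m = {k\<in>{..<n}. 1 < snd (s k) \<and> big \<omega> (pos s k) m}"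
      by (auto simp: big_visits_def long_holds_def)
    have "real (card (big_visits \<omega> s n m)) = (\<Sum>k\<in>big_visits \<omega> s n m. 1)" by simp
    also have "\<dots> = (\<Sum>k<n. if 1 < snd (s k) \<and> big \<omega> (pos s k) m then 1 else 0)"
      unfolding e by (rule sum.inter_filter) simp
    finally show ?thesis .
  qed
  moreover have "(\<lambda>z. \<Sum>k<n. if 1 < snd (snd z k) \<and> big (fst z) (pos (snd z) k) m then 1 else 0 :: real) \<in> borel_measurable (joint p lam l)"
  proof (intro borel_measurable_sum measurable_If borel_measurable_const)
    fix k
    have 1: "{z \<in> space (joint p lam l). 1 < snd (snd z k)} \<in> sets (joint p lam l)"
      using hold_joint_measurable[of k p lam l] by measurable
    have "(\<lambda>z. cluster_size (fst z) (pos (snd z) k)) \<in> joint p lam l \<rightarrow>\<^sub>M count_space UNIV"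
      by (rule at_pos_joint_measurable) (rule cluster_size_measurable)
    from measurable_sets[OF this, of "{c. enat m \<le> c}"]
    have 2: "{z \<in> space (joint p lam l). big (fst z) (pos (snd z) k) m} \<in> sets (joint p lam l)"
      by (simp add: vimage_def)
    show "{z \<in> space (joint p lam l). 1 < snd (snd z k) \<and> big (fst z) (pos (snd z) k) m} \<in> sets (joint p lam l)"
      using sets.Int[OF 1 2] by (simp add: Int_def)
  qed
  ultimately show ?thesis by (simp only:)
qed

text \<open>The first conjunct bounds the sample size in Chebyshev's inequality from below; almost
  surely it holds for all large \<open>n\<close>.\<close>

definition few_big_visits ::
  "real \<Rightarrow> nat \<Rightarrow> nat \<Rightarrow> ('d::finite env \<times> (nat \<Rightarrow> (int ^ 'd) \<times> real)) \<Rightarrow> bool" where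
  "few_big_visits p n m y \<longleftrightarrow> hold_frac * real n < real (card (long_holds (snd y) n)) \<and>
      real (card (big_visits (fst y) (snd y) n m)) \<le> hold_frac * real n * big_prob TYPE('d) p m / 2"

lemma clock_lower_prob:
  fixes l :: "real ^ 'd::finite"
  assumes n: "1 \<le> n" and q: "0 < big_prob TYPE('d) p m"
  shows "measure (joint p lam l) {y. few_big_visits p n m y}
    \<le> 8 * green lam l n (2 * m) / (big_prob TYPE('d) p m * hold_frac\<^sup>2 * real n)"
    and "{y. few_big_visits p n m y} \<in> sets (joint p lam l)"
proof -
  let ?q = "big_prob TYPE('d) p m" and ?h = "hold_frac"
  interpret jp: prob_space "joint p lam l" by (rule prob_space_joint)
  have h: "0 < ?h" by (rule hold_frac_pos)
  have "(\<lambda>y. real (card (long_holds (snd y) n))) \<in> borel_measurable (joint p lam l)"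
    by (rule measurable_compose[OF measurable_snd J.card_long_holds_measurable])
  then have 1: "{y \<in> space (joint p lam l). ?h * real n < real (card (long_holds (snd y) n))} \<in> sets (joint p lam l)"
    by measurable
  have 2: "{y \<in> space (joint p lam l). real (card (big_visits (fst y) (snd y) n m)) \<le> ?h * real n * ?q / 2} \<in> sets (joint p lam l)"
    using big_visits_measurable[of n m p lam l] by measurable
  show A: "{y. few_big_visits p n m y} \<in> sets (joint p lam l)"
    using sets.Int[OF 1 2] by (simp add: Int_def few_big_visits_def)
  let ?P = "\<lambda>\<omega> s. few_big_visits p n m (\<omega>, s)"
  let ?c = "4 / (?q * (?h * real n)\<^sup>2)"
  have c: "0 \<le> ?c" using q by simp
  have A': "{y. ?P (fst y) (snd y)} \<in> sets (joint p lam l)" using A by simp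
  have "emeasure (joint p lam l) {y. ?P (fst y) (snd y)}
    \<le> (\<integral>\<^sup>+s. ennreal ?c * ennreal (real (card (close_pairs (pos s) n (2 * m)))) \<partial>J.marks lam l)"
  proof (rule joint_emeasure_le[OF A'], rule AE_I2)
    fix s :: "nat \<Rightarrow> (int ^ 'd) \<times> real"
    interpret E: prob_space "perc p :: 'd env measure" by (rule prob_space_perc)
    show "emeasure (perc p) {\<omega>. ?P \<omega> s} \<le> ennreal ?c * ennreal (real (card (close_pairs (pos s) n (2 * m))))"
    proof (cases "?h * real n < real (card (long_holds s n))")
      case True
      let ?N = "real (card (long_holds s n))"
      let ?B = "{\<omega>. real (card {k\<in>long_holds s n. big \<omega> (pos s k) m}) \<le> ?N * ?q / 2}"
      have hn: "0 < ?h * real n" using h n by simp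
      have N: "0 < card (long_holds s n)" using True hn by linarith
      have "(\<lambda>\<omega>. real (card (big_visits \<omega> s n m))) \<in> borel_measurable (perc p)"
      proof -
        \<comment> \<open>Only the environment varies here, so any walk parameters may be chosen for
          the product space; they are set to 0.\<close>
        have "(\<lambda>\<omega>. (\<omega>, s)) \<in> perc p \<rightarrow>\<^sub>M joint p 0 (0 :: real ^ 'd)"
          by (rule measurable_Pair2') (simp only: J.space_marks UNIV_I)
        from measurable_compose[OF this big_visits_measurable[of n m p 0 0]]
        show ?thesis by (simp only: fst_conv snd_conv)
      qed
      then have "{\<omega> \<in> space (perc p). real (card (big_visits \<omega> s n m)) \<le> ?N * ?q / 2} \<in> sets (perc p)" by measurable
      then have B: "?B \<in> sets (perc p)" by (simp add: big_visits_def)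
      have sub: "{\<omega>. ?P \<omega> s} \<subseteq> ?B"
      proof
        fix \<omega> assume "\<omega> \<in> {\<omega>. ?P \<omega> s}"
        then have "real (card {k\<in>long_holds s n. big \<omega> (pos s k) m}) \<le> ?h * real n * ?q / 2"
          by (simp add: few_big_visits_def big_visits_def)
        also have "\<dots> \<le> ?N * ?q / 2" using True q by (intro divide_right_mono mult_right_mono) auto
        finally show "\<omega> \<in> ?B" by simp
      qed
      have "E.prob {\<omega>. ?P \<omega> s} \<le> E.prob ?B" by (rule E.finite_measure_mono[OF sub B])
      also have "\<dots> \<le> 4 * real (card (close_pairs (pos s) n (2 * m))) / (?q * ?N\<^sup>2)"
        by (rule big_count_deviation[OF _ q N]) (auto simp: long_holds_def)
      also have "\<dots> \<le> 4 * real (card (close_pairs (pos s) n (2 * m))) / (?q * (?h * real n)\<^sup>2)"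
        using True hn q n by (intro divide_left_mono mult_left_mono power_mono mult_pos_pos) auto
      also have "\<dots> = ?c * real (card (close_pairs (pos s) n (2 * m)))" by simp
      finally have "E.prob {\<omega>. ?P \<omega> s} \<le> ?c * real (card (close_pairs (pos s) n (2 * m)))" .
      then show ?thesis using c by (simp only: E.emeasure_eq_measure ennreal_mult[OF c of_nat_0_le_iff, symmetric] ennreal_leI)
    qed (simp add: few_big_visits_def)
  qed
  also have "\<dots> = ennreal ?c * (\<integral>\<^sup>+s. ennreal (real (card (close_pairs (pos s) n (2 * m)))) \<partial>J.marks lam l)"
  proof (rule nn_integral_cmult)
    have ms: "(\<lambda>s. \<Sum>j<n. \<Sum>k<n. indicator {s. pos s j - pos s k \<in> sbox 0 (2 * m)} s :: real) \<in> borel_measurable (J.marks lam l)"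
      by (intro borel_measurable_sum borel_measurable_indicator difference_sets)
    have eq: "(\<lambda>s. \<Sum>j<n. \<Sum>k<n. indicator {s. pos s j - pos s k \<in> sbox 0 (2 * m)} s :: real) = (\<lambda>s. real (card (close_pairs (pos s) n (2 * m))))"
      unfolding card_close_pairs by (intro ext sum.cong refl) simp
    have "(\<lambda>s. real (card (close_pairs (pos s) n (2 * m)))) \<in> borel_measurable (J.marks lam l)"
      using ms unfolding eq .
    then show "(\<lambda>s. ennreal (real (card (close_pairs (pos s) n (2 * m))))) \<in> borel_measurable (J.marks lam l)"
      by (rule measurable_compose[OF _ measurable_ennreal])
  qed
  also have "\<dots> \<le> ennreal ?c * ennreal (2 * real n * green lam l n (2 * m))"
    by (intro mult_left_mono close_pairs_expectation) simp
  also have "\<dots> = ennreal (?c * (2 * real n * green lam l n (2 * m)))"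
    by (rule ennreal_mult[OF c, symmetric]) (simp add: green_nonneg)
  also have "?c * (2 * real n * green lam l n (2 * m)) = 8 * green lam l n (2 * m) / (?q * ?h\<^sup>2 * real n)"
    using n h q by (simp add: power2_eq_square field_simps)
  finally have "ennreal (jp.prob {y. few_big_visits p n m y}) \<le> ennreal (8 * green lam l n (2 * m) / (?q * ?h\<^sup>2 * real n))"
    by (simp add: jp.emeasure_eq_measure)
  then show "jp.prob {y. few_big_visits p n m y} \<le> 8 * green lam l n (2 * m) / (?q * ?h\<^sup>2 * real n)"
    using q by (subst (asm) ennreal_le_iff) (simp_all add: green_nonneg)
qed

lemma clk_lower_deterministic:
  assumes fin: "\<And>x. cluster_size \<omega> x \<noteq> \<infinity>" and s: "\<And>k. 0 \<le> snd (s k)" and \<beta>: "0 \<le> \<beta>"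
  shows "exp (\<beta> * real m) * real (card (big_visits \<omega> s n m)) \<le> clk (trap \<beta> \<omega>) 0 s n"
proof -
  have "exp (\<beta> * real m) * real (card (big_visits \<omega> s n m)) = (\<Sum>k\<in>big_visits \<omega> s n m. 1 * exp (\<beta> * real m))" by simp
  also have "\<dots> \<le> (\<Sum>k\<in>big_visits \<omega> s n m. snd (s k) * trap \<beta> \<omega> (pos s k))"
  proof (intro sum_mono mult_mono)
    fix k assume k: "k \<in> big_visits \<omega> s n m"
    then show "1 \<le> snd (s k)" by (simp add: big_visits_def long_holds_def)
    obtain c where c: "cluster_size \<omega> (pos s k) = enat c" using fin[of "pos s k"] by auto
    then have "m \<le> c" using k by (simp add: big_visits_def)
    then show "exp (\<beta> * real m) \<le> trap \<beta> \<omega> (pos s k)" using \<beta> by (simp add: trap_def c mult_left_mono)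
  qed (use s in auto)
  also have "\<dots> \<le> (\<Sum>k<n. snd (s k) * trap \<beta> \<omega> (pos s k))"
    by (rule sum_mono2) (auto simp: big_visits_def long_holds_def intro!: mult_nonneg_nonneg s trap_nonneg)
  finally show ?thesis by (simp add: clk_def)
qed

section \<open>Almost sure growth of the clock\<close>

text \<open>Heuristics: among \<open>n^\<alpha>\<close> sites the largest cluster has about
  \<open>\<alpha> ln n / \<xi>\<close> sites, its trap factor is \<open>n\<close> to the power
  \<open>\<alpha> \<beta> / \<xi>\<close>, and a site is visited about
  \<open>n^(1 - \<alpha>)\<close> times.\<close>

definition clock_exp :: "real \<Rightarrow> real \<Rightarrow> real \<Rightarrow> real" where
  "clock_exp \<alpha> \<beta> \<xi> = 1 - \<alpha> + \<alpha> * \<beta> / \<xi>"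

lemma AE_joint_snd:
  assumes "AE s in J.marks lam l. P s" shows "AE z in joint p lam l. P (snd z)"
proof -
  interpret pair_prob_space "perc p" "J.marks lam l" by (rule pair_prob_joint)
  obtain N where N: "{s \<in> space (J.marks lam l). \<not> P s} \<subseteq> N" "N \<in> null_sets (J.marks lam l)"
    using assms by (auto simp: eventually_ae_filter)
  have "space (perc p) \<times> N \<in> null_sets (joint p lam l)"
    by (rule J.marks.times_in_null_sets2[OF sets.top N(2)])
  from AE_not_in[OF this] show ?thesis
    by eventually_elim (use N(1) in auto)
qed

lemma AE_joint_fst:
  assumes "AE \<omega> in perc p. P \<omega>" shows "AE z in joint p lam l. P (fst z)"
proof -
  interpret pair_prob_space "perc p" "J.marks lam l" by (rule pair_prob_joint)
  obtain N where N: "{\<omega> \<in> space (perc p). \<not> P \<omega>} \<subseteq> N" "N \<in> null_sets (perc p)"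
    using assms by (auto simp: eventually_ae_filter)
  have "N \<times> space (J.marks lam l) \<in> null_sets (joint p lam l)"
    by (rule J.marks.times_in_null_sets1[OF N(2) sets.top])
  from AE_not_in[OF this] show ?thesis
    by eventually_elim (use N(1) in auto)
qed

lemma regime_alpha: "regime lam l \<alpha> \<Longrightarrow> 0 < \<alpha> \<and> \<alpha> \<le> 1"
  by (auto simp: regime_def)

text \<open>The loss \<open>\<epsilon>\<close> in the exponent is spent in three parts: a quarter on
  \<open>e1\<close>, a quarter on \<open>\<zeta>\<close>, and half on the constants in the final
  estimate.\<close>

theorem clock_lower_as:
  fixes l :: "real ^ 'd::finite"
  assumes reg: "regime lam l \<alpha>" and decay: "cluster_decay_rate TYPE('d) p \<xi>" and \<beta>: "\<xi> \<le> \<beta>" and \<epsilon>: "0 < \<epsilon>"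
  shows "AE z in joint p lam l. \<forall>\<^sub>F k in sequentially.
    real (2 ^ k) powr (clock_exp \<alpha> \<beta> \<xi> - \<epsilon>) \<le> clk (trap \<beta> (fst z)) 0 (snd z) (2 ^ k)"
proof -
  interpret jp: prob_space "joint p lam l" by (rule prob_space_joint)
  have \<xi>: "0 < \<xi>" using decay by (simp add: cluster_decay_rate_def)
  have \<beta>0: "0 < \<beta>" using \<xi> \<beta> by linarith
  have \<alpha>: "0 < \<alpha>" "\<alpha> \<le> 1" using regime_alpha[OF reg] by auto
  \<comment> \<open>The margin \<open>e1\<close> keeps the probability of a large cluster well above
    \<open>n powr (- \<alpha>)\<close>; its cost \<open>\<beta> * e1 / \<xi>\<close> is at most
    \<open>\<epsilon> / 4\<close>.\<close>
  define e1 where "e1 = min (\<alpha> / 2) (\<epsilon> * \<xi> / (4 * \<beta>))"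
  have e1: "0 < e1" "e1 < \<alpha>" using \<alpha> \<epsilon> \<xi> \<beta>0 by (auto simp: e1_def min_less_iff_disj)
  have e1b: "\<beta> * e1 / \<xi> \<le> \<epsilon> / 4"
  proof -
    have "\<beta> * e1 / \<xi> \<le> \<beta> * (\<epsilon> * \<xi> / (4 * \<beta>)) / \<xi>"
      using \<beta>0 \<xi> by (intro divide_right_mono mult_left_mono) (auto simp: e1_def)
    then show ?thesis using \<beta>0 \<xi> by simp
  qed
  define \<zeta> where "\<zeta> = \<epsilon> * \<xi> / (4 * \<beta>)"
  have \<zeta>: "0 < \<zeta>" using \<epsilon> \<xi> \<beta>0 by (simp add: \<zeta>_def)
  define \<theta> where "\<theta> = \<xi> * (1 + \<zeta>)"
  have \<theta>: "\<xi> < \<theta>" "0 < \<theta>" using \<xi> \<zeta> by (auto simp: \<theta>_def algebra_simps add_pos_pos)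
  \<comment> \<open>For large \<open>n\<close>, clusters of size at least
    \<open>\<tau> * ln n\<close> have probability at least
    \<open>n powr (- \<theta> * \<tau>) = n powr (- (\<alpha> - e1))\<close>.\<close>
  define \<tau> where "\<tau> = (\<alpha> - e1) / \<theta>"
  have \<tau>: "0 < \<tau>" using e1 \<theta> by (simp add: \<tau>_def)
  have \<tau>\<theta>: "\<theta> * \<tau> = \<alpha> - e1" using \<theta> by (simp add: \<tau>_def)
  have \<beta>\<tau>: "\<alpha> * \<beta> / \<xi> - \<epsilon> / 2 \<le> \<beta> * \<tau>"
  proof -
    define A where "A = \<beta> * (\<alpha> - e1) / \<xi>"
    have "\<beta> * \<tau> = A / (1 + \<zeta>)" by (simp add: \<tau>_def \<theta>_def A_def)
    moreover have "A - A / (1 + \<zeta>) = A * (\<zeta> / (1 + \<zeta>))" using \<zeta> by (simp add: field_simps)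
    ultimately have "\<beta> * (\<alpha> - e1) / \<xi> - \<beta> * \<tau> = \<beta> * (\<alpha> - e1) / \<xi> * (\<zeta> / (1 + \<zeta>))"
      by (simp only: A_def)
    also have "\<dots> \<le> \<beta> * 1 / \<xi> * \<zeta>"
    proof (intro mult_mono divide_right_mono mult_left_mono)
      have "\<zeta> / (1 + \<zeta>) \<le> \<zeta> / 1" using \<zeta> by (intro divide_left_mono) auto
      then show "\<zeta> / (1 + \<zeta>) \<le> \<zeta>" by simp
    qed (use e1 \<alpha> \<beta>0 \<xi> \<zeta> in auto)
    also have "\<dots> = \<epsilon> / 4" using \<beta>0 \<xi> by (simp add: \<zeta>_def)
    finally have "\<beta> * (\<alpha> - e1) / \<xi> - \<epsilon> / 4 \<le> \<beta> * \<tau>" by linarith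
    moreover have "\<beta> * (\<alpha> - e1) / \<xi> = \<alpha> * \<beta> / \<xi> - \<beta> * e1 / \<xi>"
      by (simp add: right_diff_distrib diff_divide_distrib mult.commute)
    ultimately show ?thesis using e1b by linarith
  qed
  \<comment> \<open>Rounding down preserves the lower bound on the probability and costs at most a
    factor \<open>exp \<beta>\<close> in the trap.\<close>
  define m where "m k = nat \<lfloor>\<tau> * ln (real (2 ^ k))\<rfloor>" for k :: nat
  have lnk: "0 \<le> ln (real (2 ^ k))" for k by simp
  have m: "\<tau> * ln (real (2 ^ k)) - 1 \<le> real (m k)" "real (m k) \<le> \<tau> * ln (real (2 ^ k))" for k
  proof -
    have "0 \<le> \<tau> * ln (real (2 ^ k))" using \<tau> lnk[of k] by (intro mult_nonneg_nonneg) auto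
    then show "\<tau> * ln (real (2 ^ k)) - 1 \<le> real (m k)" "real (m k) \<le> \<tau> * ln (real (2 ^ k))"
      unfolding m_def by linarith+
  qed
  obtain M where M: "\<And>j. M \<le> j \<Longrightarrow> exp (- \<theta> * real j) \<le> big_prob TYPE('d) p j"
    using decay_lower[OF decay \<theta>(1)] by (auto simp: eventually_sequentially)
  have "\<forall>\<^sub>F k in sequentially. real M \<le> \<tau> * ln (real (2 ^ k)) - 1"
    using \<tau> by real_asymp
  then obtain k0 where k0: "\<And>k. k0 \<le> k \<Longrightarrow> M \<le> m k"
    unfolding eventually_sequentially using m(1) by (meson le_nat_floor of_nat_le_iff order_trans)
  have q: "real (2 ^ k) powr (- (\<alpha> - e1)) \<le> big_prob TYPE('d) p (m k)" if "k0 \<le> k" for k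
  proof -
    have "real (2 ^ k) powr (- (\<alpha> - e1)) = exp (- \<theta> * (\<tau> * ln (real (2 ^ k))))"
      by (simp add: powr_def \<tau>\<theta>[symmetric])
    also have "\<dots> \<le> exp (- \<theta> * real (m k))"
      using \<theta> m(2)[of k] by simp
    also have "\<dots> \<le> big_prob TYPE('d) p (m k)" by (rule M[OF k0[OF that]])
    finally show ?thesis .
  qed
  have qpos: "0 < big_prob TYPE('d) p (m k)" if "k0 \<le> k" for k
    using q[OF that] by (rule less_le_trans[rotated]) simp
  obtain C where C: "0 < C" "\<And>n r. 1 \<le> n \<Longrightarrow> green lam l n r \<le> C * (real r + 1)\<^sup>2 * real n powr (1 - \<alpha> + e1 / 4)"
    using green_bound[OF reg, of "e1 / 4"] e1 by auto
  \<comment> \<open>The squared logarithmic radius costs the exponent \<open>2 * u = e1 / 4\<close>,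
    the Green sum another \<open>e1 / 4\<close>; against the margin \<open>e1\<close> this leaves
    \<open>- e1 / 2\<close>.\<close>
  define u where "u = e1 / 8"
  have u: "0 < u" using e1 by (simp add: u_def)
  define C1 where "C1 = 8 * C * (2 * \<tau> / u + 1)\<^sup>2 / hold_frac\<^sup>2"
  have bound: "measure (joint p lam l) {z. few_big_visits p (2 ^ k) (m k) z} \<le> C1 * real (2 ^ k) powr (- (e1 / 2))" if k: "k0 \<le> k" for k
  proof -
    define n where "n = real (2 ^ k)"
    have n: "1 \<le> n" unfolding n_def by simp
    have nu: "1 \<le> n powr u" using n u by (intro ge_one_powr_ge_zero) auto
    have "real (2 * m k) \<le> 2 * (\<tau> * (n powr u / u))"
    proof -
      have "ln n \<le> n powr u / u" using n u by (rule ln_powr_bound)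
      then have "\<tau> * ln n \<le> \<tau> * (n powr u / u)" using \<tau> by (intro mult_left_mono) auto
      then show ?thesis using m(2)[of k] by (simp add: n_def)
    qed
    then have "real (2 * m k) + 1 \<le> (2 * \<tau> / u + 1) * n powr u"
      using nu by (simp add: algebra_simps)
    then have "(real (2 * m k) + 1)\<^sup>2 \<le> ((2 * \<tau> / u + 1) * n powr u)\<^sup>2" by (intro power_mono) auto
    also have "\<dots> = (2 * \<tau> / u + 1)\<^sup>2 * n powr (2 * u)"
      by (simp add: power_mult_distrib power2_eq_square powr_add[symmetric])
    finally have r: "(real (2 * m k) + 1)\<^sup>2 \<le> (2 * \<tau> / u + 1)\<^sup>2 * n powr (2 * u)" .
    have "measure (joint p lam l) {z. few_big_visits p (2 ^ k) (m k) z}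
      \<le> 8 * green lam l (2 ^ k) (2 * m k) / (big_prob TYPE('d) p (m k) * hold_frac\<^sup>2 * real (2 ^ k))"
      by (rule clock_lower_prob(1)[OF _ qpos[OF k]]) simp
    also have "\<dots> \<le> 8 * (C * ((2 * \<tau> / u + 1)\<^sup>2 * n powr (2 * u)) * n powr (1 - \<alpha> + e1 / 4)) / (n powr (- (\<alpha> - e1)) * hold_frac\<^sup>2 * n)"
    proof (rule frac_le)
      have "green lam l (2 ^ k) (2 * m k) \<le> C * (real (2 * m k) + 1)\<^sup>2 * n powr (1 - \<alpha> + e1 / 4)"
        unfolding n_def by (rule C(2)) simp
      also have "\<dots> \<le> C * ((2 * \<tau> / u + 1)\<^sup>2 * n powr (2 * u)) * n powr (1 - \<alpha> + e1 / 4)"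
        using C(1) r by (intro mult_right_mono mult_left_mono) auto
      finally show "8 * green lam l (2 ^ k) (2 * m k) \<le> 8 * (C * ((2 * \<tau> / u + 1)\<^sup>2 * n powr (2 * u)) * n powr (1 - \<alpha> + e1 / 4))" by simp
      show "0 < n powr (- (\<alpha> - e1)) * hold_frac\<^sup>2 * n" using n hold_frac_pos by simp
      show "n powr (- (\<alpha> - e1)) * hold_frac\<^sup>2 * n \<le> big_prob TYPE('d) p (m k) * hold_frac\<^sup>2 * real (2 ^ k)"
        using q[OF k] by (intro mult_mono) (auto simp: n_def big_prob_01)
    qed (use C(1) in simp)
    also have "\<dots> = C1 * (n powr (2 * u) * n powr (1 - \<alpha> + e1 / 4) / (n powr (- (\<alpha> - e1)) * n powr 1))"
      using n by (simp add: C1_def mult_ac)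
    also have "n powr (2 * u) * n powr (1 - \<alpha> + e1 / 4) / (n powr (- (\<alpha> - e1)) * n powr 1) = n powr (- (e1 / 2))"
      unfolding powr_add[symmetric] powr_diff[symmetric] by (simp add: u_def algebra_simps)
    finally show ?thesis by (simp add: n_def)
  qed
  have "AE z in joint p lam l. \<forall>\<^sub>F k in sequentially. \<not> (k0 \<le> k \<and> few_big_visits p (2 ^ k) (m k) z)"
  proof (rule jp.borel_cantelli_eventually)
    show "{z \<in> space (joint p lam l). k0 \<le> k \<and> few_big_visits p (2 ^ k) (m k) z} \<in> sets (joint p lam l)" for k
      using clock_lower_prob(2)[of "2 ^ k" p "m k" lam l] qpos[of k] by (cases "k0 \<le> k") simp_all
    have C1: "0 \<le> C1" using C by (simp add: C1_def)
    show "jp.prob {z \<in> space (joint p lam l). k0 \<le> k \<and> few_big_visits p (2 ^ k) (m k) z} \<le> C1 * real (2 ^ k) powr (- (e1 / 2))" for k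
      using bound[of k] C1 by (cases "k0 \<le> k") simp_all
    show "summable (\<lambda>k. C1 * real (2 ^ k) powr (- (e1 / 2)))" using e1 by (intro summable_dyadic_powr) simp
  qed
  moreover have "AE z in joint p lam l. \<forall>\<^sub>F n in sequentially. hold_frac * real n < real (card (long_holds (snd z) n))"
    by (rule AE_joint_snd[OF AE_many_long_holds])
  moreover have "AE z in joint p lam l. \<forall>k. 0 < snd (snd z k)"
    by (rule AE_joint_snd[OF J.AE_holds_pos])
  moreover have "AE z in joint p lam l. \<forall>x. cluster_size (fst z) x \<noteq> \<infinity>"
    by (rule AE_joint_fst[OF AE_cluster_finite[OF decay]])
  ultimately show ?thesis
  proof eventually_elim
    case (elim z)
    have two: "filterlim (\<lambda>k. 2 ^ k :: nat) sequentially sequentially"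
      by (rule filterlim_subseq) (simp add: strict_mono_def)
    have "\<forall>\<^sub>F k in sequentially. hold_frac * real (2 ^ k) < real (card (long_holds (snd z) (2 ^ k)))"
      using eventually_compose_filterlim[OF elim(2) two] by simp
    moreover have "\<forall>\<^sub>F k in sequentially. 2 / hold_frac * exp \<beta> \<le> real (2 ^ k) powr (\<epsilon> / 2)"
      using \<epsilon> by real_asymp
    ultimately show ?case using elim(1) eventually_ge_at_top[of k0]
    proof eventually_elim
      case (elim k)
      define n where "n = real (2 ^ k)"
      have n: "1 \<le> n" unfolding n_def by simp
      have h: "0 < hold_frac" by (rule hold_frac_pos)
      have "hold_frac * n * big_prob TYPE('d) p (m k) / 2 < real (card (big_visits (fst z) (snd z) (2 ^ k) (m k)))"
        using elim unfolding few_big_visits_def n_def by auto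
      moreover have "hold_frac * n * n powr (- (\<alpha> - e1)) / 2 \<le> hold_frac * n * big_prob TYPE('d) p (m k) / 2"
        using q[OF elim(4)] h n by (intro divide_right_mono mult_left_mono) (auto simp: n_def)
      ultimately have card: "hold_frac * n * n powr (- (\<alpha> - e1)) / 2 \<le> real (card (big_visits (fst z) (snd z) (2 ^ k) (m k)))" by linarith
      have "exp (- \<beta>) * n powr (\<beta> * \<tau>) \<le> exp (\<beta> * real (m k))"
      proof -
        have "exp (- \<beta>) * n powr (\<beta> * \<tau>) = exp (\<beta> * (\<tau> * ln n - 1))"
          using n by (simp add: powr_def exp_add[symmetric] algebra_simps)
        also have "\<dots> \<le> exp (\<beta> * real (m k))" using m(1)[of k] \<beta>0 by (simp add: n_def)
        finally show ?thesis .
      qed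
      then have "(exp (- \<beta>) * n powr (\<beta> * \<tau>)) * (hold_frac * n * n powr (- (\<alpha> - e1)) / 2)
        \<le> exp (\<beta> * real (m k)) * real (card (big_visits (fst z) (snd z) (2 ^ k) (m k)))"
        using card h n by (intro mult_mono) auto
      also have "\<dots> \<le> clk (trap \<beta> (fst z)) 0 (snd z) (2 ^ k)"
        by (rule clk_lower_deterministic) (use \<open>\<forall>x. cluster_size (fst z) x \<noteq> \<infinity>\<close> \<open>\<forall>k. 0 < snd (snd z k)\<close> \<beta>0 in \<open>auto intro: less_imp_le\<close>)
      finally have clk: "(exp (- \<beta>) * n powr (\<beta> * \<tau>)) * (hold_frac * n * n powr (- (\<alpha> - e1)) / 2) \<le> clk (trap \<beta> (fst z)) 0 (snd z) (2 ^ k)" .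
      have "n powr (clock_exp \<alpha> \<beta> \<xi> - \<epsilon>) = n powr (clock_exp \<alpha> \<beta> \<xi> - \<epsilon> / 2) * n powr (- (\<epsilon> / 2))"
        by (simp add: powr_add[symmetric])
      also have "\<dots> \<le> n powr (\<beta> * \<tau> + 1 + - (\<alpha> - e1)) * (hold_frac / 2 * exp (- \<beta>))"
      proof (intro mult_mono powr_mono n)
        show "clock_exp \<alpha> \<beta> \<xi> - \<epsilon> / 2 \<le> \<beta> * \<tau> + 1 + - (\<alpha> - e1)"
          using \<beta>\<tau> e1 by (simp add: clock_exp_def)
        have "n powr (- (\<epsilon> / 2)) = 1 / n powr (\<epsilon> / 2)" by (simp add: powr_minus_divide)
        also have "\<dots> \<le> 1 / (2 / hold_frac * exp \<beta>)"
          using elim(2) h unfolding n_def by (intro divide_left_mono) auto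
        also have "\<dots> = hold_frac / 2 * exp (- \<beta>)" by (simp add: exp_minus field_simps)
        finally show "n powr (- (\<epsilon> / 2)) \<le> hold_frac / 2 * exp (- \<beta>)" .
      qed (use n in auto)
      also have "\<dots> = (exp (- \<beta>) * n powr (\<beta> * \<tau>)) * (hold_frac * n * n powr (- (\<alpha> - e1)) / 2)"
        using n by (simp add: powr_add)
      finally show ?case using clk by (simp add: n_def)
    qed
  qed
qed

text \<open>For \<open>\<alpha> = 1\<close> the number of steps suffices. On the line the visited
  sites lie in an interval whose length is governed by the maximal displacement.\<close>

lemma range_bound_as:
  fixes l :: "real ^ 'd::finite"
  assumes reg: "regime lam l \<alpha>" and \<delta>: "0 < \<delta>"
  shows "AE s in J.marks lam l. \<forall>\<^sub>F n in sequentially. real (card (pos s ` {..<n})) \<le> real n powr (\<alpha> + \<delta>)"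
proof -
  have trivial: ?thesis if \<alpha>: "\<alpha> = 1"
  proof (rule AE_I2)
    fix s :: "nat \<Rightarrow> (int ^ 'd) \<times> real"
    show "\<forall>\<^sub>F n in sequentially. real (card (pos s ` {..<n})) \<le> real n powr (\<alpha> + \<delta>)"
      using eventually_ge_at_top[of 1]
    proof eventually_elim
      case (elim n)
      have "card (pos s ` {..<n}) \<le> n" using card_image_le[of "{..<n}" "pos s"] by simp
      then have "real (card (pos s ` {..<n})) \<le> real n powr 1" using elim by simp
      also have "\<dots> \<le> real n powr (\<alpha> + \<delta>)" using elim \<alpha> \<delta> by (intro powr_mono) auto
      finally show ?case .
    qed
  qed
  from reg show ?thesis
  proof (cases rule: regime_cases)
    case 3
    obtain i :: 'd where True by simp
    have all: "j = i" for j :: 'd using 3(2) by (metis (full_types) UNIV_I card_1_singletonE singletonD)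
    have inj: "inj_on (\<lambda>x :: int ^ 'd. x $ i) A" for A
    proof (rule inj_onI)
      fix x y :: "int ^ 'd" assume e: "x $ i = y $ i"
      have "x $ j = y $ j" for j using e all[of j] by simp
      then show "x = y" by (simp add: vec_eq_iff)
    qed
    have "AE s in J.marks 0 l. \<forall>\<^sub>F n in sequentially. \<forall>i. \<bar>real_of_int (pos s n $ i)\<bar> \<le> real n powr (1 / 2 + \<delta> / 2)"
      by (rule walk_diffusive_upper) (use \<delta> in simp)
    then have "AE s in J.marks 0 l. \<forall>\<^sub>F n in sequentially. real (card (pos s ` {..<n})) \<le> real n powr (1 / 2 + \<delta>)"
    proof eventually_elim
      case (elim s)
      then obtain N where N: "\<And>j. N \<le> j \<Longrightarrow> \<bar>real_of_int (pos s j $ i)\<bar> \<le> real j powr (1 / 2 + \<delta> / 2)"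
        by (auto simp: eventually_sequentially)
      \<comment> \<open>The diffusive bound starts at \<open>N\<close>; \<open>B\<close> covers the
        finitely many earlier positions.\<close>
      define B where "B = (\<Sum>j<N. \<bar>real_of_int (pos s j $ i)\<bar>)"
      have B: "0 \<le> B" by (simp add: B_def sum_nonneg)
      have "\<forall>\<^sub>F n in sequentially. 2 * (B + real n powr (1 / 2 + \<delta> / 2)) + 1 \<le> real n powr (1 / 2 + \<delta>)"
        using \<delta> by real_asymp
      then show ?case
      proof eventually_elim
        case (elim n)
        define K where "K = \<lfloor>B + real n powr (1 / 2 + \<delta> / 2)\<rfloor>"
        have K0: "0 \<le> K" using B by (simp add: K_def)
        have "(\<lambda>x. x $ i) ` pos s ` {..<n} \<subseteq> {- K..K}"
        proof (intro subsetI, elim imageE, simp)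
          fix j assume j: "j < n"
          have "\<bar>real_of_int (pos s j $ i)\<bar> \<le> B + real n powr (1 / 2 + \<delta> / 2)"
          proof (cases "N \<le> j")
            case True
            have "real j powr (1 / 2 + \<delta> / 2) \<le> real n powr (1 / 2 + \<delta> / 2)" using j \<delta> by (intro powr_mono2) auto
            then show ?thesis using N[OF True] B by linarith
          next
            case False
            have "\<bar>real_of_int (pos s j $ i)\<bar> \<le> B" unfolding B_def using False by (intro member_le_sum) auto
            then show ?thesis by (simp add: add_increasing2)
          qed
          then have "\<bar>pos s j $ i\<bar> \<le> K" unfolding K_def by (simp add: le_floor_iff)
          then show "- K \<le> pos s j $ i \<and> pos s j $ i \<le> K" by linarith
        qed
        then have "card ((\<lambda>x. x $ i) ` pos s ` {..<n}) \<le> card {- K..K}" by (intro card_mono) auto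
        then have "card (pos s ` {..<n}) \<le> nat (2 * K + 1)" by (simp add: card_image[OF inj])
        then have "real (card (pos s ` {..<n})) \<le> 2 * real_of_int K + 1" using K0 by linarith
        also have "\<dots> \<le> 2 * (B + real n powr (1 / 2 + \<delta> / 2)) + 1"
          unfolding K_def by (intro add_right_mono mult_left_mono of_int_floor_le) simp
        finally show ?case using elim by linarith
      qed
    qed
    then show ?thesis unfolding 3(1,3) .
  qed (use trivial in auto)
qed

theorem clock_upper_as:
  fixes l :: "real ^ 'd::finite"
  assumes reg: "regime lam l \<alpha>" and decay: "cluster_decay_rate TYPE('d) p \<xi>" and \<beta>: "\<xi> \<le> \<beta>" and \<epsilon>: "0 < \<epsilon>"
  shows "AE z in joint p lam l. \<forall>\<^sub>F k in sequentially.
    clk (trap \<beta> (fst z)) 0 (snd z) (2 ^ k) \<le> real (2 ^ k) powr (clock_exp \<alpha> \<beta> \<xi> + \<epsilon>)"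
proof -
  interpret jp: prob_space "joint p lam l" by (rule prob_space_joint)
  have \<xi>: "0 < \<xi>" using decay by (simp add: cluster_decay_rate_def)
  have \<beta>0: "0 < \<beta>" using \<xi> \<beta> by linarith
  have \<alpha>: "0 < \<alpha>" "\<alpha> \<le> 1" using regime_alpha[OF reg] by auto
  define \<eta> where "\<eta> = \<xi> / \<beta>"
  have \<eta>: "0 < \<eta>" "\<eta> \<le> 1" using \<xi> \<beta> \<beta>0 by (simp_all add: \<eta>_def)
  \<comment> \<open>Exponent budget: \<open>\<delta>\<close> for the range and
    \<open>\<kappa> \<le> \<delta>\<close> for the moment order lose at most
    \<open>\<eta> * \<epsilon> / 4\<close>, against a gain \<open>a * \<epsilon>\<close> of at least
    \<open>\<eta> * \<epsilon> / 2\<close>.\<close>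
  define \<delta> where "\<delta> = \<eta> * \<epsilon> / 8"
  have \<delta>: "0 < \<delta>" using \<eta> \<epsilon> by (simp add: \<delta>_def)
  define \<kappa> where "\<kappa> = min (1 / 2) \<delta>"
  have \<kappa>: "0 < \<kappa>" "\<kappa> \<le> 1 / 2" "\<kappa> \<le> \<delta>" using \<delta> by (auto simp: \<kappa>_def)
  \<comment> \<open>Just below the critical order \<open>\<xi> / \<beta>\<close>, so that
    \<open>a * \<beta> < \<xi>\<close> and the trap moment is finite;
    \<open>\<kappa> \<le> 1 / 2\<close> keeps \<open>a\<close> above
    \<open>\<eta> / 2\<close>.\<close>
  define a where "a = \<eta> * (1 - \<kappa>)"
  have "\<eta> * (1 - \<kappa>) \<le> 1 * 1" using \<eta> \<kappa> by (intro mult_mono) auto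
  then have a: "0 < a" "a \<le> 1" using \<eta> \<kappa> by (simp_all add: a_def)
  have a2: "\<eta> / 2 \<le> a"
  proof -
    have "\<eta> * (1 / 2) \<le> \<eta> * (1 - \<kappa>)" using \<eta> \<kappa> by (intro mult_left_mono) auto
    then show ?thesis by (simp add: a_def)
  qed
  have a\<beta>: "a * \<beta> = \<xi> * (1 - \<kappa>)" using \<beta>0 by (simp add: a_def \<eta>_def)
  have "a * \<beta> < \<xi>" unfolding a\<beta> using \<xi> \<kappa> by (simp add: algebra_simps)
  from trap_moment[OF decay a(1) \<beta>0 this] obtain C where C: "0 < C"
    and mom: "\<And>x :: int ^ 'd. (\<integral>\<^sup>+\<omega>. ennreal (trap \<beta> \<omega> x powr a) \<partial>perc p) \<le> ennreal C" by blast
  let ?\<sigma> = "clock_exp \<alpha> \<beta> \<xi>"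
  let ?P = "\<lambda>k y. real (card (pos (snd y) ` {..<2 ^ k})) \<le> real (2 ^ k) powr (\<alpha> + \<delta>) \<and>
     real (2 ^ k) powr (?\<sigma> + \<epsilon>) < clk (trap \<beta> (fst y)) 0 (snd y) (2 ^ k)"
  have expo: "- a * (?\<sigma> + \<epsilon>) + (\<alpha> + \<delta> + (1 - \<alpha>) * a) \<le> - (\<eta> * \<epsilon> / 4)"
  proof -
    have "a * (\<alpha> * \<beta> / \<xi>) = \<alpha> * (a * \<beta>) / \<xi>" by simp
    also have "\<dots> = \<alpha> * (1 - \<kappa>)" unfolding a\<beta> using \<xi> by simp
    finally have 1: "a * (\<alpha> * \<beta> / \<xi>) = \<alpha> * (1 - \<kappa>)" .
    have "- a * (?\<sigma> + \<epsilon>) + (\<alpha> + \<delta> + (1 - \<alpha>) * a) = \<alpha> + \<delta> - a * (\<alpha> * \<beta> / \<xi>) - a * \<epsilon>"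
      unfolding clock_exp_def by (simp add: algebra_simps)
    also have "\<dots> = \<alpha> * \<kappa> + \<delta> - a * \<epsilon>" unfolding 1 by (simp add: algebra_simps)
    also have "\<dots> \<le> \<delta> + \<delta> - \<eta> / 2 * \<epsilon>"
    proof -
      have "\<alpha> * \<kappa> \<le> 1 * \<delta>" using \<alpha> \<kappa> by (intro mult_mono) auto
      moreover have "\<eta> / 2 * \<epsilon> \<le> a * \<epsilon>" using a2 \<epsilon> by (intro mult_right_mono) auto
      ultimately show ?thesis by linarith
    qed
    also have "\<dots> = - (\<eta> * \<epsilon> / 4)" by (simp add: \<delta>_def)
    finally show ?thesis .
  qed
  have bound: "jp.prob {y. ?P k y} \<le> 2 * C * real (2 ^ k) powr (- (\<eta> * \<epsilon> / 4))" for k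
  proof -
    define n where "n = real (2 ^ k)"
    have n: "1 \<le> n" unfolding n_def by simp
    \<comment> \<open>The scale \<open>n powr (1 - \<alpha>)\<close>, the typical number of visits
      per site, balances the two terms of the affine majorant up to
      \<open>n powr \<delta>\<close>.\<close>
    have "jp.prob {y. real (card (pos (snd y) ` {..<2 ^ k})) \<le> n powr (\<alpha> + \<delta>) \<and>
         n powr (?\<sigma> + \<epsilon>) < clk (trap \<beta> (fst y)) 0 (snd y) (2 ^ k)} \<le> (n powr (?\<sigma> + \<epsilon>)) powr (- a) * (C * (n powr (\<alpha> + \<delta>) * (n powr (1 - \<alpha>)) powr a + (n powr (1 - \<alpha>)) powr (a - 1) * real (2 ^ k)))"
      by (rule clock_upper_prob(1)[OF mom _ _ a, of "n powr (1 - \<alpha>)" "n powr (?\<sigma> + \<epsilon>)" "n powr (\<alpha> + \<delta>)" lam l "2 ^ k"])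
        (use C n in auto)
    also have "real (2 ^ k) = n powr 1" using n by (simp add: n_def)
    also have "(n powr (?\<sigma> + \<epsilon>)) powr (- a) * (C * (n powr (\<alpha> + \<delta>) * (n powr (1 - \<alpha>)) powr a + (n powr (1 - \<alpha>)) powr (a - 1) * n powr 1))
      = C * (n powr ((?\<sigma> + \<epsilon>) * - a) * (n powr (\<alpha> + \<delta>) * n powr ((1 - \<alpha>) * a))
        + n powr ((?\<sigma> + \<epsilon>) * - a) * (n powr ((1 - \<alpha>) * (a - 1)) * n powr 1))"
      unfolding powr_powr by (simp add: distrib_left mult_ac)
    also have "\<dots> = C * (n powr (- a * (?\<sigma> + \<epsilon>) + (\<alpha> + \<delta> + (1 - \<alpha>) * a)) + n powr (- a * (?\<sigma> + \<epsilon>) + ((1 - \<alpha>) * (a - 1) + 1)))"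
      unfolding powr_add[symmetric] by (simp add: mult.commute)
    also have "\<dots> \<le> C * (n powr (- (\<eta> * \<epsilon> / 4)) + n powr (- (\<eta> * \<epsilon> / 4)))"
    proof (intro mult_left_mono add_mono powr_mono n expo)
      have "(1 - \<alpha>) * (a - 1) + 1 = \<alpha> + (1 - \<alpha>) * a" by (simp add: algebra_simps)
      then show "- a * (?\<sigma> + \<epsilon>) + ((1 - \<alpha>) * (a - 1) + 1) \<le> - (\<eta> * \<epsilon> / 4)" using expo \<delta> by linarith
    qed (use C in simp)
    finally show ?thesis by (simp add: n_def)
  qed
  have "AE y in joint p lam l. \<forall>\<^sub>F k in sequentially. \<not> ?P k y"
  proof (rule jp.borel_cantelli_eventually)
    show "{y \<in> space (joint p lam l). ?P k y} \<in> sets (joint p lam l)" for k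
      using clock_upper_prob(2)[OF mom _ _ a, of 1 "real (2 ^ k) powr (?\<sigma> + \<epsilon>)" "real (2 ^ k) powr (\<alpha> + \<delta>)" "2 ^ k" lam l] C by simp
    show "jp.prob {y \<in> space (joint p lam l). ?P k y} \<le> 2 * C * real (2 ^ k) powr (- (\<eta> * \<epsilon> / 4))" for k
      using bound[of k] by simp
    show "summable (\<lambda>k. 2 * C * real (2 ^ k) powr (- (\<eta> * \<epsilon> / 4)))" using \<eta> \<epsilon> by (intro summable_dyadic_powr) simp
  qed
  moreover have "AE z in joint p lam l. \<forall>\<^sub>F n in sequentially. real (card (pos (snd z) ` {..<n})) \<le> real n powr (\<alpha> + \<delta>)"
    by (rule AE_joint_snd[OF range_bound_as[OF reg \<delta>]])
  ultimately show ?thesis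
  proof eventually_elim
    case (elim z)
    have two: "filterlim (\<lambda>k. 2 ^ k :: nat) sequentially sequentially"
      by (rule filterlim_subseq) (simp add: strict_mono_def)
    have "\<forall>\<^sub>F k in sequentially. real (card (pos (snd z) ` {..<2 ^ k})) \<le> real (2 ^ k) powr (\<alpha> + \<delta>)"
      using eventually_compose_filterlim[OF elim(2) two] .
    with elim(1) show ?case
      by eventually_elim (auto simp: not_less)
  qed
qed

section \<open>From the clock to the process\<close>

text \<open>Rational times and countably many exponents make the event measurable in
  \<open>path_space\<close>; right continuity recovers real times. The clause
  \<open>1 \<le> real_of_rat q\<close> keeps to times at which evaluation is a coordinate.\<close>

definition upper_rate :: "real \<Rightarrow> (real \<Rightarrow> int ^ 'd::finite) \<Rightarrow> bool" where
  "upper_rate c Y \<longleftrightarrow> (\<forall>j::nat. \<exists>N::nat. \<forall>q::rat. 1 \<le> real_of_rat q \<and> real N \<le> real_of_rat q \<longrightarrow>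
     norm (to_real (Y (real_of_rat q))) \<le> real_of_rat q powr (c + inverse (real (Suc j))))"

definition lower_rate :: "real \<Rightarrow> (real \<Rightarrow> int ^ 'd::finite) \<Rightarrow> bool" where
  "lower_rate c Y \<longleftrightarrow> (\<forall>j::nat. \<exists>N::nat. \<forall>q::rat. 1 \<le> real_of_rat q \<and> real N \<le> real_of_rat q \<longrightarrow>
     real_of_rat q powr (c - inverse (real (Suc j))) \<le> norm (to_real (Y (real_of_rat q))))"

definition recurrent_lower_rate :: "real \<Rightarrow> (real \<Rightarrow> int ^ 'd::finite) \<Rightarrow> bool" where
  "recurrent_lower_rate c Y \<longleftrightarrow> (\<forall>j::nat. \<forall>N::nat. \<exists>q::rat. 1 \<le> real_of_rat q \<and> real N \<le> real_of_rat q \<and>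
     real_of_rat q powr (c - inverse (real (Suc j))) \<le> norm (to_real (Y (real_of_rat q))))"

lemma path_eval_pred:
  assumes "A \<Longrightarrow> 0 \<le> t"
  shows "Measurable.pred path_space (\<lambda>Y. A \<longrightarrow> R (Y t))" "Measurable.pred path_space (\<lambda>Y. A \<and> R (Y t))"
proof -
  have "Measurable.pred path_space (\<lambda>Y. R (Y t))" if A
    by (rule measurable_compose[OF path_eval_measurable[OF assms[OF that]]]) simp
  then show "Measurable.pred path_space (\<lambda>Y. A \<longrightarrow> R (Y t))" "Measurable.pred path_space (\<lambda>Y. A \<and> R (Y t))"
    by (cases A; simp only: simp_thms measurable_const space_count_space UNIV_I)+
qed

lemma rate_measurable:
  "Measurable.pred path_space (upper_rate c)" "Measurable.pred path_space (lower_rate c)"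
  "Measurable.pred path_space (recurrent_lower_rate c)"
proof -
  have p: "1 \<le> real_of_rat q \<and> real N \<le> real_of_rat q \<Longrightarrow> 0 \<le> real_of_rat q" for q N by linarith
  show "Measurable.pred path_space (upper_rate c)"
    unfolding upper_rate_def
    by (intro pred_intros_countable path_eval_pred(1)[OF p, where R="\<lambda>x. norm (to_real x) \<le> _"])
  show "Measurable.pred path_space (lower_rate c)"
    unfolding lower_rate_def
    by (intro pred_intros_countable path_eval_pred(1)[OF p, where R="\<lambda>x. _ \<le> norm (to_real x)"])
  show "Measurable.pred path_space (recurrent_lower_rate c)"
    unfolding recurrent_lower_rate_def conj_assoc[symmetric]
    by (intro pred_intros_countable path_eval_pred(2)[OF p, where R="\<lambda>x. _ \<le> norm (to_real x)"])
qed

text \<open>The coordinates are integers, so right continuity means being constant for a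
  while.\<close>

lemma path_space_locally_constant:
  assumes "Y \<in> space path_space" "0 \<le> t"
  shows "\<forall>\<^sub>F u in at_right t. Y u = (Y t :: int ^ 'd::finite)"
proof -
  have "(Y \<longlongrightarrow> Y t) (at_right t)" using assms by (simp add: space_path_space continuous_within)
  then have "((\<lambda>u. Y u $ i) \<longlongrightarrow> Y t $ i) (at_right t)" for i by (rule tendsto_vec_nth)
  then have "\<forall>\<^sub>F u in at_right t. Y u $ i = Y t $ i" for i by (simp add: tendsto_discrete)
  then have "\<forall>\<^sub>F u in at_right t. \<forall>i. Y u $ i = Y t $ i" by (rule eventually_all_finite)
  then show ?thesis by (simp add: vec_eq_iff)
qed

lemma rational_right_neighbour:
  assumes "\<forall>\<^sub>F u in at_right t. P u"
  shows "\<exists>q. t < real_of_rat q \<and> P (real_of_rat q)"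
proof -
  obtain b where b: "t < b" "\<And>u. t < u \<Longrightarrow> u < b \<Longrightarrow> P u"
    using assms by (auto simp: eventually_at_right_field)
  obtain q where "q \<in> \<rat>" "t < q" "q < b" using Rats_dense_in_real[OF b(1)] by blast
  then show ?thesis using b(2) by (metis Rats_cases)
qed

text \<open>A violation at a real time persists to its right, where the path is constant and the
  power continuous, and so would occur at a rational time.\<close>

lemma upper_rate_real:
  assumes Y: "Y \<in> space path_space" and u: "upper_rate c Y"
  shows "\<forall>\<^sub>F t in at_top. norm (to_real (Y t)) \<le> t powr (c + inverse (real (Suc j)))"
proof -
  let ?c = "c + inverse (real (Suc j))"
  obtain N where N: "\<And>q. 1 \<le> real_of_rat q \<Longrightarrow> real N \<le> real_of_rat q \<Longrightarrow> norm (to_real (Y (real_of_rat q))) \<le> real_of_rat q powr ?c"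
    using u unfolding upper_rate_def by blast
  show ?thesis
    using eventually_ge_at_top[of "max 1 (real N)"]
  proof eventually_elim
    case (elim t)
    show ?case
    proof (rule ccontr)
      assume "\<not> norm (to_real (Y t)) \<le> t powr ?c"
      then have lt: "t powr ?c < norm (to_real (Y t))" by simp
      have "((\<lambda>u. u powr ?c) \<longlongrightarrow> t powr ?c) (at_right t)"
        using elim by (intro tendsto_intros) auto
      then have "\<forall>\<^sub>F u in at_right t. u powr ?c < norm (to_real (Y t))" using lt by (rule order_tendstoD)
      moreover have "\<forall>\<^sub>F u in at_right t. Y u = Y t" using elim by (intro path_space_locally_constant[OF Y]) simp
      ultimately have "\<forall>\<^sub>F u in at_right t. u powr ?c < norm (to_real (Y u))" by eventually_elim simp
      then obtain q where q: "t < real_of_rat q" "real_of_rat q powr ?c < norm (to_real (Y (real_of_rat q)))"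
        using rational_right_neighbour by blast
      have "1 \<le> t" "real N \<le> t" using elim by simp_all
      then have "1 \<le> (real_of_rat q :: real)" "real N \<le> real_of_rat q" using q(1) by linarith+
      from N[OF this] show False using q(2) by linarith
    qed
  qed
qed

lemma lower_rate_real:
  assumes Y: "Y \<in> space path_space" and u: "lower_rate c Y"
  shows "\<forall>\<^sub>F t in at_top. t powr (c - inverse (real (Suc j))) \<le> norm (to_real (Y t))"
proof -
  let ?c = "c - inverse (real (Suc j))"
  obtain N where N: "\<And>q. 1 \<le> real_of_rat q \<Longrightarrow> real N \<le> real_of_rat q \<Longrightarrow> real_of_rat q powr ?c \<le> norm (to_real (Y (real_of_rat q)))"
    using u unfolding lower_rate_def by blast
  show ?thesis
    using eventually_ge_at_top[of "max 1 (real N)"]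
  proof eventually_elim
    case (elim t)
    show ?case
    proof (rule ccontr)
      assume "\<not> t powr ?c \<le> norm (to_real (Y t))"
      then have lt: "norm (to_real (Y t)) < t powr ?c" by simp
      have "((\<lambda>u. u powr ?c) \<longlongrightarrow> t powr ?c) (at_right t)"
        using elim by (intro tendsto_intros) auto
      then have "\<forall>\<^sub>F u in at_right t. norm (to_real (Y t)) < u powr ?c" using lt by (rule order_tendstoD)
      moreover have "\<forall>\<^sub>F u in at_right t. Y u = Y t" using elim by (intro path_space_locally_constant[OF Y]) simp
      ultimately have "\<forall>\<^sub>F u in at_right t. norm (to_real (Y u)) < u powr ?c" by eventually_elim simp
      then obtain q where q: "t < real_of_rat q" "norm (to_real (Y (real_of_rat q))) < real_of_rat q powr ?c"
        using rational_right_neighbour by blast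
      have "1 \<le> t" "real N \<le> t" using elim by simp_all
      then have "1 \<le> (real_of_rat q :: real)" "real N \<le> real_of_rat q" using q(1) by linarith+
      from N[OF this] show False using q(2) by linarith
    qed
  qed
qed

lemma log_ratio_le:
  assumes t: "1 < t" and "norm (to_real (Y t)) \<le> t powr c"
  shows "log_ratio Y t \<le> ereal c"
proof (cases "norm (to_real (Y t)) = 0")
  case True
  then show ?thesis using t by (simp add: log_ratio_def eln_def)
next
  case False
  then have "ln (norm (to_real (Y t))) \<le> c * ln t" using assms by (simp add: ln_powr[symmetric] del: ln_powr)
  then show ?thesis using False t by (simp add: log_ratio_def eln_def divide_le_eq)
qed

lemma log_ratio_ge:
  assumes t: "1 < t" and "t powr c \<le> norm (to_real (Y t))"
  shows "ereal c \<le> log_ratio Y t"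
proof -
  have "0 < t powr c" using t by simp
  then have n: "0 < norm (to_real (Y t))" using assms by linarith
  then have "c * ln t \<le> ln (norm (to_real (Y t)))" using assms by (simp add: ln_powr[symmetric] del: ln_powr)
  then show ?thesis using n t by (simp add: log_ratio_def eln_def le_divide_eq)
qed

lemma ereal_sandwich_Suc:
  fixes x :: ereal
  assumes "\<And>j. ereal (c - inverse (real (Suc j))) \<le> x"
  shows "ereal c \<le> x"
proof (rule LIMSEQ_le_const2)
  have "(\<lambda>j. c - inverse (real (Suc j))) \<longlonglongrightarrow> c - 0"
    by (intro tendsto_intros LIMSEQ_inverse_real_of_nat)
  then show "(\<lambda>j. ereal (c - inverse (real (Suc j)))) \<longlonglongrightarrow> ereal c" by simp
qed (use assms in auto)

lemma ereal_sandwich_Suc':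
  fixes x :: ereal
  assumes "\<And>j. x \<le> ereal (c + inverse (real (Suc j)))"
  shows "x \<le> ereal c"
proof (rule LIMSEQ_le_const)
  have "(\<lambda>j. c + inverse (real (Suc j))) \<longlonglongrightarrow> c + 0"
    by (intro tendsto_intros LIMSEQ_inverse_real_of_nat)
  then show "(\<lambda>j. ereal (c + inverse (real (Suc j)))) \<longlonglongrightarrow> ereal c" by simp
qed (use assms in auto)

lemma Limsup_log_ratio_le:
  assumes Y: "Y \<in> space path_space" and u: "upper_rate c Y"
  shows "Limsup at_top (log_ratio Y) \<le> ereal c"
proof (rule ereal_sandwich_Suc')
  fix j
  have "\<forall>\<^sub>F t in at_top. log_ratio Y t \<le> ereal (c + inverse (real (Suc j)))"
    using upper_rate_real[OF Y u, of j] eventually_gt_at_top[of 1]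
    by eventually_elim (rule log_ratio_le)
  then show "Limsup at_top (log_ratio Y) \<le> ereal (c + inverse (real (Suc j)))" by (rule Limsup_bounded)
qed

lemma log_ratio_tendsto:
  assumes Y: "Y \<in> space path_space" and u: "upper_rate c Y" and l: "lower_rate c Y"
  shows "(log_ratio Y \<longlongrightarrow> ereal c) at_top"
proof -
  have "ereal c \<le> Liminf at_top (log_ratio Y)"
  proof (rule ereal_sandwich_Suc)
    fix j
    have "\<forall>\<^sub>F t in at_top. ereal (c - inverse (real (Suc j))) \<le> log_ratio Y t"
      using lower_rate_real[OF Y l, of j] eventually_gt_at_top[of 1]
      by eventually_elim (rule log_ratio_ge)
    then show "ereal (c - inverse (real (Suc j))) \<le> Liminf at_top (log_ratio Y)" by (rule Liminf_bounded)
  qed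
  moreover note Limsup_log_ratio_le[OF Y u]
  moreover have "Liminf at_top (log_ratio Y) \<le> Limsup at_top (log_ratio Y)"
    by (rule Liminf_le_Limsup) simp
  ultimately show ?thesis by (intro Liminf_eq_Limsup) auto
qed

lemma Limsup_log_ratio_eq:
  assumes Y: "Y \<in> space path_space" and u: "upper_rate c Y" and l: "recurrent_lower_rate c Y"
  shows "Limsup at_top (log_ratio Y) = ereal c"
proof (rule antisym[OF Limsup_log_ratio_le[OF Y u]])
  show "ereal c \<le> Limsup at_top (log_ratio Y)"
  proof (rule ereal_sandwich_Suc)
    fix j
    show "ereal (c - inverse (real (Suc j))) \<le> Limsup at_top (log_ratio Y)"
      unfolding Limsup_def
    proof (rule INF_greatest)
      fix P :: "real \<Rightarrow> bool" assume "P \<in> {P. eventually P at_top}"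
      then obtain M where M: "\<And>t. M \<le> t \<Longrightarrow> P t" by (auto simp: eventually_at_top_linorder)
      obtain N :: nat where N: "max M 2 \<le> real N" using real_arch_simple by blast
      obtain q where q: "real N \<le> real_of_rat q" "real_of_rat q powr (c - inverse (real (Suc j))) \<le> norm (to_real (Y (real_of_rat q)))"
        using l unfolding recurrent_lower_rate_def by blast
      have "ereal (c - inverse (real (Suc j))) \<le> log_ratio Y (real_of_rat q)"
      proof (rule log_ratio_ge)
        have "2 \<le> real N" using N by simp
        then show "1 < (real_of_rat q :: real)" using q(1) by linarith
      qed (rule q(2))
      also have "\<dots> \<le> (SUP t\<in>{t. P t}. log_ratio Y t)"
        by (rule SUP_upper) (use M q N in auto)
      finally show "ereal (c - inverse (real (Suc j))) \<le> Sup (log_ratio Y ` Collect P)" .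
    qed
  qed
qed

section \<open>Deterministic inversion of the clock\<close>

lemma walk_path_between:
  assumes mono: "\<And>n. clk V x s n < clk V x s (Suc n)" and t: "clk V x s n \<le> t" "t < clk V x s (Suc n)"
  shows "walk_path V x s t = x + pos s n"
proof -
  have sm: "strict_mono (clk V x s)" using mono by (simp add: strict_mono_Suc_iff)
  have "(LEAST k. t < clk V x s (Suc k)) = n"
  proof (rule Least_equality)
    show "t < clk V x s (Suc n)" by (rule t(2))
  next
    fix k assume k: "t < clk V x s (Suc k)"
    then have "clk V x s n < clk V x s (Suc k)" using t by linarith
    then have "n < Suc k" using strict_mono_less[OF sm] by blast
    then show "n \<le> k" by simp
  qed
  then show ?thesis using t(2) unfolding walk_path_def by auto
qed

text \<open>Monotonicity extends dyadic bounds to all \<open>n\<close> at the cost of a factor 2 in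
  \<open>n\<close>, absorbed by halving the slack beforehand. The upper bound is for
  \<open>Suc n\<close> because the process sits at the \<open>n\<close>-th position until that clock
  value.\<close>

lemma clock_all_n:
  fixes S :: "nat \<Rightarrow> real"
  assumes mono: "\<And>m n. m \<le> n \<Longrightarrow> S m \<le> S n"
    and lo: "\<And>\<epsilon>. 0 < \<epsilon> \<Longrightarrow> \<epsilon> < 1 \<Longrightarrow> \<forall>\<^sub>F k in sequentially. real (2 ^ k) powr (\<sigma> - \<epsilon>) \<le> S (2 ^ k)"
    and up: "\<And>\<epsilon>. 0 < \<epsilon> \<Longrightarrow> \<epsilon> < 1 \<Longrightarrow> \<forall>\<^sub>F k in sequentially. S (2 ^ k) \<le> real (2 ^ k) powr (\<sigma> + \<epsilon>)"
    and \<sigma>: "1 \<le> \<sigma>" and d: "0 < d" "d < 1"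
  shows "\<forall>\<^sub>F n in sequentially. real n powr (\<sigma> - d) \<le> S n \<and> S (Suc n) \<le> real n powr (\<sigma> + d)"
proof -
  obtain K where K: "\<And>k. K \<le> k \<Longrightarrow> real (2 ^ k) powr (\<sigma> - d / 2) \<le> S (2 ^ k)"
      "\<And>k. K \<le> k \<Longrightarrow> S (2 ^ k) \<le> real (2 ^ k) powr (\<sigma> + d / 2)"
  proof -
    have "\<forall>\<^sub>F k in sequentially. real (2 ^ k) powr (\<sigma> - d / 2) \<le> S (2 ^ k) \<and> S (2 ^ k) \<le> real (2 ^ k) powr (\<sigma> + d / 2)"
      using lo[of "d / 2"] up[of "d / 2"] d by (intro eventually_conj) auto
    then show ?thesis using that unfolding eventually_sequentially by blast
  qed
  have "\<forall>\<^sub>F n in sequentially. real n powr (\<sigma> - d) \<le> (real n / 2) powr (\<sigma> - d / 2)"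
    using d \<sigma> by real_asymp
  moreover have "\<forall>\<^sub>F n in sequentially. (2 * real n) powr (\<sigma> + d / 2) \<le> real n powr (\<sigma> + d)"
    using d \<sigma> by real_asymp
  ultimately show ?thesis using eventually_ge_at_top[of "2 ^ K"]
  proof eventually_elim
    case (elim n)
    have "1 \<le> n" using elim(3) by (metis le_trans one_le_numeral one_le_power)
    then obtain k where k: "2 ^ k \<le> n" "n < 2 ^ (k + 1)" using ex_power_ivl1[of 2 n] by auto
    have "(2::nat) ^ K < 2 ^ (k + 1)" using elim(3) k(2) by linarith
    then have "K < k + 1" by (rule power_less_imp_less_exp[rotated]) simp
    then have Kk: "K \<le> k" "K \<le> k + 1" by simp_all
    have "n \<le> 2 * 2 ^ k" using k(2) by simp
    then have "real n \<le> real (2 * 2 ^ k)" by (simp only: of_nat_le_iff)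
    moreover have "real (2 ^ k) \<le> real n" using k(1) by (simp only: of_nat_le_iff)
    ultimately have k': "real (2 ^ k) \<le> real n" "real n \<le> 2 * real (2 ^ k)" by simp_all
    have "real n powr (\<sigma> - d) \<le> (real n / 2) powr (\<sigma> - d / 2)" by (rule elim)
    also have "\<dots> \<le> real (2 ^ k) powr (\<sigma> - d / 2)" using k' \<sigma> d by (intro powr_mono2) auto
    also have "\<dots> \<le> S (2 ^ k)" by (rule K(1)[OF Kk(1)])
    also have "\<dots> \<le> S n" by (rule mono[OF k(1)])
    finally have 1: "real n powr (\<sigma> - d) \<le> S n" .
    have "S (Suc n) \<le> S (2 ^ (k + 1))" using k by (intro mono) simp
    also have "\<dots> \<le> real (2 ^ (k + 1)) powr (\<sigma> + d / 2)" by (rule K(2)[OF Kk(2)])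
    also have "\<dots> \<le> (2 * real n) powr (\<sigma> + d / 2)" using k' \<sigma> d by (intro powr_mono2) auto
    also have "\<dots> \<le> real n powr (\<sigma> + d)" by (rule elim)
    finally show ?case using 1 by simp
  qed
qed

text \<open>Both quotients are continuous in \<open>d\<close> at 0. The bound \<open>b\<close> later
  keeps \<open>\<gamma> - d\<close> positive.\<close>

lemma exponent_slack:
  fixes \<gamma> \<sigma> \<delta> :: real
  assumes "1 \<le> \<sigma>" "0 < \<delta>" "0 < b"
  obtains d where "0 < d" "d < 1" "d < b" "(\<gamma> + d) / (\<sigma> - d) \<le> \<gamma> / \<sigma> + \<delta>" "\<gamma> / \<sigma> - \<delta> \<le> (\<gamma> - d) / (\<sigma> + d)"
proof -
  have "((\<lambda>d. (\<gamma> + d) / (\<sigma> - d)) \<longlongrightarrow> (\<gamma> + 0) / (\<sigma> - 0)) (at_right 0)"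
    using assms by (intro tendsto_intros) auto
  then have 1: "\<forall>\<^sub>F d in at_right 0. (\<gamma> + d) / (\<sigma> - d) < \<gamma> / \<sigma> + \<delta>"
    by (rule order_tendstoD) (use assms in simp)
  have "((\<lambda>d. (\<gamma> - d) / (\<sigma> + d)) \<longlongrightarrow> (\<gamma> - 0) / (\<sigma> + 0)) (at_right 0)"
    using assms by (intro tendsto_intros) auto
  then have 2: "\<forall>\<^sub>F d in at_right 0. \<gamma> / \<sigma> - \<delta> < (\<gamma> - d) / (\<sigma> + d)"
    by (rule order_tendstoD) (use assms in simp)
  have 3: "\<forall>\<^sub>F d in at_right (0::real). 0 < d \<and> d < min 1 b"
    using eventually_at_right_real[of 0 "min 1 b"] assms(3) by (auto elim: eventually_mono)
  have "\<exists>d. 0 < d \<and> d < 1 \<and> d < b \<and> (\<gamma> + d) / (\<sigma> - d) \<le> \<gamma> / \<sigma> + \<delta> \<and> \<gamma> / \<sigma> - \<delta> \<le> (\<gamma> - d) / (\<sigma> + d)"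
    using eventually_happens[OF eventually_conj[OF 1 eventually_conj[OF 2 3]]] by (auto intro: less_imp_le)
  then show ?thesis using that by blast
qed

lemma powr_time_change_upper:
  assumes "1 \<le> n" "1 \<le> \<sigma>" "0 < d" "d < 1" "0 \<le> \<gamma>" "real n powr (\<sigma> - d) \<le> t" "1 \<le> t" "(\<gamma> + d) / (\<sigma> - d) \<le> e"
  shows "real n powr (\<gamma> + d) \<le> t powr e"
proof -
  have "real n powr (\<gamma> + d) = (real n powr (\<sigma> - d)) powr ((\<gamma> + d) / (\<sigma> - d))"
    using assms by (simp add: powr_powr)
  also have "\<dots> \<le> t powr ((\<gamma> + d) / (\<sigma> - d))" using assms by (intro powr_mono2) auto
  also have "\<dots> \<le> t powr e" using assms by (intro powr_mono) auto
  finally show ?thesis .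
qed

lemma powr_time_change_lower:
  assumes "1 \<le> n" "1 \<le> \<sigma>" "0 < d" "d \<le> \<gamma>" "1 \<le> t" "t \<le> real n powr (\<sigma> + d)" "e \<le> (\<gamma> - d) / (\<sigma> + d)"
  shows "t powr e \<le> real n powr (\<gamma> - d)"
proof -
  have "t powr e \<le> t powr ((\<gamma> - d) / (\<sigma> + d))" using assms by (intro powr_mono) auto
  also have "\<dots> \<le> (real n powr (\<sigma> + d)) powr ((\<gamma> - d) / (\<sigma> + d))" using assms by (intro powr_mono2) auto
  also have "\<dots> = real n powr (\<gamma> - d)" using assms by (simp add: powr_powr)
  finally show ?thesis .
qed

text \<open>One realization with all almost sure properties of the clock; what follows in the locale
  is deterministic.\<close>

locale clocked_path =
  fixes V :: "int ^ 'd::finite \<Rightarrow> real" and s :: "nat \<Rightarrow> (int ^ 'd) \<times> real" and \<sigma> :: real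
  assumes V: "\<And>x. 1 \<le> V x" and s: "\<And>k. 0 < snd (s k)" and \<sigma>: "1 \<le> \<sigma>"
    and clock: "\<And>d. 0 < d \<Longrightarrow> d < 1 \<Longrightarrow>
      \<forall>\<^sub>F n in sequentially. real n powr (\<sigma> - d) \<le> clk V 0 s n \<and> clk V 0 s (Suc n) \<le> real n powr (\<sigma> + d)"
begin

abbreviation "S n \<equiv> clk V 0 s n"
abbreviation "X n \<equiv> pos s n"

lemma S_less: "S n < S (Suc n)"
proof -
  have "0 < snd (s n) * V (0 + pos s n)" using s[of n] V[of "0 + pos s n"] by (intro mult_pos_pos) auto
  then show ?thesis by (simp add: clk_def)
qed

lemma S_mono: "m \<le> n \<Longrightarrow> S m \<le> S n"
proof (induction n rule: dec_induct)
  case (step n) then show ?case using S_less[of n] by linarith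
qed simp

lemma S_unbounded: "\<exists>n. t < S n"
proof -
  have "0 < (1 / 2 :: real)" "1 / 2 < (1 :: real)" by simp_all
  note clock[OF this]
  moreover have "\<forall>\<^sub>F n in sequentially. t < real n powr (1 / 2)" by real_asymp
  ultimately have "\<forall>\<^sub>F n in sequentially. t < S n" using eventually_ge_at_top[of 1]
  proof eventually_elim
    case (elim n)
    have "real n powr (1 / 2) \<le> real n powr (\<sigma> - 1 / 2)" using elim(3) \<sigma> by (intro powr_mono) auto
    then show ?case using elim by linarith
  qed
  then show ?thesis unfolding eventually_sequentially by blast
qed

lemma S_interval:
  assumes "S m \<le> t" obtains n where "m \<le> n" "S n \<le> t" "t < S (Suc n)" "J.ext_path V s t = X n"
proof -
  define n where "n = (LEAST k. t < S (Suc k))"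
  obtain k where "t < S k" using S_unbounded by blast
  then have ex: "t < S (Suc k)" using S_less[of k] by linarith
  have 2: "t < S (Suc n)" using ex unfolding n_def by (rule LeastI)
  have 1: "S n \<le> t"
  proof (cases n)
    case 0
    then show ?thesis using assms S_mono[of 0 m] by simp
  next
    case (Suc j)
    then have "\<not> t < S (Suc j)" using not_less_Least[of j "\<lambda>k. t < S (Suc k)"] by (simp add: n_def)
    then show ?thesis using Suc by simp
  qed
  have "m \<le> n"
  proof (rule ccontr)
    assume "\<not> m \<le> n"
    then have "S (Suc n) \<le> S m" by (intro S_mono) simp
    then show False using 2 assms by linarith
  qed
  moreover have "0 \<le> t" using 1 S_mono[of 0 n] by simp
  then have "J.ext_path V s t = X n"
    using walk_path_between[OF S_less 1 2] by (simp add: J.ext_path_def)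
  ultimately show ?thesis using that 1 2 by blast
qed

end

context clocked_path
begin

lemma process_upper:
  assumes \<gamma>: "0 \<le> \<gamma>"
    and walk: "\<And>d. 0 < d \<Longrightarrow> \<forall>\<^sub>F n in sequentially. norm (to_real (X n)) \<le> real n powr (\<gamma> + d)"
  shows "upper_rate (\<gamma> / \<sigma>) (J.ext_path V s)"
  unfolding upper_rate_def
proof
  fix j
  obtain d where d: "0 < d" "d < 1" "(\<gamma> + d) / (\<sigma> - d) \<le> \<gamma> / \<sigma> + inverse (real (Suc j))"
    using exponent_slack[OF \<sigma>, of "inverse (real (Suc j))" 1 \<gamma>] by auto
  have "\<forall>\<^sub>F n in sequentially. 1 \<le> n \<and> real n powr (\<sigma> - d) \<le> S n \<and> norm (to_real (X n)) \<le> real n powr (\<gamma> + d)"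
    using clock[OF d(1,2)] walk[OF d(1)] eventually_ge_at_top[of 1] by eventually_elim simp
  then obtain n0 where n0: "\<And>n. n0 \<le> n \<Longrightarrow> 1 \<le> n \<and> real n powr (\<sigma> - d) \<le> S n \<and> norm (to_real (X n)) \<le> real n powr (\<gamma> + d)"
    unfolding eventually_sequentially by blast
  obtain N :: nat where N: "S n0 \<le> real N" using real_arch_simple by blast
  show "\<exists>N::nat. \<forall>q::rat. 1 \<le> real_of_rat q \<and> real N \<le> real_of_rat q \<longrightarrow>
     norm (to_real (J.ext_path V s (real_of_rat q))) \<le> real_of_rat q powr (\<gamma> / \<sigma> + inverse (real (Suc j)))"
  proof (intro exI[of _ N] allI impI)
    fix q :: rat assume q: "1 \<le> real_of_rat q \<and> real N \<le> real_of_rat q"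
    then have "S n0 \<le> real_of_rat q" using N by linarith
    then obtain n where n: "n0 \<le> n" "S n \<le> real_of_rat q" "J.ext_path V s (real_of_rat q) = X n" by (rule S_interval)
    have "norm (to_real (X n)) \<le> real n powr (\<gamma> + d)" using n0[OF n(1)] by blast
    also have "\<dots> \<le> real_of_rat q powr (\<gamma> / \<sigma> + inverse (real (Suc j)))"
    proof (rule powr_time_change_upper[OF _ \<sigma> d(1,2) \<gamma> _ _ d(3)])
      show "real n powr (\<sigma> - d) \<le> real_of_rat q" using n0[OF n(1)] n(2) by linarith
    qed (use n0[OF n(1)] q in blast)+
    finally show "norm (to_real (J.ext_path V s (real_of_rat q))) \<le> real_of_rat q powr (\<gamma> / \<sigma> + inverse (real (Suc j)))"
      by (simp only: n(3))
  qed
qed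

lemma process_lower:
  assumes \<gamma>: "0 < \<gamma>"
    and walk: "\<And>d. 0 < d \<Longrightarrow> d < \<gamma> \<Longrightarrow> \<forall>\<^sub>F n in sequentially. real n powr (\<gamma> - d) \<le> norm (to_real (X n))"
  shows "lower_rate (\<gamma> / \<sigma>) (J.ext_path V s)"
  unfolding lower_rate_def
proof
  fix j
  obtain d where d: "0 < d" "d < 1" "d < \<gamma>" "\<gamma> / \<sigma> - inverse (real (Suc j)) \<le> (\<gamma> - d) / (\<sigma> + d)"
    using exponent_slack[OF \<sigma>, of "inverse (real (Suc j))" \<gamma> \<gamma>] \<gamma> by auto
  have "\<forall>\<^sub>F n in sequentially. 1 \<le> n \<and> S (Suc n) \<le> real n powr (\<sigma> + d) \<and> real n powr (\<gamma> - d) \<le> norm (to_real (X n))"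
    using clock[OF d(1,2)] walk[OF d(1,3)] eventually_ge_at_top[of 1] by eventually_elim simp
  then obtain n0 where n0: "\<And>n. n0 \<le> n \<Longrightarrow> 1 \<le> n \<and> S (Suc n) \<le> real n powr (\<sigma> + d) \<and> real n powr (\<gamma> - d) \<le> norm (to_real (X n))"
    unfolding eventually_sequentially by blast
  obtain N :: nat where N: "S n0 \<le> real N" using real_arch_simple by blast
  show "\<exists>N::nat. \<forall>q::rat. 1 \<le> real_of_rat q \<and> real N \<le> real_of_rat q \<longrightarrow>
     real_of_rat q powr (\<gamma> / \<sigma> - inverse (real (Suc j))) \<le> norm (to_real (J.ext_path V s (real_of_rat q)))"
  proof (intro exI[of _ N] allI impI)
    fix q :: rat assume q: "1 \<le> real_of_rat q \<and> real N \<le> real_of_rat q"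
    then have "S n0 \<le> real_of_rat q" using N by linarith
    then obtain n where n: "n0 \<le> n" "real_of_rat q < S (Suc n)" "J.ext_path V s (real_of_rat q) = X n" by (rule S_interval)
    have "real_of_rat q powr (\<gamma> / \<sigma> - inverse (real (Suc j))) \<le> real n powr (\<gamma> - d)"
    proof (rule powr_time_change_lower[OF _ \<sigma> d(1) less_imp_le[OF d(3)] _ _ d(4)])
      show "real_of_rat q \<le> real n powr (\<sigma> + d)" using n0[OF n(1)] n(2) by linarith
    qed (use n0[OF n(1)] q in blast)+
    also have "\<dots> \<le> norm (to_real (X n))" using n0[OF n(1)] by blast
    finally show "real_of_rat q powr (\<gamma> / \<sigma> - inverse (real (Suc j))) \<le> norm (to_real (J.ext_path V s (real_of_rat q)))"
      by (simp only: n(3))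
  qed
qed

text \<open>Only dyadic indices are controlled. Each sojourn interval contains a rational time, and
  at that time the process is at the dyadic position.\<close>

lemma process_recurrent_lower:
  assumes \<gamma>: "0 < \<gamma>"
    and walk: "\<And>d. 0 < d \<Longrightarrow> d < \<gamma> \<Longrightarrow> \<forall>\<^sub>F k in sequentially. real (2 ^ k) powr (\<gamma> - d) \<le> norm (to_real (X (2 ^ k)))"
  shows "recurrent_lower_rate (\<gamma> / \<sigma>) (J.ext_path V s)"
  unfolding recurrent_lower_rate_def
proof (intro allI)
  fix j N :: nat
  obtain d where d: "0 < d" "d < 1" "d < \<gamma>" "\<gamma> / \<sigma> - inverse (real (Suc j)) \<le> (\<gamma> - d) / (\<sigma> + d)"
    using exponent_slack[OF \<sigma>, of "inverse (real (Suc j))" \<gamma> \<gamma>] \<gamma> by auto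
  have "\<forall>\<^sub>F n in sequentially. 1 \<le> n \<and> S (Suc n) \<le> real n powr (\<sigma> + d)"
    using clock[OF d(1,2)] eventually_ge_at_top[of 1] by eventually_elim simp
  then obtain n0 where n0: "\<And>n. n0 \<le> n \<Longrightarrow> 1 \<le> n \<and> S (Suc n) \<le> real n powr (\<sigma> + d)"
    unfolding eventually_sequentially by blast
  obtain K where K: "\<And>k. K \<le> k \<Longrightarrow> real (2 ^ k) powr (\<gamma> - d) \<le> norm (to_real (X (2 ^ k)))"
    using walk[OF d(1,3)] unfolding eventually_sequentially by blast
  obtain m where m: "max 1 (real N) < S m" using S_unbounded by blast
  define k where "k = max m (max n0 K)"
  define n :: nat where "n = 2 ^ k"
  have "k < n" unfolding n_def by (rule less_exp)
  then have n: "m \<le> n" "n0 \<le> n" "K \<le> k" by (simp_all add: k_def)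
  obtain q' where "q' \<in> \<rat>" "S n < q'" "q' < S (Suc n)" using Rats_dense_in_real[OF S_less] by blast
  then obtain q where q: "S n < real_of_rat q" "real_of_rat q < S (Suc n)" by (metis Rats_cases)
  have "S m \<le> S n" by (rule S_mono[OF n(1)])
  moreover have "1 < S m" "real N < S m" using m by simp_all
  ultimately have q1: "1 \<le> (real_of_rat q :: real)" "real N \<le> real_of_rat q" using q(1) by linarith+
  have "0 \<le> (real_of_rat q :: real)" using q1 by linarith
  then have path: "J.ext_path V s (real_of_rat q) = X n"
    using walk_path_between[OF S_less less_imp_le[OF q(1)] q(2)] by (simp add: J.ext_path_def)
  have "real_of_rat q powr (\<gamma> / \<sigma> - inverse (real (Suc j))) \<le> real n powr (\<gamma> - d)"
  proof (rule powr_time_change_lower[OF _ \<sigma> d(1) less_imp_le[OF d(3)] q1(1) _ d(4)])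
    show "real_of_rat q \<le> real n powr (\<sigma> + d)" using n0[OF n(2)] q(2) by linarith
  qed (use n0[OF n(2)] in blast)
  also have "\<dots> \<le> norm (to_real (X n))" unfolding n_def by (rule K[OF n(3)])
  finally show "\<exists>q::rat. 1 \<le> real_of_rat q \<and> real N \<le> real_of_rat q \<and>
     real_of_rat q powr (\<gamma> / \<sigma> - inverse (real (Suc j))) \<le> norm (to_real (J.ext_path V s (real_of_rat q)))"
    using q1 path by metis
qed

end

section \<open>Almost sure rates of the process\<close>

text \<open>Monotonicity in the exponent reduces uncountably many null sets to countably many; the
  threshold \<open>m\<close> allows it to be checked for large \<open>n\<close> only.\<close>

lemma AE_all_exponents:
  assumes "\<And>j. AE z in M. \<forall>\<^sub>F n in sequentially. P n (inverse (real (Suc j))) z"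
    and "\<And>n d e z. 0 < d \<Longrightarrow> d \<le> e \<Longrightarrow> P n d z \<Longrightarrow> m \<le> n \<Longrightarrow> P n e z"
  shows "AE z in M. \<forall>e>0. \<forall>\<^sub>F n in sequentially. P n e z"
proof -
  have "AE z in M. \<forall>j. \<forall>\<^sub>F n in sequentially. P n (inverse (real (Suc j))) z"
    using assms(1) by (subst AE_all_countable) blast
  then show ?thesis
  proof eventually_elim
    case (elim z)
    show ?case
    proof (intro allI impI)
      fix e :: real assume "0 < e"
      then obtain j where j: "inverse (real (Suc j)) < e" using reals_Archimedean by blast
      from elim[rule_format, of j] eventually_ge_at_top[of m] show "\<forall>\<^sub>F n in sequentially. P n e z"
      proof eventually_elim
        case (elim n)
        then show ?case using j by (intro assms(2)[of "inverse (real (Suc j))" e]) auto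
      qed
    qed
  qed
qed

lemma clock_exp_ge_1: "0 < \<alpha> \<Longrightarrow> \<alpha> \<le> 1 \<Longrightarrow> 0 < \<xi> \<Longrightarrow> \<xi> \<le> \<beta> \<Longrightarrow> 1 \<le> clock_exp \<alpha> \<beta> \<xi>"
proof -
  assume a: "0 < \<alpha>" "\<alpha> \<le> 1" "0 < \<xi>" "\<xi> \<le> \<beta>"
  have "\<alpha> * 1 \<le> \<alpha> * (\<beta> / \<xi>)" using a by (intro mult_left_mono) auto
  then show ?thesis by (simp add: clock_exp_def)
qed

theorem AE_clocked_path:
  fixes l :: "real ^ 'd::finite"
  assumes reg: "regime lam l \<alpha>" and decay: "cluster_decay_rate TYPE('d) p \<xi>" and \<beta>: "\<xi> \<le> \<beta>"
  shows "AE z in joint p lam l. clocked_path (trap \<beta> (fst z)) (snd z) (clock_exp \<alpha> \<beta> \<xi>)"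
proof -
  have \<xi>: "0 < \<xi>" using decay by (simp add: cluster_decay_rate_def)
  have \<beta>0: "0 \<le> \<beta>" using \<xi> \<beta> by linarith
  let ?\<sigma> = "clock_exp \<alpha> \<beta> \<xi>"
  have \<sigma>: "1 \<le> ?\<sigma>" using regime_alpha[OF reg] \<xi> \<beta> by (intro clock_exp_ge_1) auto
  have "AE z in joint p lam l. \<forall>e>0. \<forall>\<^sub>F k in sequentially. real (2 ^ k) powr (?\<sigma> - e) \<le> clk (trap \<beta> (fst z)) 0 (snd z) (2 ^ k)"
  proof (rule AE_all_exponents[where m=0])
    show "AE z in joint p lam l. \<forall>\<^sub>F k in sequentially. real (2 ^ k) powr (?\<sigma> - inverse (real (Suc j))) \<le> clk (trap \<beta> (fst z)) 0 (snd z) (2 ^ k)" for j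
      by (rule clock_lower_as[OF reg decay \<beta>]) simp
    show "real (2 ^ k) powr (?\<sigma> - e) \<le> clk (trap \<beta> (fst z)) 0 (snd z) (2 ^ k)"
      if "d \<le> e" "real (2 ^ k) powr (?\<sigma> - d) \<le> clk (trap \<beta> (fst z)) 0 (snd z) (2 ^ k)" for k d e and z :: "'d env \<times> _"
      using powr_mono[of "?\<sigma> - e" "?\<sigma> - d" "real (2 ^ k)"] that by simp
  qed
  moreover have "AE z in joint p lam l. \<forall>e>0. \<forall>\<^sub>F k in sequentially. clk (trap \<beta> (fst z)) 0 (snd z) (2 ^ k) \<le> real (2 ^ k) powr (?\<sigma> + e)"
  proof (rule AE_all_exponents[where m=0])
    show "AE z in joint p lam l. \<forall>\<^sub>F k in sequentially. clk (trap \<beta> (fst z)) 0 (snd z) (2 ^ k) \<le> real (2 ^ k) powr (?\<sigma> + inverse (real (Suc j)))" for j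
      by (rule clock_upper_as[OF reg decay \<beta>]) simp
    show "clk (trap \<beta> (fst z)) 0 (snd z) (2 ^ k) \<le> real (2 ^ k) powr (?\<sigma> + e)"
      if "d \<le> e" "clk (trap \<beta> (fst z)) 0 (snd z) (2 ^ k) \<le> real (2 ^ k) powr (?\<sigma> + d)" for k d e and z :: "'d env \<times> _"
      using powr_mono[of "?\<sigma> + d" "?\<sigma> + e" "real (2 ^ k)"] that by simp
  qed
  moreover have "AE z in joint p lam l. \<forall>k. 0 < snd (snd z k)"
    by (rule AE_joint_snd[OF J.AE_holds_pos])
  moreover have "AE z in joint p lam l. \<forall>x. cluster_size (fst z) x \<noteq> \<infinity>"
    by (rule AE_joint_fst[OF AE_cluster_finite[OF decay]])
  ultimately show ?thesis
  proof eventually_elim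
    case (elim z)
    let ?S = "clk (trap \<beta> (fst z)) 0 (snd z)"
    have mono: "?S m \<le> ?S n" if "m \<le> n" for m n
      using that
    proof (induction n rule: dec_induct)
      case (step n)
      have "0 \<le> snd (snd z n) * trap \<beta> (fst z) (0 + pos (snd z) n)"
        using elim(3) by (intro mult_nonneg_nonneg trap_nonneg) (simp add: less_imp_le)
      then show ?case using step by (simp add: clk_def)
    qed simp
    show ?case
    proof
      show "1 \<le> trap \<beta> (fst z) x" for x using trap_ge_1[OF \<beta>0] elim(4) by blast
      show "0 < snd (snd z k)" for k using elim(3) by blast
      show "1 \<le> ?\<sigma>" by (rule \<sigma>)
      show "\<forall>\<^sub>F n in sequentially. real n powr (?\<sigma> - d) \<le> ?S n \<and> ?S (Suc n) \<le> real n powr (?\<sigma> + d)" if "0 < d" "d < 1" for d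
        by (rule clock_all_n[OF mono _ _ \<sigma> that]) (use elim(1,2) in blast)+
    qed
  qed
qed

text \<open>Membership in \<open>path_space\<close> is carried along because right continuity turns
  rates at rational times into limits over real times.\<close>

lemma joint_AE_transfer:
  fixes Q :: "'d::finite env \<Rightarrow> (real \<Rightarrow> int ^ 'd) measure"
  assumes Q: "\<And>\<omega>. quenched_law lam l \<beta> \<omega> (Q \<omega>)" and \<beta>: "0 \<le> \<beta>"
    and decay: "cluster_decay_rate TYPE('d) p \<xi>"
    and P: "Measurable.pred path_space P"
    and AE: "AE z in joint p lam l. P (J.ext_path (trap \<beta> (fst z)) (snd z))"
  shows "AE z in annealed_law p Q. P (snd z) \<and> snd z \<in> space path_space"
proof -
  interpret pair_prob_space "perc p" "J.marks lam l" by (rule pair_prob_joint)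
  have "Measurable.pred path_space (\<lambda>Y. P Y \<and> Y \<in> space path_space)"
  proof -
    have "{Y \<in> space path_space. P Y \<and> Y \<in> space path_space} = {Y \<in> space path_space. P Y}" by blast
    then show ?thesis using P by (simp only: pred_def)
  qed
  moreover have "AE \<omega> in perc p. AE s in J.marks lam l. P (J.ext_path (trap \<beta> \<omega>) s) \<and> J.ext_path (trap \<beta> \<omega>) s \<in> space path_space"
    using AE_pair[OF AE]
  proof eventually_elim
    case (elim \<omega>)
    then show ?case
    proof eventually_elim
      case (elim s)
      have "J.ext_path (trap \<beta> \<omega>) s \<in> space path_space"
        by (rule measurable_space[OF J.ext_path_measurable[of _ lam l]]) (simp only: J.space_marks UNIV_I)
      then show ?case using elim by simp
    qed
  qed
  ultimately show ?thesis
    using annealed_AE_transfer[OF Q \<beta> decay, of "\<lambda>Y. P Y \<and> Y \<in> space path_space"] by (simp add: split_beta')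
qed

text \<open>With drift the embedded walk has linear size at all large times, not only along powers
  of 2, so upper and lower rate coincide and the limit exists.\<close>

lemma ballistic_rate:
  fixes Q :: "'d::finite env \<Rightarrow> (real \<Rightarrow> int ^ 'd) measure"
  assumes Q: "\<And>\<omega>. quenched_law lam l \<beta> \<omega> (Q \<omega>)" and decay: "cluster_decay_rate TYPE('d) p \<xi>" and \<beta>: "\<xi> \<le> \<beta>"
    and lam: "0 < lam" and l: "norm l = 1"
  shows "AE z in annealed_law p Q. (log_ratio (snd z) \<longlongrightarrow> ereal (\<xi> / \<beta>)) at_top"
proof -
  have \<xi>: "0 < \<xi>" using decay by (simp add: cluster_decay_rate_def)
  have reg: "regime lam l 1" using lam l by (simp add: regime_def)
  let ?c = "1 / clock_exp 1 \<beta> \<xi>"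
  have c: "?c = \<xi> / \<beta>" by (simp add: clock_exp_def)
  obtain b where b: "0 < b" "AE s in J.marks lam l. \<forall>\<^sub>F n in sequentially. b * real n \<le> norm (to_real (pos s n))"
    using walk_drift_lower[OF lam l] by blast
  have "AE z in joint p lam l. upper_rate ?c (J.ext_path (trap \<beta> (fst z)) (snd z)) \<and> lower_rate ?c (J.ext_path (trap \<beta> (fst z)) (snd z))"
    using AE_clocked_path[OF reg decay \<beta>] AE_joint_snd[OF walk_trivial_upper[of lam l], of p] AE_joint_snd[OF b(2), of p]
  proof eventually_elim
    case (elim z)
    interpret clocked_path "trap \<beta> (fst z)" "snd z" "clock_exp 1 \<beta> \<xi>" by (rule elim(1))
    have "\<forall>\<^sub>F n in sequentially. norm (to_real (pos (snd z) n)) \<le> real n powr (1 + d)" if d: "0 < d" for d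
      using eventually_ge_at_top[of 1]
    proof eventually_elim
      case (elim n)
      have "norm (to_real (pos (snd z) n)) \<le> real n powr 1" using \<open>\<forall>n. norm (to_real (pos (snd z) n)) \<le> real n\<close> elim by simp
      also have "\<dots> \<le> real n powr (1 + d)" using elim d by (intro powr_mono) auto
      finally show ?case .
    qed
    moreover have "\<forall>\<^sub>F n in sequentially. real n powr (1 - d) \<le> norm (to_real (pos (snd z) n))" if d: "0 < d" "d < 1" for d
    proof -
      have "\<forall>\<^sub>F n in sequentially. real n powr (1 - d) \<le> b * real n" using b(1) d by real_asymp
      with elim(3) show ?thesis by eventually_elim linarith
    qed
    ultimately show ?case using process_upper[of 1] process_lower[of 1] by simp
  qed
  note joint = this
  note rate_measurable [measurable]
  have m: "Measurable.pred path_space (\<lambda>Y. upper_rate ?c Y \<and> lower_rate ?c Y)" by measurable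
  have \<beta>0: "0 \<le> \<beta>" using \<xi> \<beta> by linarith
  from joint_AE_transfer[OF Q \<beta>0 decay m joint] show ?thesis
    by eventually_elim (use log_ratio_tendsto c in metis)
qed

lemma diffusive_rate:
  fixes Q :: "'d::finite env \<Rightarrow> (real \<Rightarrow> int ^ 'd) measure"
  assumes Q: "\<And>\<omega>. quenched_law 0 l \<beta> \<omega> (Q \<omega>)" and decay: "cluster_decay_rate TYPE('d) p \<xi>" and \<beta>: "\<xi> \<le> \<beta>"
    and reg: "regime 0 l \<alpha>"
  shows "AE z in annealed_law p Q. Limsup at_top (log_ratio (snd z)) = ereal (1 / 2 / clock_exp \<alpha> \<beta> \<xi>)"
proof -
  have \<xi>: "0 < \<xi>" using decay by (simp add: cluster_decay_rate_def)
  let ?c = "1 / 2 / clock_exp \<alpha> \<beta> \<xi>"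
  have up: "AE s in J.marks 0 l. \<forall>d>0. \<forall>\<^sub>F n in sequentially. \<forall>i. \<bar>real_of_int (pos s n $ i)\<bar> \<le> real n powr (1 / 2 + d)"
  proof (rule AE_all_exponents[where m=1])
    show "AE s in J.marks 0 l. \<forall>\<^sub>F n in sequentially. \<forall>i. \<bar>real_of_int (pos s n $ i)\<bar> \<le> real n powr (1 / 2 + inverse (real (Suc j)))" for j
      by (rule walk_diffusive_upper) simp
    show "\<forall>i. \<bar>real_of_int (pos s n $ i)\<bar> \<le> real n powr (1 / 2 + e)"
      if "d \<le> e" "\<forall>i. \<bar>real_of_int (pos s n $ i)\<bar> \<le> real n powr (1 / 2 + d)" "1 \<le> n" for n d e and s :: "nat \<Rightarrow> (int ^ 'd) \<times> real"
    proof
      fix i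
      have "real n powr (1 / 2 + d) \<le> real n powr (1 / 2 + e)" using that by (intro powr_mono) auto
      then show "\<bar>real_of_int (pos s n $ i)\<bar> \<le> real n powr (1 / 2 + e)" using that(2)[rule_format, of i] by linarith
    qed
  qed
  have lo: "AE s in J.marks 0 l. \<forall>d>0. \<forall>\<^sub>F k in sequentially. real (2 ^ k) powr (1 / 2 - d) \<le> norm (to_real (pos s (2 ^ k)))"
  proof (rule AE_all_exponents[where m=0])
    have mono: "real (2 ^ k) powr (1 / 2 - e) \<le> norm (to_real (pos s (2 ^ k)))"
      if "d \<le> e" "real (2 ^ k) powr (1 / 2 - d) \<le> norm (to_real (pos s (2 ^ k)))" for k d e and s :: "nat \<Rightarrow> (int ^ 'd) \<times> real"
      using powr_mono[of "1 / 2 - e" "1 / 2 - d" "real (2 ^ k)"] that by simp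
    show "real (2 ^ k) powr (1 / 2 - e) \<le> norm (to_real (pos s (2 ^ k)))"
      if "d \<le> e" "real (2 ^ k) powr (1 / 2 - d) \<le> norm (to_real (pos s (2 ^ k)))" for k d e and s :: "nat \<Rightarrow> (int ^ 'd) \<times> real"
      using mono[OF that] .
    fix j
    \<comment> \<open>\<open>walk_diffusive_lower\<close> wants an exponent below
      \<open>1 / 2\<close>, which \<open>inverse (real (Suc j))\<close> is not for small
      \<open>j\<close>.\<close>
    define d where "d = min (1 / 4) (inverse (real (Suc j)))"
    have "AE s in J.marks 0 l. \<forall>\<^sub>F k in sequentially. real (2 ^ k) powr (1 / 2 - d) \<le> norm (to_real (pos s (2 ^ k)))"
      by (rule walk_diffusive_lower) (auto simp: d_def)
    then show "AE s in J.marks 0 l. \<forall>\<^sub>F k in sequentially. real (2 ^ k) powr (1 / 2 - inverse (real (Suc j))) \<le> norm (to_real (pos s (2 ^ k)))"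
    proof eventually_elim
      case (elim s)
      then show ?case by eventually_elim (rule mono[of d], simp_all add: d_def)
    qed
  qed
  have "AE z in joint p 0 l. upper_rate ?c (J.ext_path (trap \<beta> (fst z)) (snd z)) \<and> recurrent_lower_rate ?c (J.ext_path (trap \<beta> (fst z)) (snd z))"
    using AE_clocked_path[OF reg decay \<beta>] AE_joint_snd[OF up, of p] AE_joint_snd[OF lo, of p]
  proof eventually_elim
    case (elim z)
    interpret clocked_path "trap \<beta> (fst z)" "snd z" "clock_exp \<alpha> \<beta> \<xi>" by (rule elim(1))
    have "\<forall>\<^sub>F n in sequentially. norm (to_real (pos (snd z) n)) \<le> real n powr (1 / 2 + d)" if d: "0 < d" for d
    proof -
      have "\<forall>\<^sub>F n in sequentially. \<forall>i. \<bar>real_of_int (pos (snd z) n $ i)\<bar> \<le> real n powr (1 / 2 + d / 2)"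
        using elim(2) d by simp
      \<comment> \<open>Passing from coordinates to the norm costs a factor \<open>CARD('d)\<close>,
        paid by the spare \<open>d / 2\<close>.\<close>
      moreover have "\<forall>\<^sub>F n in sequentially. real CARD('d) * real n powr (1 / 2 + d / 2) \<le> real n powr (1 / 2 + d)"
        using d by real_asymp
      ultimately show ?thesis
      proof eventually_elim
        case (elim n)
        have "norm (to_real (pos (snd z) n)) \<le> (\<Sum>i\<in>UNIV. \<bar>real_of_int (pos (snd z) n $ i)\<bar>)" by (rule norm_to_real_le)
        also have "\<dots> \<le> (\<Sum>i\<in>(UNIV :: 'd set). real n powr (1 / 2 + d / 2))" using elim(1) by (intro sum_mono) simp
        also have "\<dots> = real CARD('d) * real n powr (1 / 2 + d / 2)" by simp
        finally show ?case using elim(2) by linarith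
      qed
    qed
    moreover have "\<forall>\<^sub>F k in sequentially. real (2 ^ k) powr (1 / 2 - d) \<le> norm (to_real (pos (snd z) (2 ^ k)))" if "0 < d" for d
      using elim(3) that by blast
    ultimately show ?case using process_upper[of "1 / 2"] process_recurrent_lower[of "1 / 2"] by simp
  qed
  note joint = this
  note rate_measurable [measurable]
  have m: "Measurable.pred path_space (\<lambda>Y. upper_rate ?c Y \<and> recurrent_lower_rate ?c Y)" by measurable
  have \<beta>0: "0 \<le> \<beta>" using \<xi> \<beta> by linarith
  from joint_AE_transfer[OF Q \<beta>0 decay m joint] show ?thesis
    by eventually_elim (use Limsup_log_ratio_eq in metis)
qed

theorem theorem2:
  fixes p \<beta> \<xi> lam :: real
    and l :: "real ^ 'd::finite"
    and Q :: "'d env \<Rightarrow> (real \<Rightarrow> int ^ 'd) measure"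
  assumes "0 < p" and "p < p_crit TYPE('d)"
    and "norm l = 1"
    and "cluster_decay_rate TYPE('d) p \<xi>"
    and "\<xi> \<le> \<beta>"
    and "\<And>\<omega>. quenched_law lam l \<beta> \<omega> (Q \<omega>)"
  shows "(lam > 0 \<longrightarrow>
            (AE (\<omega>, Y) in annealed_law p Q. (log_ratio Y \<longlongrightarrow> ereal (\<xi> / \<beta>)) at_top))
       \<and> (lam = 0 \<and> CARD('d) \<ge> 2 \<longrightarrow>
            (AE (\<omega>, Y) in annealed_law p Q.
               Limsup at_top (log_ratio Y) = ereal (\<xi> / (2 * \<beta>))))
       \<and> (lam = 0 \<and> CARD('d) = 1 \<longrightarrow>
            (AE (\<omega>, Y) in annealed_law p Q.
               Limsup at_top (log_ratio Y) = ereal (1 / 2 * inverse (\<beta> / (2 * \<xi>) + 1 / 2))))"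
proof (intro conjI impI)
  assume "lam > 0"
  from ballistic_rate[OF assms(6,4,5) this assms(3)]
  show "AE (\<omega>, Y) in annealed_law p Q. (log_ratio Y \<longlongrightarrow> ereal (\<xi> / \<beta>)) at_top"
    unfolding split_beta' .
next
  assume 2: "lam = 0 \<and> CARD('d) \<ge> 2"
  have Q0: "quenched_law 0 l \<beta> \<omega> (Q \<omega>)" for \<omega> using assms(6)[of \<omega>] 2 by simp
  have "regime 0 l 1" using 2 by (simp add: regime_def)
  from diffusive_rate[OF Q0 assms(4,5) this]
  have "AE z in annealed_law p Q. Limsup at_top (log_ratio (snd z)) = ereal (1 / 2 / clock_exp 1 \<beta> \<xi>)" .
  moreover have "1 / 2 / clock_exp 1 \<beta> \<xi> = \<xi> / (2 * \<beta>)" by (simp add: clock_exp_def)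
  ultimately show "AE (\<omega>, Y) in annealed_law p Q. Limsup at_top (log_ratio Y) = ereal (\<xi> / (2 * \<beta>))"
    by (simp only: split_beta')
next
  assume 1: "lam = 0 \<and> CARD('d) = 1"
  have Q0: "quenched_law 0 l \<beta> \<omega> (Q \<omega>)" for \<omega> using assms(6)[of \<omega>] 1 by simp
  have "regime 0 l (1 / 2)" using 1 by (simp add: regime_def)
  from diffusive_rate[OF Q0 assms(4,5) this]
  have "AE z in annealed_law p Q. Limsup at_top (log_ratio (snd z)) = ereal (1 / 2 / clock_exp (1 / 2) \<beta> \<xi>)" .
  moreover have "clock_exp (1 / 2) \<beta> \<xi> = \<beta> / (2 * \<xi>) + 1 / 2" by (simp add: clock_exp_def)
  then have "1 / 2 / clock_exp (1 / 2) \<beta> \<xi> = 1 / 2 * inverse (\<beta> / (2 * \<xi>) + 1 / 2)"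
    by (simp only: divide_inverse[of "1 / 2"])
  ultimately show "AE (\<omega>, Y) in annealed_law p Q. Limsup at_top (log_ratio Y) = ereal (1 / 2 * inverse (\<beta> / (2 * \<xi>) + 1 / 2))"
    by (simp only: split_beta')
qed

end
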